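(* Let $X$ be an affine Poisson variety, $Y$ an affine variety, $\phi:X\to Y$ a morphism, and $p: X\to pt$ the projection to a point. Then the space $\mathcal{O}_X/\{\mathcal{O}_Y,\mathcal{O}_X\}$ is the (underived) direct image $p_0(M_\phi(X))$ of $M_\phi(X)$ under $p$. In particular, $p_0(M(X))$ is the zeroth Poisson homology $HP_0(\mathcal{O}_X)=\mathcal{O}_X/\{\mathcal{O}_X,\mathcal{O}_X\}$.
   Context: The ground field $\mathbb{K}$ is algebraically closed of characteristic zero. A variety is a reduced separated scheme of finite type over $\mathbb{K}$. A Poisson variety is a variety whose structure sheaf carries a Poisson bracket $\{\,,\}$; $\xi_f=\{f,-\}$ is the Hamiltonian vector field of $f$. $\{\mathcal{O}_Y,\mathcal{O}_X\}$ is the linear span of all $\{\phi^*f,g\}$, $f\in\mathcal{O}_Y$, $g\in\mathcal{O}_X$. For a closed embedding $i:X\to V$ into a smooth affine variety with ideal $I_X\subset\mathcal{O}_V$, right $D$-modules on $X$ are identified via $i_*$ (Kashiwara) with right $D_V$-modules supported on $X$ (independently of $i$). $M_\phi(X)$ is the right $D$-module on $X$ such that $i_*M_\phi(X)$ is the quotient of $D_V$ by the right ideal generated by $I_X$ and by all vector fields on $V$ that preserve $I_X$ and restrict on $X$ to $\xi_{\phi^*f}$ for some $f\in\mathcal{O}_Y$. One sets $M(X):=M_{\mathrm{id}}(X)$ (with $Y=X$). The underived direct image is $p_0(M)=i_*M\otimes_{D_V}\mathcal{O}_V$. *)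

theory Defs
  imports "HOL-Algebra.Algebra"
begin

text \<open>
  An affine variety over \<open>K\<close> is given by its algebra of regular functions, a finitely generated
  reduced commutative \<open>K\<close>-algebra (the zero ring for the empty variety); morphisms of
  varieties are algebra homomorphisms in the opposite direction.
\<close>

definition char_zero :: "('k, 'e) ring_scheme \<Rightarrow> bool" where
  "char_zero K \<longleftrightarrow> (\<forall>n>0. [(n::nat)] \<cdot>\<^bsub>K\<^esub> \<one>\<^bsub>K\<^esub> \<noteq> \<zero>\<^bsub>K\<^esub>)"


subsection \<open>Polynomials in several variables\<close>

text \<open>
  The carrier and the addition are those of \<open>Indexed_Polynomials\<close>: a polynomial maps a monomial,
  i.e. a multiset of variables, to its coefficient. That theory provides neither the product of two
  polynomials nor evaluation in an algebra.
\<close>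

definition mpoly_ring :: "'k ring \<Rightarrow> nat \<Rightarrow> (nat multiset \<Rightarrow> 'k) ring" where
  "mpoly_ring K n =
     \<lparr> carrier = ring.indexed_pset K {..<n} (carrier K),
       monoid.mult = (\<lambda>p q \<mu>. \<Oplus>\<^bsub>K\<^esub>\<nu>\<in>{\<nu>. \<nu> \<subseteq># \<mu>}. p \<nu> \<otimes>\<^bsub>K\<^esub> q (\<mu> - \<nu>)),
       monoid.one = ring.indexed_const K \<one>\<^bsub>K\<^esub>,
       ring.zero = ring.indexed_const K \<zero>\<^bsub>K\<^esub>,
       ring.add = ring.indexed_padd K \<rparr>"

definition mpoly_eval ::
  "'k ring \<Rightarrow> ('k, 'a) module \<Rightarrow> (nat \<Rightarrow> 'a) \<Rightarrow> (nat multiset \<Rightarrow> 'k) \<Rightarrow> 'a" where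
  "mpoly_eval K A a p =
     (\<Oplus>\<^bsub>A\<^esub>\<mu>\<in>{\<mu>. p \<mu> \<noteq> \<zero>\<^bsub>K\<^esub>}. p \<mu> \<odot>\<^bsub>A\<^esub> (\<Otimes>\<^bsub>A\<^esub>j\<in>set_mset \<mu>. a j [^]\<^bsub>A\<^esub> count \<mu> j))"

definition mpoly_pderiv ::
  "'k ring \<Rightarrow> nat \<Rightarrow> (nat multiset \<Rightarrow> 'k) \<Rightarrow> (nat multiset \<Rightarrow> 'k)" where
  "mpoly_pderiv K j p = (\<lambda>\<mu>. [Suc (count \<mu> j)] \<cdot>\<^bsub>K\<^esub> p (add_mset j \<mu>))"


subsection \<open>Affine varieties\<close>

definition generates_algebra :: "'k ring \<Rightarrow> ('k, 'a) module \<Rightarrow> nat \<Rightarrow> (nat \<Rightarrow> 'a) \<Rightarrow> bool" where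
  "generates_algebra K A n a \<longleftrightarrow>
     a \<in> {..<n} \<rightarrow> carrier A \<and> mpoly_eval K A a ` carrier (mpoly_ring K n) = carrier A"

definition affine_variety :: "'k ring \<Rightarrow> ('k, 'a) module \<Rightarrow> bool" where
  "affine_variety K A \<longleftrightarrow>
     algebra K A \<and>
     (\<exists>n a. generates_algebra K A n a) \<and>
     (\<forall>x\<in>carrier A. \<forall>n::nat. x [^]\<^bsub>A\<^esub> n = \<zero>\<^bsub>A\<^esub> \<longrightarrow> x = \<zero>\<^bsub>A\<^esub>)"

text \<open>
  Smoothness at the closed point \<open>m\<close>, for the embedding into affine space by the generators \<open>a\<close>:
  after inverting some \<open>h\<close> that does not vanish at \<open>m\<close>, the ideal of the variety is generated by
  polynomials \<open>g\<^sub>0, \<dots>, g\<^bsub>r-1\<^esub>\<close> whose differentials at \<open>m\<close> are linearly independent over the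
  residue field of \<open>m\<close> (the last conjunct is this linear independence, written in \<open>A\<close> modulo
  \<open>m\<close>). Whether it holds does not depend on the choice of the generators.
\<close>

definition smooth_at ::
  "'k ring \<Rightarrow> ('k, 'a) module \<Rightarrow> nat \<Rightarrow> (nat \<Rightarrow> 'a) \<Rightarrow> 'a set \<Rightarrow> bool" where
  "smooth_at K A n a m \<longleftrightarrow>
     (let P = mpoly_ring K n; ev = mpoly_eval K A a; I = a_kernel P A ev in
      \<exists>(r::nat) g h.
        g \<in> {..<r} \<rightarrow> I \<and> h \<in> carrier P \<and> ev h \<notin> m \<and>
        (\<forall>f\<in>I. h \<otimes>\<^bsub>P\<^esub> f \<in> Idl\<^bsub>P\<^esub> (g ` {..<r})) \<and>
        (\<forall>c\<in>{..<r} \<rightarrow> carrier A.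
           (\<forall>j<n. (\<Oplus>\<^bsub>A\<^esub>k\<in>{..<r}. c k \<otimes>\<^bsub>A\<^esub> ev (mpoly_pderiv K j (g k))) \<in> m)
             \<longrightarrow> (\<forall>k<r. c k \<in> m)))"

definition smooth_affine_variety :: "'k ring \<Rightarrow> ('k, 'a) module \<Rightarrow> bool" where
  "smooth_affine_variety K A \<longleftrightarrow>
     affine_variety K A \<and>
     (\<exists>n a. generates_algebra K A n a \<and> (\<forall>m. maximalideal m A \<longrightarrow> smooth_at K A n a m))"

definition alg_hom ::
  "'k ring \<Rightarrow> ('k, 'a) module \<Rightarrow> ('k, 'b) module \<Rightarrow> ('a \<Rightarrow> 'b) set" where
  "alg_hom K A B =
     {h \<in> ring_hom A B. \<forall>c\<in>carrier K. \<forall>x\<in>carrier A. h (c \<odot>\<^bsub>A\<^esub> x) = c \<odot>\<^bsub>B\<^esub> h x}"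

text \<open>The comorphisms of the closed embeddings of the variety \<open>B\<close> into the variety \<open>A\<close>.\<close>

definition closed_embeddings ::
  "'k ring \<Rightarrow> ('k, 'a) module \<Rightarrow> ('k, 'b) module \<Rightarrow> ('a \<Rightarrow> 'b) set" where
  "closed_embeddings K A B = {h \<in> alg_hom K A B. h ` carrier A = carrier B}"

definition affine_poisson_variety ::
  "'k ring \<Rightarrow> ('k, 'a) module \<Rightarrow> ('a \<Rightarrow> 'a \<Rightarrow> 'a) \<Rightarrow> bool" where
  "affine_poisson_variety K A br \<longleftrightarrow>
     affine_variety K A \<and>
     (\<forall>f\<in>carrier A. \<forall>g\<in>carrier A. br f g \<in> carrier A) \<and>
     (\<forall>f\<in>carrier A. \<forall>g\<in>carrier A. \<forall>h\<in>carrier A.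
        br f (g \<oplus>\<^bsub>A\<^esub> h) = br f g \<oplus>\<^bsub>A\<^esub> br f h) \<and>
     (\<forall>c\<in>carrier K. \<forall>f\<in>carrier A. \<forall>g\<in>carrier A. br f (c \<odot>\<^bsub>A\<^esub> g) = c \<odot>\<^bsub>A\<^esub> br f g) \<and>
     (\<forall>f\<in>carrier A. \<forall>g\<in>carrier A. br f g = \<ominus>\<^bsub>A\<^esub> br g f) \<and>
     (\<forall>f\<in>carrier A. \<forall>g\<in>carrier A. \<forall>h\<in>carrier A.
        br f (br g h) \<oplus>\<^bsub>A\<^esub> br g (br h f) \<oplus>\<^bsub>A\<^esub> br h (br f g) = \<zero>\<^bsub>A\<^esub>) \<and>
     (\<forall>f\<in>carrier A. \<forall>g\<in>carrier A. \<forall>h\<in>carrier A.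
        br f (g \<otimes>\<^bsub>A\<^esub> h) = br f g \<otimes>\<^bsub>A\<^esub> h \<oplus>\<^bsub>A\<^esub> g \<otimes>\<^bsub>A\<^esub> br f h)"


subsection \<open>Modules\<close>

text \<open>
  The record type \<open>module\<close> also serves for modules over noncommutative rings. A right module is
  encoded by taking \<open>r \<odot> x\<close> to mean \<open>x \<cdot> r\<close>. The ring multiplication inherited by the record is left
  \<open>undefined\<close> where it has no meaning.
\<close>

definition gen_submodule :: "('r, 'e) ring_scheme \<Rightarrow> ('r, 'm) module \<Rightarrow> 'm set \<Rightarrow> 'm set" where
  "gen_submodule R M S = \<Inter>{N. submodule N R M \<and> S \<subseteq> N}"

definition quotient_module :: "('r, 'm) module \<Rightarrow> 'm set \<Rightarrow> ('r, 'm set) module" where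
  "quotient_module M N =
     \<lparr> carrier = a_rcosets\<^bsub>M\<^esub> N, monoid.mult = undefined, monoid.one = undefined, ring.zero = N,
       ring.add = set_add M, smult = (\<lambda>r t. \<Union>x\<in>t. N +>\<^bsub>M\<^esub> (r \<odot>\<^bsub>M\<^esub> x)) \<rparr>"

definition linear_iso :: "'k ring \<Rightarrow> ('k, 'm) module \<Rightarrow> ('k, 'n) module \<Rightarrow> ('m \<Rightarrow> 'n) \<Rightarrow> bool" where
  "linear_iso K M N T \<longleftrightarrow>
     bij_betw T (carrier M) (carrier N) \<and>
     (\<forall>x\<in>carrier M. \<forall>y\<in>carrier M. T (x \<oplus>\<^bsub>M\<^esub> y) = T x \<oplus>\<^bsub>N\<^esub> T y) \<and>
     (\<forall>c\<in>carrier K. \<forall>x\<in>carrier M. T (c \<odot>\<^bsub>M\<^esub> x) = c \<odot>\<^bsub>N\<^esub> T x)"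

text \<open>
  \<open>M \<otimes>\<^sub>D N\<close> for a right \<open>D\<close>-module \<open>M\<close> and a left \<open>D\<close>-module \<open>N\<close>: the free abelian group on
  \<open>M \<times> N\<close> modulo the usual relations. An action \<open>act\<close> of \<open>K\<close> on \<open>N\<close> that commutes with \<open>D\<close> makes it
  a \<open>K\<close>-module with \<open>c (x \<otimes> y) = x \<otimes> c y\<close>.
\<close>

definition tensor_relations ::
  "('d, 'e) ring_scheme \<Rightarrow> ('d, 'm) module \<Rightarrow> ('d, 'n) module \<Rightarrow> ('m \<times> 'n \<Rightarrow>\<^sub>0 int) set" where
  "tensor_relations D M N =
     {frag_of (x \<oplus>\<^bsub>M\<^esub> x', y) - frag_of (x, y) - frag_of (x', y) | x x' y.
        x \<in> carrier M \<and> x' \<in> carrier M \<and> y \<in> carrier N} \<union>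
     {frag_of (x, y \<oplus>\<^bsub>N\<^esub> y') - frag_of (x, y) - frag_of (x, y') | x y y'.
        x \<in> carrier M \<and> y \<in> carrier N \<and> y' \<in> carrier N} \<union>
     {frag_of (r \<odot>\<^bsub>M\<^esub> x, y) - frag_of (x, r \<odot>\<^bsub>N\<^esub> y) | r x y.
        r \<in> carrier D \<and> x \<in> carrier M \<and> y \<in> carrier N}"

definition tensor_kernel ::
  "('d, 'e) ring_scheme \<Rightarrow> ('d, 'm) module \<Rightarrow> ('d, 'n) module \<Rightarrow> ('m \<times> 'n \<Rightarrow>\<^sub>0 int) set" where
  "tensor_kernel D M N =
     generate (free_Abelian_group (carrier M \<times> carrier N)) (tensor_relations D M N)"

definition tensor ::
  "('d, 'e) ring_scheme \<Rightarrow> ('d, 'm) module \<Rightarrow> ('d, 'n) module \<Rightarrow> 'm \<Rightarrow> 'n \<Rightarrow> ('m \<times> 'n \<Rightarrow>\<^sub>0 int) set"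
  where
  "tensor D M N x y =
     tensor_kernel D M N #>\<^bsub>free_Abelian_group (carrier M \<times> carrier N)\<^esub> frag_of (x, y)"

definition tensor_product ::
  "('d, 'e) ring_scheme \<Rightarrow> ('d, 'm) module \<Rightarrow> ('d, 'n) module \<Rightarrow> ('k \<Rightarrow> 'n \<Rightarrow> 'n)
     \<Rightarrow> ('k, ('m \<times> 'n \<Rightarrow>\<^sub>0 int) set) module" where
  "tensor_product D M N act =
     (let F = free_Abelian_group (carrier M \<times> carrier N); T = tensor_kernel D M N in
      \<lparr> carrier = carrier (F Mod T), monoid.mult = undefined, monoid.one = undefined,
        ring.zero = \<one>\<^bsub>F Mod T\<^esub>, ring.add = monoid.mult (F Mod T),
        smult = (\<lambda>c t. \<Union>u\<in>t. T #>\<^bsub>F\<^esub> frag_extend (\<lambda>(x, y). frag_of (x, act c y)) u) \<rparr>)"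


subsection \<open>Differential operators\<close>

text \<open>Endomorphisms of \<open>A\<close> are represented by extensional functions on the carrier of \<open>A\<close>.\<close>

definition linear_endos :: "'k ring \<Rightarrow> ('k, 'a) module \<Rightarrow> ('a \<Rightarrow> 'a) set" where
  "linear_endos K A =
     {P \<in> carrier A \<rightarrow>\<^sub>E carrier A.
        (\<forall>x\<in>carrier A. \<forall>y\<in>carrier A. P (x \<oplus>\<^bsub>A\<^esub> y) = P x \<oplus>\<^bsub>A\<^esub> P y) \<and>
        (\<forall>c\<in>carrier K. \<forall>x\<in>carrier A. P (c \<odot>\<^bsub>A\<^esub> x) = c \<odot>\<^bsub>A\<^esub> P x)}"

definition mult_op :: "('k, 'a) module \<Rightarrow> 'a \<Rightarrow> ('a \<Rightarrow> 'a)" where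
  "mult_op A f = (\<lambda>x\<in>carrier A. f \<otimes>\<^bsub>A\<^esub> x)"

text \<open>\<open>func_commutator A P f\<close> is \<open>[P, f]\<close>, with \<open>f\<close> regarded as a multiplication operator.\<close>

definition func_commutator :: "('k, 'a) module \<Rightarrow> ('a \<Rightarrow> 'a) \<Rightarrow> 'a \<Rightarrow> ('a \<Rightarrow> 'a)" where
  "func_commutator A P f = (\<lambda>x\<in>carrier A. P (f \<otimes>\<^bsub>A\<^esub> x) \<ominus>\<^bsub>A\<^esub> f \<otimes>\<^bsub>A\<^esub> P x)"

primrec diff_ops_upto :: "'k ring \<Rightarrow> ('k, 'a) module \<Rightarrow> nat \<Rightarrow> ('a \<Rightarrow> 'a) set" where
  "diff_ops_upto K A 0 =
     {P \<in> linear_endos K A. \<forall>f\<in>carrier A. func_commutator A P f = (\<lambda>x\<in>carrier A. \<zero>\<^bsub>A\<^esub>)}"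
| "diff_ops_upto K A (Suc n) =
     {P \<in> linear_endos K A. \<forall>f\<in>carrier A. func_commutator A P f \<in> diff_ops_upto K A n}"

definition diff_op_ring :: "'k ring \<Rightarrow> ('k, 'a) module \<Rightarrow> ('a \<Rightarrow> 'a) ring" where
  "diff_op_ring K A =
     \<lparr> carrier = (\<Union>n. diff_ops_upto K A n),
       monoid.mult = compose (carrier A),
       monoid.one = (\<lambda>x\<in>carrier A. x),
       ring.zero = (\<lambda>x\<in>carrier A. \<zero>\<^bsub>A\<^esub>),
       ring.add = (\<lambda>P Q. \<lambda>x\<in>carrier A. P x \<oplus>\<^bsub>A\<^esub> Q x) \<rparr>"

definition vector_fields :: "'k ring \<Rightarrow> ('k, 'a) module \<Rightarrow> ('a \<Rightarrow> 'a) set" where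
  "vector_fields K A =
     {\<xi> \<in> linear_endos K A. \<forall>x\<in>carrier A. \<forall>y\<in>carrier A.
        \<xi> (x \<otimes>\<^bsub>A\<^esub> y) = \<xi> x \<otimes>\<^bsub>A\<^esub> y \<oplus>\<^bsub>A\<^esub> x \<otimes>\<^bsub>A\<^esub> \<xi> y}"

definition right_regular :: "'d ring \<Rightarrow> ('d, 'd) module" where
  "right_regular D =
     \<lparr> carrier = carrier D, monoid.mult = undefined, monoid.one = undefined, ring.zero = \<zero>\<^bsub>D\<^esub>,
       ring.add = ring.add D,
       smult = (\<lambda>r x. x \<otimes>\<^bsub>D\<^esub> r) \<rparr>"

definition functions_as_D_module :: "('k, 'a) module \<Rightarrow> ('a \<Rightarrow> 'a, 'a) module" where
  "functions_as_D_module A =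
     \<lparr> carrier = carrier A, monoid.mult = undefined, monoid.one = undefined, ring.zero = \<zero>\<^bsub>A\<^esub>,
       ring.add = ring.add A,
       smult = (\<lambda>P x. P x) \<rparr>"

text \<open>
  A right \<open>D\<close>-module on \<open>X\<close> is handled through its image under \<open>i\<^sub>*\<close>, a right module over the
  differential operators of a smooth affine variety \<open>V\<close> containing \<open>X\<close>. Accordingly
  \<open>direct_image_pt K V\<close> takes \<open>i\<^sub>* M\<close> as its argument.
\<close>

definition direct_image_pt ::
  "'k ring \<Rightarrow> ('k, 'v) module \<Rightarrow> ('v \<Rightarrow> 'v, 'm) module \<Rightarrow> ('k, ('m \<times> 'v \<Rightarrow>\<^sub>0 int) set) module" where
  "direct_image_pt K OV M =
     tensor_product (diff_op_ring K OV) M (functions_as_D_module OV) (smult OV)"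


subsection \<open>The D-module of a morphism from a Poisson variety\<close>

text \<open>
  \<open>phi\<close> is the comorphism from the functions on \<open>Y\<close> to the functions on \<open>X\<close>, and \<open>i\<close> is the
  restriction of functions from \<open>V\<close> to \<open>X\<close>, with kernel the ideal of \<open>X\<close>.
\<close>

definition hamiltonian_lifts ::
  "'k ring \<Rightarrow> ('k, 'x) module \<Rightarrow> ('x \<Rightarrow> 'x \<Rightarrow> 'x) \<Rightarrow> ('k, 'y) module \<Rightarrow> ('y \<Rightarrow> 'x)
     \<Rightarrow> ('k, 'v) module \<Rightarrow> ('v \<Rightarrow> 'x) \<Rightarrow> ('v \<Rightarrow> 'v) set" where
  "hamiltonian_lifts K OX br OY phi OV i =
     {\<xi> \<in> vector_fields K OV.
        \<xi> ` a_kernel OV OX i \<subseteq> a_kernel OV OX i \<and>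
        (\<exists>f\<in>carrier OY. \<forall>g\<in>carrier OV. i (\<xi> g) = br (phi f) (i g))}"

definition M_phi_ideal ::
  "'k ring \<Rightarrow> ('k, 'x) module \<Rightarrow> ('x \<Rightarrow> 'x \<Rightarrow> 'x) \<Rightarrow> ('k, 'y) module \<Rightarrow> ('y \<Rightarrow> 'x)
     \<Rightarrow> ('k, 'v) module \<Rightarrow> ('v \<Rightarrow> 'x) \<Rightarrow> ('v \<Rightarrow> 'v) set" where
  "M_phi_ideal K OX br OY phi OV i =
     gen_submodule (diff_op_ring K OV) (right_regular (diff_op_ring K OV))
       (mult_op OV ` a_kernel OV OX i \<union> hamiltonian_lifts K OX br OY phi OV i)"

definition M_phi ::
  "'k ring \<Rightarrow> ('k, 'x) module \<Rightarrow> ('x \<Rightarrow> 'x \<Rightarrow> 'x) \<Rightarrow> ('k, 'y) module \<Rightarrow> ('y \<Rightarrow> 'x)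
     \<Rightarrow> ('k, 'v) module \<Rightarrow> ('v \<Rightarrow> 'x) \<Rightarrow> ('v \<Rightarrow> 'v, ('v \<Rightarrow> 'v) set) module" where
  "M_phi K OX br OY phi OV i =
     quotient_module (right_regular (diff_op_ring K OV)) (M_phi_ideal K OX br OY phi OV i)"

definition M_poisson ::
  "'k ring \<Rightarrow> ('k, 'x) module \<Rightarrow> ('x \<Rightarrow> 'x \<Rightarrow> 'x)
     \<Rightarrow> ('k, 'v) module \<Rightarrow> ('v \<Rightarrow> 'x) \<Rightarrow> ('v \<Rightarrow> 'v, ('v \<Rightarrow> 'v) set) module" where
  "M_poisson K OX br OV i = M_phi K OX br OX (\<lambda>f. f) OV i"

definition bracket_span ::
  "'k ring \<Rightarrow> ('k, 'x) module \<Rightarrow> ('x \<Rightarrow> 'x \<Rightarrow> 'x) \<Rightarrow> ('k, 'y) module \<Rightarrow> ('y \<Rightarrow> 'x) \<Rightarrow> 'x set" where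
  "bracket_span K OX br OY phi =
     gen_submodule K OX {br (phi f) g | f g. f \<in> carrier OY \<and> g \<in> carrier OX}"

definition bracket_quotient ::
  "'k ring \<Rightarrow> ('k, 'x) module \<Rightarrow> ('x \<Rightarrow> 'x \<Rightarrow> 'x) \<Rightarrow> ('k, 'y) module \<Rightarrow> ('y \<Rightarrow> 'x)
     \<Rightarrow> ('k, 'x set) module" where
  "bracket_quotient K OX br OY phi = quotient_module OX (bracket_span K OX br OY phi)"

definition HP0 ::
  "'k ring \<Rightarrow> ('k, 'x) module \<Rightarrow> ('x \<Rightarrow> 'x \<Rightarrow> 'x) \<Rightarrow> ('k, 'x set) module" where
  "HP0 K OX br =
     quotient_module OX (gen_submodule K OX {br f g | f g. f \<in> carrier OX \<and> g \<in> carrier OX})"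

end

theory Submission
  imports Defs
begin

text \<open>
  For a right ideal \<open>J\<close> of \<open>D = D\<^sub>V\<close> one has \<open>D/J \<otimes>\<^sub>D \<O>\<^sub>V = \<O>\<^sub>V / J \<O>\<^sub>V\<close>. For the ideal defining
  \<open>M\<^sub>\<phi>(X)\<close>, the subspace \<open>J \<O>\<^sub>V\<close> is \<open>I\<^sub>X\<close> plus the span of all \<open>\<xi>(g)\<close> with \<open>\<xi>\<close> a vector field on \<open>V\<close>
  lifting a \<open>\<xi>\<^sub>f\<close>, so the quotient is \<open>\<O>\<^sub>X / {\<O>\<^sub>Y, \<O>\<^sub>X}\<close> once every \<open>\<xi>\<^sub>f\<close> is known to lift. This is where
  smoothness enters. Near a closed point \<open>m\<close>, a lift is a tuple of values on the coordinates that is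
  annihilated by the Jacobian of \<open>g\<^sub>0, \<dots>, g\<^bsub>r-1\<^esub>\<close>; the Jacobian has rank \<open>r\<close> modulo \<open>m\<close>, so an arbitrary
  lift of the coordinates can be corrected by elements of the ideal of \<open>X\<close>, at the price of a factor
  \<open>s \<notin> m\<close>. The functions \<open>s\<close> for which \<open>s \<xi>\<^sub>f\<close> lifts form an ideal contained in no maximal ideal.
\<close>

section \<open>Multivariate polynomials\<close>

text \<open>The right ideal behind \<open>M_phi\<close> contains only vector fields defined on all
  of V, whereas smoothness is a condition near one closed point. No localization is formed: local
  statements are multiplied out, all elements stay in the algebra of V, and the price is a factor
  outside the maximal ideal. Two such factors occur: \<open>ev h\<close>, because the ideal of V is
  generated by the \<open>g k\<close> only after inverting \<open>h\<close>, and \<open>s\<close>, a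
  product of pivots of the elimination.

  Correcting a coordinatewise lift \<open>u\<close> works because its defects, the values of
  \<open>dir_deriv u\<close> on the \<open>g k\<close>, restrict on X to the Hamiltonian field
  applied to zero. So right side and unknowns of the linear system both lie in the ideal of X, and
  the correction is invisible after restriction.

  The tensor product is computable because D/J is cyclic: every tensor is 1 tensor y for a function
  y. In J O_V only the values of the generators r of J matter, since r D O_V = r O_V.\<close>

lemma finite_submultisets: "finite {\<nu>. \<nu> \<subseteq># \<mu>}"
proof (induction \<mu>)
  case empty
  then show ?case by simp
next
  case (add x \<mu>)
  have "{\<nu>. \<nu> \<subseteq># add_mset x \<mu>} \<subseteq> {\<nu>. \<nu> \<subseteq># \<mu>} \<union> add_mset x ` {\<nu>. \<nu> \<subseteq># \<mu>}"
  proof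
    fix \<nu> assume "\<nu> \<in> {\<nu>. \<nu> \<subseteq># add_mset x \<mu>}"
    then have le: "\<nu> \<subseteq># add_mset x \<mu>" by simp
    show "\<nu> \<in> {\<nu>. \<nu> \<subseteq># \<mu>} \<union> add_mset x ` {\<nu>. \<nu> \<subseteq># \<mu>}"
    proof (cases "x \<in># \<nu>")
      case True
      then obtain \<rho> where "\<nu> = add_mset x \<rho>" by (meson multi_member_split)
      then show ?thesis using le by simp
    next
      case False
      then have "count \<nu> y \<le> count \<mu> y" for y
        using mset_subset_eq_count[OF le, of y] by (cases "y = x") (simp_all add: not_in_iff)
      then show ?thesis by (simp add: subseteq_mset_def)
    qed
  qed
  then show ?case using add finite_subset by blast
qed

section \<open>The ring of polynomials and its partial derivatives\<close>

locale poly_coeffs = cring K for K :: "'k ring" (structure) + fixes n :: nat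
begin

abbreviation P where "P \<equiv> mpoly_ring K n"

text \<open>The product with a constant, as \<open>mult_const\<close> confirms. The coefficientwise
  form makes additive inverses available before anything is known about the product.\<close>

definition scale :: "'k \<Rightarrow> (nat multiset \<Rightarrow> 'k) \<Rightarrow> (nat multiset \<Rightarrow> 'k)" where
  "scale c p = (\<lambda>\<mu>. c \<otimes> p \<mu>)"

lemma P_carrier: "carrier P = indexed_pset {..<n} (carrier K)"
  by (simp add: mpoly_ring_def)

lemma P_add: "p \<oplus>\<^bsub>P\<^esub> q = indexed_padd p q"
  by (simp add: mpoly_ring_def)

lemma P_zero: "\<zero>\<^bsub>P\<^esub> = indexed_const \<zero>"
  by (simp add: mpoly_ring_def)

lemma P_one: "\<one>\<^bsub>P\<^esub> = indexed_const \<one>"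
  by (simp add: mpoly_ring_def)

lemma P_mult: "p \<otimes>\<^bsub>P\<^esub> q = (\<lambda>\<mu>. \<Oplus>\<nu>\<in>{\<nu>. \<nu> \<subseteq># \<mu>}. p \<nu> \<otimes> q (\<mu> - \<nu>))"
  by (simp add: mpoly_ring_def)

lemma const_closed [simp]: "k \<in> carrier K \<Longrightarrow> indexed_const k \<in> carrier P"
  by (simp add: P_carrier indexed_pset.indexed_const)

lemma P_add_closed: "p \<in> carrier P \<Longrightarrow> q \<in> carrier P \<Longrightarrow> p \<oplus>\<^bsub>P\<^esub> q \<in> carrier P"
  by (simp add: P_add P_carrier indexed_pset.indexed_padd)

lemma pmult_closed [simp]: "p \<in> carrier P \<Longrightarrow> j < n \<Longrightarrow> indexed_pmult p j \<in> carrier P"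
  by (simp add: P_carrier indexed_pset.indexed_pmult)

lemma coeff_closed: "p \<in> carrier P \<Longrightarrow> p \<mu> \<in> carrier K"
  using indexed_pset_in_carrier[of "carrier K" p "{..<n}"]
  by (simp add: P_carrier carrier_coeff_def)

text \<open>Polynomials arise from constants by sums and by multiplication with a single variable.
  Identities for products therefore reduce to three rules in the left factor:
  \<open>mult_const\<close>, \<open>mult_add_l\<close> and \<open>mult_pmult\<close>.\<close>

lemma P_induct [consumes 1, case_names const add var]:
  assumes "p \<in> carrier P"
    and "\<And>k. k \<in> carrier K \<Longrightarrow> Q (indexed_const k)"
    and "\<And>p q. p \<in> carrier P \<Longrightarrow> q \<in> carrier P \<Longrightarrow> Q p \<Longrightarrow> Q q \<Longrightarrow> Q (p \<oplus>\<^bsub>P\<^esub> q)"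
    and "\<And>p j. p \<in> carrier P \<Longrightarrow> j < n \<Longrightarrow> Q p \<Longrightarrow> Q (indexed_pmult p j)"
  shows "Q p"
  using assms(1) unfolding P_carrier
  by (induction rule: indexed_pset.induct)
    (use assms(2-4) in \<open>auto simp: P_carrier P_add\<close>)

lemma scale_const: "scale c (indexed_const k) = indexed_const (c \<otimes> k)" if "c \<in> carrier K"
  using that by (auto simp: scale_def indexed_const_def)

lemma scale_add: "scale c (p \<oplus>\<^bsub>P\<^esub> q) = scale c p \<oplus>\<^bsub>P\<^esub> scale c q"
  if "c \<in> carrier K" "p \<in> carrier P" "q \<in> carrier P"
  using that coeff_closed by (auto simp: scale_def P_add indexed_padd_def r_distr)

lemma scale_pmult: "scale c (indexed_pmult p j) = indexed_pmult (scale c p) j"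
  if "c \<in> carrier K"
  using that by (auto simp: scale_def indexed_pmult_def)

lemma scale_closed [simp]: "scale c p \<in> carrier P" if "p \<in> carrier P" "c \<in> carrier K"
  using that(1)
  by (induction rule: P_induct) (simp_all add: scale_const scale_add scale_pmult that P_add_closed)

lemma P_abelian_group: "abelian_group P"
proof (rule abelian_groupI)
  fix p assume p: "p \<in> carrier P"
  show "\<exists>q\<in>carrier P. q \<oplus>\<^bsub>P\<^esub> p = \<zero>\<^bsub>P\<^esub>"
  proof
    show "scale (\<ominus> \<one>) p \<in> carrier P" using p by simp
    have "\<ominus> \<one> \<otimes> x \<oplus> x = \<zero>" if "x \<in> carrier K" for x
      using that by (simp add: l_minus l_neg)
    then show "scale (\<ominus> \<one>) p \<oplus>\<^bsub>P\<^esub> p = \<zero>\<^bsub>P\<^esub>"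
      using p coeff_closed by (auto simp: scale_def P_add P_zero indexed_padd_def indexed_const_def)
  qed
next
  fix p assume "p \<in> carrier P"
  then show "\<zero>\<^bsub>P\<^esub> \<oplus>\<^bsub>P\<^esub> p = p"
    using coeff_closed by (auto simp: P_add P_zero indexed_padd_def indexed_const_def)
next
  fix p q r assume "p \<in> carrier P" "q \<in> carrier P" "r \<in> carrier P"
  then show "p \<oplus>\<^bsub>P\<^esub> q \<oplus>\<^bsub>P\<^esub> r = p \<oplus>\<^bsub>P\<^esub> (q \<oplus>\<^bsub>P\<^esub> r)"
    using coeff_closed by (auto simp: P_add indexed_padd_def a_assoc)
next
  fix p q assume "p \<in> carrier P" "q \<in> carrier P"
  then show "p \<oplus>\<^bsub>P\<^esub> q = q \<oplus>\<^bsub>P\<^esub> p"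
    using coeff_closed by (auto simp: P_add indexed_padd_def a_comm)
qed (simp_all add: P_zero P_add_closed)

sublocale P: abelian_group P
  by (rule P_abelian_group)

lemma minus_eq_scale: "\<ominus>\<^bsub>P\<^esub> p = scale (\<ominus> \<one>) p" if "p \<in> carrier P"
proof (rule P.minus_equality[OF _ that])
  have "\<ominus> \<one> \<otimes> x \<oplus> x = \<zero>" if "x \<in> carrier K" for x
    using that by (simp add: l_minus l_neg)
  then show "scale (\<ominus> \<one>) p \<oplus>\<^bsub>P\<^esub> p = \<zero>\<^bsub>P\<^esub>"
    using that coeff_closed by (auto simp: scale_def P_add P_zero indexed_padd_def indexed_const_def)
qed (simp add: that)

lemma mult_add_l: "(p \<oplus>\<^bsub>P\<^esub> p') \<otimes>\<^bsub>P\<^esub> q = p \<otimes>\<^bsub>P\<^esub> q \<oplus>\<^bsub>P\<^esub> p' \<otimes>\<^bsub>P\<^esub> q"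
  if "p \<in> carrier P" "p' \<in> carrier P" "q \<in> carrier P"
  using that coeff_closed
  by (auto simp: P_mult P_add indexed_padd_def l_distr Pi_def intro!: finsum_addf)

lemma mult_const: "indexed_const k \<otimes>\<^bsub>P\<^esub> q = scale k q" if "k \<in> carrier K" "q \<in> carrier P"
proof
  fix \<mu>
  have "(\<Oplus>\<nu>\<in>{\<nu>. \<nu> \<subseteq># \<mu>}. indexed_const k \<nu> \<otimes> q (\<mu> - \<nu>))
      = (\<Oplus>\<nu>\<in>{\<nu>. \<nu> \<subseteq># \<mu>}. if {#} = \<nu> then k \<otimes> q (\<mu> - \<nu>) else \<zero>)"
    by (rule finsum_cong') (use that coeff_closed in \<open>auto simp: indexed_const_def\<close>)
  also have "\<dots> = k \<otimes> q (\<mu> - {#})"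
    by (rule finsum_singleton) (use that coeff_closed in \<open>auto simp: finite_submultisets\<close>)
  finally show "(indexed_const k \<otimes>\<^bsub>P\<^esub> q) \<mu> = scale k q \<mu>"
    by (simp add: P_mult scale_def)
qed

text \<open>On the left only submultisets that contain \<open>j\<close> contribute to the
  coefficient at \<mu>. Removing one copy of \<open>j\<close> from them and from \<mu> gives the
  convolution of \<open>p\<close> and \<open>q\<close>; if \<open>j\<close> does not occur in \<mu>,
  both sides vanish.\<close>

lemma mult_pmult: "indexed_pmult p j \<otimes>\<^bsub>P\<^esub> q = indexed_pmult (p \<otimes>\<^bsub>P\<^esub> q) j"
  if "p \<in> carrier P" "q \<in> carrier P"
proof
  fix \<mu>
  show "(indexed_pmult p j \<otimes>\<^bsub>P\<^esub> q) \<mu> = indexed_pmult (p \<otimes>\<^bsub>P\<^esub> q) j \<mu>"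
  proof (cases "j \<in># \<mu>")
    case True
    then obtain \<rho> where \<rho>: "\<mu> = add_mset j \<rho>" by (meson multi_member_split)
    have "(indexed_pmult p j \<otimes>\<^bsub>P\<^esub> q) \<mu>
        = (\<Oplus>\<nu>\<in>add_mset j ` {\<nu>. \<nu> \<subseteq># \<rho>}. p (\<nu> - {#j#}) \<otimes> q (\<mu> - \<nu>))"
      unfolding P_mult
    proof (rule add.finprod_mono_neutral_cong_right)
      show "add_mset j ` {\<nu>. \<nu> \<subseteq># \<rho>} \<subseteq> {\<nu>. \<nu> \<subseteq># \<mu>}" by (auto simp: \<rho>)
      fix \<nu> assume \<nu>: "\<nu> \<in> {\<nu>. \<nu> \<subseteq># \<mu>} - add_mset j ` {\<nu>. \<nu> \<subseteq># \<rho>}"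
      have "j \<notin># \<nu>"
      proof
        assume "j \<in># \<nu>"
        then obtain \<sigma> where "\<nu> = add_mset j \<sigma>" by (meson multi_member_split)
        then show False using \<nu> by (auto simp: \<rho>)
      qed
      then show "indexed_pmult p j \<nu> \<otimes> q (\<mu> - \<nu>) = \<zero>"
        using that coeff_closed by (simp add: indexed_pmult_def)
    qed (use that coeff_closed in \<open>auto simp: finite_submultisets indexed_pmult_def\<close>)
    also have "\<dots> = (\<Oplus>\<nu>\<in>{\<nu>. \<nu> \<subseteq># \<rho>}. p \<nu> \<otimes> q (\<rho> - \<nu>))"
      by (subst finsum_reindex) (use that coeff_closed in \<open>auto simp: \<rho> inj_on_def\<close>)
    finally show ?thesis by (simp add: \<rho> P_mult indexed_pmult_def)
  next
    case False
    then have "(\<Oplus>\<nu>\<in>{\<nu>. \<nu> \<subseteq># \<mu>}. indexed_pmult p j \<nu> \<otimes> q (\<mu> - \<nu>)) = (\<Oplus>\<nu>\<in>{\<nu>. \<nu> \<subseteq># \<mu>}. \<zero>)"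
      by (intro finsum_cong')
        (use that coeff_closed in \<open>auto simp: indexed_pmult_def dest: mset_subset_eqD\<close>)
    then show ?thesis using False by (simp add: P_mult indexed_pmult_def)
  qed
qed

text \<open>Taking the complement in \<mu> is an involution on the submultisets of \<mu> and
  exchanges the two factors of the convolution.\<close>

lemma mult_comm: "p \<otimes>\<^bsub>P\<^esub> q = q \<otimes>\<^bsub>P\<^esub> p" if "p \<in> carrier P" "q \<in> carrier P"
proof
  fix \<mu> :: "nat multiset"
  have dd: "\<mu> - (\<mu> - \<nu>) = \<nu>" if "\<nu> \<subseteq># \<mu>" for \<nu>
    using that by (auto intro!: multiset_eqI simp: subseteq_mset_def)
  have im: "(\<lambda>\<nu>. \<mu> - \<nu>) ` {\<nu>. \<nu> \<subseteq># \<mu>} = {\<nu>. \<nu> \<subseteq># \<mu>}"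
    by (auto simp: image_iff intro!: exI[of _ "\<mu> - _"] dd[symmetric])
  have inj: "inj_on (\<lambda>\<nu>. \<mu> - \<nu>) {\<nu>. \<nu> \<subseteq># \<mu>}"
    by (rule inj_on_inverseI[of _ "\<lambda>\<nu>. \<mu> - \<nu>"]) (simp add: dd)
  have "(\<Oplus>\<nu>\<in>(\<lambda>\<nu>. \<mu> - \<nu>) ` {\<nu>. \<nu> \<subseteq># \<mu>}. p \<nu> \<otimes> q (\<mu> - \<nu>))
      = (\<Oplus>\<nu>\<in>{\<nu>. \<nu> \<subseteq># \<mu>}. p (\<mu> - \<nu>) \<otimes> q (\<mu> - (\<mu> - \<nu>)))"
    by (rule finsum_reindex) (use that coeff_closed inj in auto)
  also have "\<dots> = (\<Oplus>\<nu>\<in>{\<nu>. \<nu> \<subseteq># \<mu>}. q \<nu> \<otimes> p (\<mu> - \<nu>))"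
    by (rule finsum_cong') (use that coeff_closed in \<open>auto simp: m_comm dd\<close>)
  finally show "(p \<otimes>\<^bsub>P\<^esub> q) \<mu> = (q \<otimes>\<^bsub>P\<^esub> p) \<mu>" by (simp add: P_mult im)
qed

lemma mult_closed: "p \<otimes>\<^bsub>P\<^esub> q \<in> carrier P" if "p \<in> carrier P" "q \<in> carrier P"
  using that(1)
  by (induction rule: P_induct) (simp_all add: that mult_const mult_add_l mult_pmult)

lemma mult_scale: "scale c p \<otimes>\<^bsub>P\<^esub> q = scale c (p \<otimes>\<^bsub>P\<^esub> q)"
  if "p \<in> carrier P" "q \<in> carrier P" "c \<in> carrier K"
  using that(1)
proof (induction rule: P_induct)
  case (const k)
  show ?case using that const coeff_closed
    by (simp add: scale_const mult_const) (simp add: scale_def m_assoc)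
qed (simp_all add: that scale_add mult_add_l scale_pmult mult_pmult mult_closed)

lemma mult_assoc: "(p \<otimes>\<^bsub>P\<^esub> q) \<otimes>\<^bsub>P\<^esub> r = p \<otimes>\<^bsub>P\<^esub> (q \<otimes>\<^bsub>P\<^esub> r)"
  if "p \<in> carrier P" "q \<in> carrier P" "r \<in> carrier P"
  using that(1)
  by (induction rule: P_induct)
    (simp_all add: that mult_const mult_closed mult_scale mult_add_l mult_pmult)

lemma P_cring: "cring P"
proof (rule cringI)
  show "comm_monoid P"
  proof (rule comm_monoidI)
    fix p assume p: "p \<in> carrier P"
    then show "\<one>\<^bsub>P\<^esub> \<otimes>\<^bsub>P\<^esub> p = p"
      using coeff_closed by (simp add: P_one mult_const) (simp add: scale_def)
  qed (simp_all add: P_one mult_closed mult_assoc, simp add: mult_comm)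
qed (simp_all add: P_abelian_group mult_add_l)

lemma pderiv_const: "mpoly_pderiv K j (indexed_const k) = indexed_const \<zero>" if "k \<in> carrier K"
  using that by (auto simp: mpoly_pderiv_def indexed_const_def)

lemma pderiv_add: "mpoly_pderiv K j (p \<oplus>\<^bsub>P\<^esub> q) = mpoly_pderiv K j p \<oplus>\<^bsub>P\<^esub> mpoly_pderiv K j q"
  if "p \<in> carrier P" "q \<in> carrier P"
  using that coeff_closed
  by (auto simp: mpoly_pderiv_def P_add indexed_padd_def add.nat_pow_distrib simp del: add.nat_pow_Suc)

text \<open>Product rule for a variable times \<open>p\<close>. For \<open>i = j\<close> the
  multiplicity of the variable is one larger than in the derivative of \<open>p\<close>, and the
  surplus copy of the coefficient is the summand \<open>p\<close>.\<close>

lemma pderiv_pmult: "mpoly_pderiv K j (indexed_pmult p i) =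
    indexed_pmult (mpoly_pderiv K j p) i \<oplus>\<^bsub>P\<^esub> (if i = j then p else \<zero>\<^bsub>P\<^esub>)"
  if "p \<in> carrier P"
proof
  fix \<mu>
  have c: "p \<nu> \<in> carrier K" for \<nu> using that by (rule coeff_closed)
  show "mpoly_pderiv K j (indexed_pmult p i) \<mu> =
    (indexed_pmult (mpoly_pderiv K j p) i \<oplus>\<^bsub>P\<^esub> (if i = j then p else \<zero>\<^bsub>P\<^esub>)) \<mu>"
  proof (cases "i \<in># \<mu>")
    case True
    then obtain \<rho> where \<rho>: "\<mu> = add_mset i \<rho>" by (meson multi_member_split)
    show ?thesis
      by (auto simp: \<rho> mpoly_pderiv_def indexed_pmult_def P_add P_zero indexed_padd_def
          indexed_const_def c add_mset_commute)
  next
    case False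
    then have "count \<mu> i = 0" by (simp add: not_in_iff)
    with False show ?thesis
      by (cases "i = j") (auto simp: mpoly_pderiv_def indexed_pmult_def P_add P_zero indexed_padd_def
          indexed_const_def c)
  qed
qed

lemma pderiv_closed [simp]: "mpoly_pderiv K j p \<in> carrier P" if "p \<in> carrier P"
  using that
proof (induction rule: P_induct)
  case (var p i)
  show ?case unfolding pderiv_pmult[OF var(1)]
    by (intro P.a_closed) (use var in auto)
qed (simp_all add: pderiv_const pderiv_add)

end

section \<open>Evaluation at generators and directional derivatives\<close>

locale poly_eval = poly_coeffs K n + A: algebra K A
  for K :: "'k ring" (structure) and n :: nat and A :: "('k, 'a) module" +
  fixes a :: "nat \<Rightarrow> 'a"
  assumes a_closed_fun: "a \<in> {..<n} \<rightarrow> carrier A"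
begin

abbreviation ev where "ev \<equiv> mpoly_eval K A a"

definition monom_val :: "nat multiset \<Rightarrow> 'a" where
  "monom_val \<mu> = (\<Otimes>\<^bsub>A\<^esub>j\<in>set_mset \<mu>. a j [^]\<^bsub>A\<^esub> count \<mu> j)"

text \<open>A tuple \<open>v\<close> is a candidate for the values of a vector field on the
  generators \<open>a\<close>. This is what such a field is forced to do, by the chain rule, to the
  element \<open>ev p\<close>.\<close>

definition dir_deriv :: "(nat \<Rightarrow> 'a) \<Rightarrow> (nat multiset \<Rightarrow> 'k) \<Rightarrow> 'a" where
  "dir_deriv v p = (\<Oplus>\<^bsub>A\<^esub>j\<in>{..<n}. ev (mpoly_pderiv K j p) \<otimes>\<^bsub>A\<^esub> v j)"

lemma a_in: "j < n \<Longrightarrow> a j \<in> carrier A"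
  using a_closed_fun by auto

text \<open>The index set in \<open>monom_val\<close> varies with the monomial; a common one allows
  monomials to be compared factor by factor. The added factors are zeroth powers.\<close>

lemma monom_val_eq: "monom_val \<mu> = (\<Otimes>\<^bsub>A\<^esub>j\<in>{..<n}. a j [^]\<^bsub>A\<^esub> count \<mu> j)" if "set_mset \<mu> \<subseteq> {..<n}"
  unfolding monom_val_def
  by (rule A.finprod_mono_neutral_cong_left)
    (use that a_in in \<open>auto simp: not_in_iff\<close>)

lemma monom_val_closed: "monom_val \<mu> \<in> carrier A" if "set_mset \<mu> \<subseteq> {..<n}"
  using a_in by (auto simp: monom_val_eq[OF that] intro!: A.finprod_closed)

lemma monom_val_add: "monom_val (add_mset i \<mu>) = a i \<otimes>\<^bsub>A\<^esub> monom_val \<mu>"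
  if "set_mset \<mu> \<subseteq> {..<n}" "i < n"
proof -
  have "monom_val (add_mset i \<mu>) = (\<Otimes>\<^bsub>A\<^esub>j\<in>{..<n}. a j [^]\<^bsub>A\<^esub> count (add_mset i \<mu>) j)"
    by (rule monom_val_eq) (use that in auto)
  also have "\<dots> = (\<Otimes>\<^bsub>A\<^esub>j\<in>{..<n}. (if i = j then a j else \<one>\<^bsub>A\<^esub>) \<otimes>\<^bsub>A\<^esub> a j [^]\<^bsub>A\<^esub> count \<mu> j)"
    by (rule A.finprod_cong') (use a_in in \<open>auto simp: A.m_comm\<close>)
  also have "\<dots> = (\<Otimes>\<^bsub>A\<^esub>j\<in>{..<n}. if i = j then a j else \<one>\<^bsub>A\<^esub>) \<otimes>\<^bsub>A\<^esub> monom_val \<mu>"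
    by (subst A.finprod_multf) (use a_in in \<open>auto simp: monom_val_eq[OF that(1)]\<close>)
  also have "(\<Otimes>\<^bsub>A\<^esub>j\<in>{..<n}. if i = j then a j else \<one>\<^bsub>A\<^esub>) = a i"
    by (rule A.finprod_singleton) (use a_in that in auto)
  finally show ?thesis .
qed

text \<open>A \<open>finsum\<close> over an infinite set is zero by default, so
  \<open>mpoly_eval\<close> has its intended meaning only by the first half. The second half keeps
  every \<open>a j\<close> that occurs inside the carrier.\<close>

lemma finite_support:
  assumes "p \<in> carrier P"
  shows "finite {\<mu>. p \<mu> \<noteq> \<zero>} \<and> (\<forall>\<mu>. p \<mu> \<noteq> \<zero> \<longrightarrow> set_mset \<mu> \<subseteq> {..<n})"
  using assms
proof (induction rule: P_induct)
  case (const k)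
  have "{\<mu>. indexed_const k \<mu> \<noteq> \<zero>} \<subseteq> {{#}}" by (auto simp: indexed_const_def)
  then show ?case using finite_subset by (fastforce simp: indexed_const_def)
next
  case (add p q)
  have "{\<mu>. (p \<oplus>\<^bsub>P\<^esub> q) \<mu> \<noteq> \<zero>} \<subseteq> {\<mu>. p \<mu> \<noteq> \<zero>} \<union> {\<mu>. q \<mu> \<noteq> \<zero>}"
    by (auto simp: P_add indexed_padd_def)
  moreover from this have "finite {\<mu>. (p \<oplus>\<^bsub>P\<^esub> q) \<mu> \<noteq> \<zero>}"
    using add.IH finite_subset by blast
  ultimately show ?case using add.IH by blast
next
  case (var p j)
  have "{\<mu>. indexed_pmult p j \<mu> \<noteq> \<zero>} \<subseteq> add_mset j ` {\<mu>. p \<mu> \<noteq> \<zero>}"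
    by (auto simp: indexed_pmult_def image_iff split: if_splits intro!: exI[of _ "_ - {#j#}"])
  moreover from this have "finite {\<mu>. indexed_pmult p j \<mu> \<noteq> \<zero>}"
    using var.IH finite_surj by blast
  ultimately show ?case using var by fastforce
qed

text \<open>Coefficients may cancel in a sum of polynomials, so supports do not add up exactly. Any
  finite set of admissible monomials above the support will serve, in particular one common to
  several polynomials.\<close>

lemma ev_eq_sum:
  assumes "p \<in> carrier P" "finite F" "{\<mu>. p \<mu> \<noteq> \<zero>} \<subseteq> F" "\<And>\<mu>. \<mu> \<in> F \<Longrightarrow> set_mset \<mu> \<subseteq> {..<n}"
  shows "ev p = (\<Oplus>\<^bsub>A\<^esub>\<mu>\<in>F. p \<mu> \<odot>\<^bsub>A\<^esub> monom_val \<mu>)"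
  unfolding mpoly_eval_def monom_val_def[symmetric]
  by (rule A.add.finprod_mono_neutral_cong_left)
    (use assms in \<open>auto simp: monom_val_closed coeff_closed\<close>)

lemma ev_closed [simp]: "ev p \<in> carrier A" if "p \<in> carrier P"
  unfolding mpoly_eval_def monom_val_def[symmetric]
  by (rule A.finsum_closed) (use that finite_support[OF that] in \<open>auto simp: monom_val_closed coeff_closed\<close>)

lemma ev_const: "ev (indexed_const k) = k \<odot>\<^bsub>A\<^esub> \<one>\<^bsub>A\<^esub>" if "k \<in> carrier K"
proof -
  have "ev (indexed_const k) = (\<Oplus>\<^bsub>A\<^esub>\<mu>\<in>{{#}}. indexed_const k \<mu> \<odot>\<^bsub>A\<^esub> monom_val \<mu>)"
    by (rule ev_eq_sum[OF const_closed[OF that]]) (auto simp: indexed_const_def)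
  then show ?thesis using that by (simp add: indexed_const_def monom_val_def)
qed

lemma ev_zero: "ev \<zero>\<^bsub>P\<^esub> = \<zero>\<^bsub>A\<^esub>"
  by (simp add: P_zero ev_const)

lemma ev_add: "ev (p \<oplus>\<^bsub>P\<^esub> q) = ev p \<oplus>\<^bsub>A\<^esub> ev q" if "p \<in> carrier P" "q \<in> carrier P"
proof -
  let ?F = "{\<mu>. p \<mu> \<noteq> \<zero>} \<union> {\<mu>. q \<mu> \<noteq> \<zero>}"
  note sp = finite_support[OF that(1)] and sq = finite_support[OF that(2)]
  have F: "finite ?F" "\<And>\<mu>. \<mu> \<in> ?F \<Longrightarrow> set_mset \<mu> \<subseteq> {..<n}" using sp sq by blast+
  have "ev (p \<oplus>\<^bsub>P\<^esub> q) = (\<Oplus>\<^bsub>A\<^esub>\<mu>\<in>?F. (p \<oplus>\<^bsub>P\<^esub> q) \<mu> \<odot>\<^bsub>A\<^esub> monom_val \<mu>)"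
    by (rule ev_eq_sum) (use that F P_add_closed in \<open>auto simp: P_add indexed_padd_def\<close>)
  also have "\<dots> = (\<Oplus>\<^bsub>A\<^esub>\<mu>\<in>?F. p \<mu> \<odot>\<^bsub>A\<^esub> monom_val \<mu> \<oplus>\<^bsub>A\<^esub> q \<mu> \<odot>\<^bsub>A\<^esub> monom_val \<mu>)"
    by (rule A.finsum_cong')
      (use that F(2) in \<open>auto simp: P_add indexed_padd_def coeff_closed monom_val_closed A.smult_l_distr\<close>)
  also have "\<dots> = (\<Oplus>\<^bsub>A\<^esub>\<mu>\<in>?F. p \<mu> \<odot>\<^bsub>A\<^esub> monom_val \<mu>) \<oplus>\<^bsub>A\<^esub> (\<Oplus>\<^bsub>A\<^esub>\<mu>\<in>?F. q \<mu> \<odot>\<^bsub>A\<^esub> monom_val \<mu>)"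
    by (rule A.finsum_addf) (use that F(2) in \<open>auto simp: coeff_closed monom_val_closed\<close>)
  also have "\<dots> = ev p \<oplus>\<^bsub>A\<^esub> ev q"
    using ev_eq_sum[OF that(1) F(1) _ F(2)] ev_eq_sum[OF that(2) F(1) _ F(2)] by simp
  finally show ?thesis .
qed

lemma ev_pmult: "ev (indexed_pmult p i) = a i \<otimes>\<^bsub>A\<^esub> ev p" if "p \<in> carrier P" "i < n"
proof -
  let ?F = "{\<mu>. p \<mu> \<noteq> \<zero>}"
  have F: "finite ?F" "\<And>\<mu>. \<mu> \<in> ?F \<Longrightarrow> set_mset \<mu> \<subseteq> {..<n}" using finite_support[OF that(1)] by blast+
  have F': "x < n" if "p \<mu> \<noteq> \<zero>" "x \<in># \<mu>" for x \<mu> using F(2)[of \<mu>] that by auto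
  have cl: "monom_val \<mu> \<in> carrier A" if "\<mu> \<in> ?F" for \<mu>
    using F(2) that monom_val_closed by blast
  have "ev (indexed_pmult p i) = (\<Oplus>\<^bsub>A\<^esub>\<mu>\<in>add_mset i ` ?F. indexed_pmult p i \<mu> \<odot>\<^bsub>A\<^esub> monom_val \<mu>)"
    by (rule ev_eq_sum[OF pmult_closed[OF that]])
      (use that F F' in \<open>auto simp: indexed_pmult_def image_iff split: if_splits intro!: exI[of _ "_ - {#i#}"]\<close>)
  also have "\<dots> = (\<Oplus>\<^bsub>A\<^esub>\<mu>\<in>?F. p \<mu> \<odot>\<^bsub>A\<^esub> monom_val (add_mset i \<mu>))"
    by (subst A.finsum_reindex)
      (use that F' in \<open>auto simp: indexed_pmult_def inj_on_def coeff_closed intro!: A.smult_closed monom_val_closed\<close>)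
  also have "\<dots> = (\<Oplus>\<^bsub>A\<^esub>\<mu>\<in>?F. a i \<otimes>\<^bsub>A\<^esub> (p \<mu> \<odot>\<^bsub>A\<^esub> monom_val \<mu>))"
    by (rule A.finsum_cong')
      (use that F(2) a_in cl in \<open>auto simp: monom_val_add coeff_closed A.m_comm[of "a i"] A.smult_assoc2\<close>)
  also have "\<dots> = a i \<otimes>\<^bsub>A\<^esub> ev p"
    unfolding mpoly_eval_def monom_val_def[symmetric]
    by (rule A.finsum_rdistr[symmetric]) (use that F a_in cl in \<open>auto simp: coeff_closed\<close>)
  finally show ?thesis .
qed

lemma ev_scale: "ev (scale c p) = c \<odot>\<^bsub>A\<^esub> ev p" if "p \<in> carrier P" "c \<in> carrier K"
  using that(1)
proof (induction rule: P_induct)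
  case (var p j)
  then show ?case
    using that(2) a_in by (simp add: scale_pmult ev_pmult A.m_comm[of "a j"] A.smult_assoc2)
qed (use that(2) in \<open>simp_all add: scale_const ev_const scale_add ev_add A.smult_r_distr A.smult_assoc1\<close>)

lemma ev_mult: "ev (p \<otimes>\<^bsub>P\<^esub> q) = ev p \<otimes>\<^bsub>A\<^esub> ev q" if "p \<in> carrier P" "q \<in> carrier P"
  using that(1)
proof (induction rule: P_induct)
  case (var p j)
  then show ?case
    using that(2) a_in by (simp add: mult_pmult mult_closed ev_pmult A.m_assoc)
qed (use that(2) in \<open>simp_all add: mult_const ev_const ev_scale mult_add_l mult_closed ev_add
      A.l_distr A.smult_assoc2\<close>)

context
  fixes v assumes v: "v \<in> {..<n} \<rightarrow> carrier A"
begin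

lemma v_in: "j < n \<Longrightarrow> v j \<in> carrier A"
  using v by auto

lemma dir_deriv_closed [simp]: "dir_deriv v p \<in> carrier A" if "p \<in> carrier P"
  unfolding dir_deriv_def by (rule A.finsum_closed) (use that v_in in auto)

lemma dir_deriv_const: "dir_deriv v (indexed_const k) = \<zero>\<^bsub>A\<^esub>" if "k \<in> carrier K"
  using that v_in by (simp add: dir_deriv_def pderiv_const P_zero[symmetric] ev_zero A.finsum_zero
    cong: A.finsum_cong)

lemma dir_deriv_add: "dir_deriv v (p \<oplus>\<^bsub>P\<^esub> q) = dir_deriv v p \<oplus>\<^bsub>A\<^esub> dir_deriv v q"
  if "p \<in> carrier P" "q \<in> carrier P"
proof -
  have "dir_deriv v (p \<oplus>\<^bsub>P\<^esub> q) = (\<Oplus>\<^bsub>A\<^esub>j\<in>{..<n}. ev (mpoly_pderiv K j p) \<otimes>\<^bsub>A\<^esub> v j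
      \<oplus>\<^bsub>A\<^esub> ev (mpoly_pderiv K j q) \<otimes>\<^bsub>A\<^esub> v j)"
    unfolding dir_deriv_def
    by (rule A.finsum_cong') (use that v_in in \<open>auto simp: pderiv_add ev_add A.l_distr\<close>)
  also have "\<dots> = dir_deriv v p \<oplus>\<^bsub>A\<^esub> dir_deriv v q"
    unfolding dir_deriv_def by (rule A.finsum_addf) (use that v_in in auto)
  finally show ?thesis .
qed

lemma dir_deriv_pmult: "dir_deriv v (indexed_pmult p i) = a i \<otimes>\<^bsub>A\<^esub> dir_deriv v p \<oplus>\<^bsub>A\<^esub> ev p \<otimes>\<^bsub>A\<^esub> v i"
  if "p \<in> carrier P" "i < n"
proof -
  have "dir_deriv v (indexed_pmult p i) = (\<Oplus>\<^bsub>A\<^esub>j\<in>{..<n}. a i \<otimes>\<^bsub>A\<^esub> (ev (mpoly_pderiv K j p) \<otimes>\<^bsub>A\<^esub> v j)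
      \<oplus>\<^bsub>A\<^esub> (if i = j then ev p \<otimes>\<^bsub>A\<^esub> v j else \<zero>\<^bsub>A\<^esub>))"
    unfolding dir_deriv_def
    by (rule A.finsum_cong')
      (use that v_in a_in in \<open>auto simp: pderiv_pmult ev_add ev_zero ev_pmult A.l_distr A.m_assoc\<close>)
  also have "\<dots> = (\<Oplus>\<^bsub>A\<^esub>j\<in>{..<n}. a i \<otimes>\<^bsub>A\<^esub> (ev (mpoly_pderiv K j p) \<otimes>\<^bsub>A\<^esub> v j))
      \<oplus>\<^bsub>A\<^esub> (\<Oplus>\<^bsub>A\<^esub>j\<in>{..<n}. if i = j then ev p \<otimes>\<^bsub>A\<^esub> v j else \<zero>\<^bsub>A\<^esub>)"
    by (rule A.finsum_addf) (use that v_in a_in in auto)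
  also have "(\<Oplus>\<^bsub>A\<^esub>j\<in>{..<n}. a i \<otimes>\<^bsub>A\<^esub> (ev (mpoly_pderiv K j p) \<otimes>\<^bsub>A\<^esub> v j)) = a i \<otimes>\<^bsub>A\<^esub> dir_deriv v p"
    unfolding dir_deriv_def
    by (rule A.finsum_rdistr[symmetric]) (use that v_in a_in in auto)
  also have "(\<Oplus>\<^bsub>A\<^esub>j\<in>{..<n}. if i = j then ev p \<otimes>\<^bsub>A\<^esub> v j else \<zero>\<^bsub>A\<^esub>) = ev p \<otimes>\<^bsub>A\<^esub> v i"
    by (rule A.add.finprod_singleton) (use that v_in in auto)
  finally show ?thesis .
qed

lemma dir_deriv_scale: "dir_deriv v (scale c p) = c \<odot>\<^bsub>A\<^esub> dir_deriv v p"
  if "p \<in> carrier P" "c \<in> carrier K"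
  using that(1)
proof (induction rule: P_induct)
  case (var p j)
  then show ?case
    using that(2) a_in v_in
    by (simp add: scale_pmult dir_deriv_pmult ev_scale A.m_comm[of "a j"] A.smult_assoc2 A.smult_r_distr)
qed (use that(2) in \<open>simp_all add: scale_const dir_deriv_const scale_add dir_deriv_add A.smult_r_distr\<close>)

text \<open>When one factor lies in the kernel of \<open>ev\<close>, only one summand survives. In
  this form the rule later carries vanishing from generators to an ideal and extracts the factor
  \<open>ev h\<close>.\<close>

lemma dir_deriv_mult: "dir_deriv v (p \<otimes>\<^bsub>P\<^esub> q) = dir_deriv v p \<otimes>\<^bsub>A\<^esub> ev q \<oplus>\<^bsub>A\<^esub> ev p \<otimes>\<^bsub>A\<^esub> dir_deriv v q"
  if "p \<in> carrier P" "q \<in> carrier P"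
  using that(1)
proof (induction rule: P_induct)
  case (const k)
  then show ?case
    using that(2) by (simp add: mult_const dir_deriv_scale dir_deriv_const ev_const A.smult_assoc2)
next
  case (add p p')
  have *: "(x \<oplus>\<^bsub>A\<^esub> x') \<otimes>\<^bsub>A\<^esub> e \<oplus>\<^bsub>A\<^esub> (y \<oplus>\<^bsub>A\<^esub> y') \<otimes>\<^bsub>A\<^esub> t =
      (x \<otimes>\<^bsub>A\<^esub> e \<oplus>\<^bsub>A\<^esub> y \<otimes>\<^bsub>A\<^esub> t) \<oplus>\<^bsub>A\<^esub> (x' \<otimes>\<^bsub>A\<^esub> e \<oplus>\<^bsub>A\<^esub> y' \<otimes>\<^bsub>A\<^esub> t)"
    if "x \<in> carrier A" "x' \<in> carrier A" "y \<in> carrier A" "y' \<in> carrier A" "e \<in> carrier A" "t \<in> carrier A"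
    for x x' y y' e t
    using that by (simp add: A.l_distr A.a_ac)
  show ?case
    using add that(2) by (simp add: mult_add_l mult_closed dir_deriv_add ev_add *)
next
  case (var p j)
  have *: "b \<otimes>\<^bsub>A\<^esub> (x \<otimes>\<^bsub>A\<^esub> e \<oplus>\<^bsub>A\<^esub> y \<otimes>\<^bsub>A\<^esub> t) \<oplus>\<^bsub>A\<^esub> (y \<otimes>\<^bsub>A\<^esub> e) \<otimes>\<^bsub>A\<^esub> w =
      (b \<otimes>\<^bsub>A\<^esub> x \<oplus>\<^bsub>A\<^esub> y \<otimes>\<^bsub>A\<^esub> w) \<otimes>\<^bsub>A\<^esub> e \<oplus>\<^bsub>A\<^esub> b \<otimes>\<^bsub>A\<^esub> y \<otimes>\<^bsub>A\<^esub> t"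
    if "x \<in> carrier A" "b \<in> carrier A" "y \<in> carrier A" "w \<in> carrier A" "e \<in> carrier A" "t \<in> carrier A"
    for x b y w e t
    using that by (simp add: A.l_distr A.r_distr A.a_ac A.m_ac)
  show ?case
    using var that(2) a_in v_in
    by (simp add: mult_pmult mult_closed dir_deriv_pmult ev_pmult ev_mult *)
qed

end

end

section \<open>Lifting derivations to a smooth variety\<close>

text \<open>Descent along the surjection \<open>ev\<close>: polynomials with equal value differ by
  an element of its kernel, on which \<open>dir_deriv v\<close> vanishes. So the relations between
  the generators are the only obstruction to prescribing the values of a vector field on
  them.\<close>

lemma (in poly_eval) derivation_exists:
  assumes surj: "ev ` carrier P = carrier A" and v: "v \<in> {..<n} \<rightarrow> carrier A"
    and kills: "\<And>p. p \<in> carrier P \<Longrightarrow> ev p = \<zero>\<^bsub>A\<^esub> \<Longrightarrow> dir_deriv v p = \<zero>\<^bsub>A\<^esub>"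
  obtains \<xi> where "\<xi> \<in> vector_fields K A" "\<And>p. p \<in> carrier P \<Longrightarrow> \<xi> (ev p) = dir_deriv v p"
proof -
  note [simp] = dir_deriv_closed[OF v]
  define c where "c x = (SOME p. p \<in> carrier P \<and> ev p = x)" for x
  define \<xi> where "\<xi> = (\<lambda>x\<in>carrier A. dir_deriv v (c x))"
  have c: "c (ev p) \<in> carrier P \<and> ev (c (ev p)) = ev p" if "p \<in> carrier P" for p
    unfolding c_def by (rule someI[of _ p]) (use that in simp)
  have \<xi>: "\<xi> (ev p) = dir_deriv v p" if p: "p \<in> carrier P" for p
  proof -
    let ?q = "c (ev p)"
    have q: "?q \<in> carrier P" "ev ?q = ev p" using c[OF p] by auto
    have "dir_deriv v (?q \<oplus>\<^bsub>P\<^esub> scale (\<ominus> \<one>) p) = \<zero>\<^bsub>A\<^esub>"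
      by (rule kills) (use p q in \<open>simp_all add: P_add_closed ev_add ev_scale A.smult_l_minus A.r_neg\<close>)
    then have "dir_deriv v ?q \<oplus>\<^bsub>A\<^esub> \<ominus>\<^bsub>A\<^esub> dir_deriv v p = \<zero>\<^bsub>A\<^esub>"
      using p q by (simp add: dir_deriv_add[OF v] dir_deriv_scale[OF v] A.smult_l_minus)
    then have "dir_deriv v ?q = dir_deriv v p"
      using p q by (metis A.add.inv_closed A.minus_equality A.minus_minus dir_deriv_closed[OF v])
    then show ?thesis using p by (simp add: \<xi>_def)
  qed
  have ob: "\<exists>p. p \<in> carrier P \<and> x = ev p" if "x \<in> carrier A" for x
    using that surj by blast
  have "\<xi> \<in> carrier A \<rightarrow>\<^sub>E carrier A"
    unfolding \<xi>_def using ob c by (fastforce intro!: dir_deriv_closed[OF v])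
  moreover have "\<xi> (x \<oplus>\<^bsub>A\<^esub> y) = \<xi> x \<oplus>\<^bsub>A\<^esub> \<xi> y" if xy: "x \<in> carrier A" "y \<in> carrier A" for x y
  proof -
    obtain p q where "p \<in> carrier P" "x = ev p" "q \<in> carrier P" "y = ev q" using ob xy by blast
    then show ?thesis using \<xi>[of "p \<oplus>\<^bsub>P\<^esub> q"] by (simp add: \<xi> ev_add P_add_closed dir_deriv_add[OF v])
  qed
  moreover have "\<xi> (x \<otimes>\<^bsub>A\<^esub> y) = \<xi> x \<otimes>\<^bsub>A\<^esub> y \<oplus>\<^bsub>A\<^esub> x \<otimes>\<^bsub>A\<^esub> \<xi> y"
    if xy: "x \<in> carrier A" "y \<in> carrier A" for x y
  proof -
    obtain p q where "p \<in> carrier P" "x = ev p" "q \<in> carrier P" "y = ev q" using ob xy by blast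
    then show ?thesis using \<xi>[of "p \<otimes>\<^bsub>P\<^esub> q"] by (simp add: \<xi> ev_mult mult_closed dir_deriv_mult[OF v])
  qed
  moreover have "\<xi> (k \<odot>\<^bsub>A\<^esub> x) = k \<odot>\<^bsub>A\<^esub> \<xi> x" if kx: "k \<in> carrier K" "x \<in> carrier A" for k x
  proof -
    obtain p where "p \<in> carrier P" "x = ev p" using ob kx by blast
    then show ?thesis using \<xi>[of "scale k p"] kx by (simp add: \<xi> ev_scale dir_deriv_scale[OF v])
  qed
  ultimately have "\<xi> \<in> vector_fields K A" by (simp add: vector_fields_def linear_endos_def)
  then show ?thesis using \<xi> that by blast
qed

text \<open>Derivations of \<open>A\<close> with values in \<open>B\<close>, where \<open>A\<close>
  acts on \<open>B\<close> through \<open>i\<close>. The map taking \<open>g\<close> to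
  \<open>br (phi f) (i g)\<close> is of this kind, and lifting a Hamiltonian field means factoring
  such a map through \<open>i\<close>.\<close>

definition derivation_along ::
  "'k ring \<Rightarrow> ('k, 'a) module \<Rightarrow> ('k, 'b) module \<Rightarrow> ('a \<Rightarrow> 'b) \<Rightarrow> ('a \<Rightarrow> 'b) \<Rightarrow> bool" where
  "derivation_along K A B i \<delta> \<longleftrightarrow>
     (\<forall>x\<in>carrier A. \<delta> x \<in> carrier B) \<and>
     (\<forall>x\<in>carrier A. \<forall>y\<in>carrier A. \<delta> (x \<oplus>\<^bsub>A\<^esub> y) = \<delta> x \<oplus>\<^bsub>B\<^esub> \<delta> y) \<and>
     (\<forall>c\<in>carrier K. \<forall>x\<in>carrier A. \<delta> (c \<odot>\<^bsub>A\<^esub> x) = c \<odot>\<^bsub>B\<^esub> \<delta> x) \<and>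
     (\<forall>x\<in>carrier A. \<forall>y\<in>carrier A. \<delta> (x \<otimes>\<^bsub>A\<^esub> y) = \<delta> x \<otimes>\<^bsub>B\<^esub> i y \<oplus>\<^bsub>B\<^esub> i x \<otimes>\<^bsub>B\<^esub> \<delta> y)"

text \<open>Both sides, as functions of \<open>p\<close>, are derivations along the composite of
  \<open>ev\<close> and \<open>i\<close>, and they agree on constants and on variables. The lifts
  \<open>u j\<close> may be chosen independently of each other.\<close>

lemma (in poly_eval) chain_rule:
  assumes B: "algebra K B" and i: "i \<in> alg_hom K A B"
    and \<delta>: "derivation_along K A B i \<delta>"
    and u: "u \<in> {..<n} \<rightarrow> carrier A" "\<And>j. j < n \<Longrightarrow> i (u j) = \<delta> (a j)"
    and p: "p \<in> carrier P"
  shows "\<delta> (ev p) = i (dir_deriv u p)"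
proof -
  interpret B: algebra K B by (rule B)
  have \<delta>_closed: "\<And>x. x \<in> carrier A \<Longrightarrow> \<delta> x \<in> carrier B"
    and \<delta>_add: "\<And>x y. x \<in> carrier A \<Longrightarrow> y \<in> carrier A \<Longrightarrow> \<delta> (x \<oplus>\<^bsub>A\<^esub> y) = \<delta> x \<oplus>\<^bsub>B\<^esub> \<delta> y"
    and \<delta>_smult: "\<And>k x. k \<in> carrier K \<Longrightarrow> x \<in> carrier A \<Longrightarrow> \<delta> (k \<odot>\<^bsub>A\<^esub> x) = k \<odot>\<^bsub>B\<^esub> \<delta> x"
    and \<delta>_mult: "\<And>x y. x \<in> carrier A \<Longrightarrow> y \<in> carrier A \<Longrightarrow>
                 \<delta> (x \<otimes>\<^bsub>A\<^esub> y) = \<delta> x \<otimes>\<^bsub>B\<^esub> i y \<oplus>\<^bsub>B\<^esub> i x \<otimes>\<^bsub>B\<^esub> \<delta> y"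
    using \<delta> by (simp_all add: derivation_along_def)
  have "i \<in> ring_hom A B" using i by (simp add: alg_hom_def)
  then interpret i: ring_hom_ring A B i
    by (intro ring_hom_ringI2 cring.axioms(1) A.M_cring B.M_cring)
  have "\<delta> \<one>\<^bsub>A\<^esub> = \<delta> \<one>\<^bsub>A\<^esub> \<oplus>\<^bsub>B\<^esub> \<delta> \<one>\<^bsub>A\<^esub>"
    using \<delta>_mult[of "\<one>\<^bsub>A\<^esub>" "\<one>\<^bsub>A\<^esub>"] \<delta>_closed by simp
  then have \<delta>_one: "\<delta> \<one>\<^bsub>A\<^esub> = \<zero>\<^bsub>B\<^esub>"
    using \<delta>_closed[of "\<one>\<^bsub>A\<^esub>"] by (metis A.one_closed B.add.l_cancel_one')
  show ?thesis
    using p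
  proof (induction rule: P_induct)
    case (const k)
    then show ?case by (simp add: ev_const \<delta>_smult \<delta>_one dir_deriv_const[OF u(1)])
  next
    case (add p q)
    then show ?case
      by (simp add: ev_add \<delta>_add dir_deriv_add[OF u(1)] dir_deriv_closed[OF u(1)])
  next
    case (var p j)
    then show ?case
      using a_in u(1) \<delta>_closed[of "a j"]
      by (simp add: ev_pmult \<delta>_mult dir_deriv_pmult[OF u(1)] dir_deriv_closed[OF u(1)] v_in[OF u(1)] u(2)
          B.m_comm[of "\<delta> (a j)"] B.a_comm)
  qed
qed

section \<open>Maximal ideals, and linear systems up to a factor outside a prime\<close>

lemma (in cring) exists_maximalideal:
  assumes "ideal I R" "I \<noteq> carrier R"
  shows "\<exists>m. maximalideal m R \<and> I \<subseteq> m"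
proof -
  \<comment> \<open>Properness is written as \<open>\<one> \<notin> J\<close> because this form
    passes to unions of chains.\<close>
  define S where "S = {J. ideal J R \<and> I \<subseteq> J \<and> \<one> \<notin> J}"
  have proper: "\<one> \<notin> J \<longleftrightarrow> J \<noteq> carrier R" if "ideal J R" for J
    using ideal.one_imp_carrier[OF that] by auto
  have "\<exists>m\<in>S. \<forall>J\<in>S. m \<subseteq> J \<longrightarrow> J = m"
  proof (rule subset_Zorn_nonempty)
    show "S \<noteq> {}" using assms proper by (auto simp: S_def)
    fix C assume C: "C \<noteq> {}" "subset.chain S C"
    then have "subset.chain {I. ideal I R} C"
      unfolding S_def pred_on.chain_def by blast
    then have "ideal (\<Union>C) R" using chain_Union_is_ideal[of C] C(1) by simp
    then show "\<Union>C \<in> S" using C unfolding S_def pred_on.chain_def by blast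
  qed
  then obtain m where m: "m \<in> S" "\<And>J. J \<in> S \<Longrightarrow> m \<subseteq> J \<Longrightarrow> J = m" by blast
  have "maximalideal m R"
  proof (rule maximalidealI)
    fix J assume "ideal J R" "m \<subseteq> J" "J \<subseteq> carrier R"
    moreover from this have "J \<in> S" if "\<one> \<notin> J" using m(1) that by (auto simp: S_def)
    ultimately show "J = m \<or> J = carrier R" using m(2)[of J] proper[of J] by blast
  qed (use m in \<open>auto simp: S_def\<close>)
  then show ?thesis using m by (auto simp: S_def)
qed

lemma (in ideal) finsum_in_ideal: "f \<in> A \<rightarrow> I \<Longrightarrow> (\<Oplus>x\<in>A. f x) \<in> I"
proof (induction A rule: infinite_finite_induct)
  case (insert x F)
  then have "(\<Oplus>x\<in>insert x F. f x) = f x \<oplus> (\<Oplus>x\<in>F. f x)"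
    by (intro finsum_insert) (use a_subset in auto)
  then show ?case using insert by simp
qed simp_all

text \<open>
  Gaussian elimination: some entry of the last row is a pivot \<open>d \<notin> m\<close>; clearing its column by
  cross-multiplication keeps the remaining rows independent modulo \<open>m\<close>.
\<close>

lemma (in cring) linear_system_solvable_locally:
  fixes r n :: nat
  assumes "primeideal m R" "ideal N R"
    and "\<And>k j. k < r \<Longrightarrow> j < n \<Longrightarrow> J k j \<in> carrier R" "\<And>k. k < r \<Longrightarrow> e k \<in> N"
    and "\<And>c. c \<in> {..<r} \<rightarrow> carrier R \<Longrightarrow> (\<And>j. j < n \<Longrightarrow> (\<Oplus>k\<in>{..<r}. c k \<otimes> J k j) \<in> m)
           \<Longrightarrow> \<forall>k<r. c k \<in> m"
  shows "\<exists>s\<in>carrier R - m. \<exists>y\<in>{..<n} \<rightarrow> N. \<forall>k<r. (\<Oplus>j\<in>{..<n}. J k j \<otimes> y j) = s \<otimes> e k"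
  using assms(3-5)
proof (induction r arbitrary: J e)
  interpret m: primeideal m R by fact
  interpret N: ideal N R by fact
  case 0
  have "\<one> \<notin> m" using m.I_notcarr m.one_imp_carrier by blast
  moreover have "(\<lambda>j. \<zero>) \<in> {..<n} \<rightarrow> N" by simp
  ultimately show ?case by blast
next
  interpret m: primeideal m R by fact
  interpret N: ideal N R by fact
  case (Suc r)
  note J = Suc.prems(1) and e = Suc.prems(2)
  have e': "e k \<in> carrier R" if "k < Suc r" for k using e[OF that] N.a_subset by blast
  have one: "\<one> \<notin> m" using m.I_notcarr m.one_imp_carrier by blast
  have "\<exists>p<n. J r p \<notin> m"
  proof (rule ccontr)
    assume neg: "\<not> ?thesis"
    \<comment> \<open>If the whole last row were in \<open>m\<close>, the coefficient vector with a
      single one in position \<open>r\<close> would satisfy the hypothesis of independence, putting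
      \<open>\<one>\<close> into \<open>m\<close>.\<close>
    have "\<forall>k<Suc r. (if r = k then \<one> else \<zero>) \<in> m"
    proof (rule Suc.prems(3))
      fix j assume j: "j < n"
      have "(\<Oplus>k\<in>{..<Suc r}. (if r = k then \<one> else \<zero>) \<otimes> J k j)
          = (\<Oplus>k\<in>{..<Suc r}. if r = k then J k j else \<zero>)"
        by (rule finsum_cong') (use J j in auto)
      also have "\<dots> = J r j"
        by (rule add.finprod_singleton) (use J j in auto)
      finally show "(\<Oplus>k\<in>{..<Suc r}. (if r = k then \<one> else \<zero>) \<otimes> J k j) \<in> m"
        using neg j by simp
    qed auto
    then show False using one by (metis lessI)
  qed
  then obtain p where p: "p < n" "J r p \<notin> m" by blast
  define d where "d = J r p"
  have d: "d \<in> carrier R" "d \<notin> m" using p J by (auto simp: d_def)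
  \<comment> \<open>A row operation without division: \<open>d\<close> times row \<open>k\<close>
    minus \<open>J k p\<close> times the pivot row, which makes column \<open>p\<close> zero. The
    right side \<open>e''\<close> undergoes the same operation and stays in
    \<open>N\<close>.\<close>
  define J' where "J' k j = d \<otimes> J k j \<oplus> J k p \<otimes> \<ominus> J r j" for k j
  define e'' where "e'' k = d \<otimes> e k \<oplus> J k p \<otimes> \<ominus> e r" for k
  have "\<exists>s\<in>carrier R - m. \<exists>y\<in>{..<n} \<rightarrow> N. \<forall>k<r. (\<Oplus>j\<in>{..<n}. J' k j \<otimes> y j) = s \<otimes> e'' k"
  proof (rule Suc.IH)
    fix k j assume "k < r" "j < n"
    then show "J' k j \<in> carrier R" using J p d by (simp add: J'_def)
  next
    fix k assume "k < r"
    then show "e'' k \<in> N" using J p d e by (simp add: e''_def N.I_l_closed)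
  next
    fix c assume c: "c \<in> {..<r} \<rightarrow> carrier R" and "\<And>j. j < n \<Longrightarrow> (\<Oplus>k\<in>{..<r}. c k \<otimes> J' k j) \<in> m"
    then have cm: "(\<Oplus>k\<in>{..<r}. c k \<otimes> J' k j) \<in> m" if "j < n" for j using that by blast
    have c': "c k \<in> carrier R" if "k < r" for k using c that by auto
    define t where "t = (\<Oplus>k\<in>{..<r}. c k \<otimes> J k p)"
    have t: "t \<in> carrier R" unfolding t_def by (rule finsum_closed) (use c' J p in auto)
    \<comment> \<open>A combination \<open>c\<close> of the reduced rows is the combination
      \<open>c2\<close> of the original ones: row \<open>k\<close> enters with
      \<open>c k \<otimes> d\<close>, and the pivot row collects all the subtracted multiples. Since
      \<open>m\<close> is prime and \<open>d\<close> lies outside it,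
      \<open>c k \<otimes> d \<in> m\<close> gives \<open>c k \<in> m\<close>.\<close>
    define c2 where "c2 k = (if k = r then \<ominus> t else c k \<otimes> d)" for k
    have "\<forall>k<Suc r. c2 k \<in> m"
    proof (rule Suc.prems(3))
      show "c2 \<in> {..<Suc r} \<rightarrow> carrier R" using c' t d by (auto simp: c2_def)
      fix j assume j: "j < n"
      have "(\<Oplus>k\<in>{..<Suc r}. c2 k \<otimes> J k j) = c2 r \<otimes> J r j \<oplus> (\<Oplus>k\<in>{..<r}. c2 k \<otimes> J k j)"
        unfolding lessThan_Suc by (rule finsum_insert) (use c' t d J j in \<open>auto simp: c2_def\<close>)
      also have "(\<Oplus>k\<in>{..<r}. c2 k \<otimes> J k j) = (\<Oplus>k\<in>{..<r}. c k \<otimes> d \<otimes> J k j)"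
        by (rule finsum_cong') (use c' t d J j in \<open>auto simp: c2_def\<close>)
      also have "c2 r \<otimes> J r j = t \<otimes> \<ominus> J r j"
        using t J j by (simp add: c2_def l_minus r_minus)
      also have "t \<otimes> \<ominus> J r j = (\<Oplus>k\<in>{..<r}. c k \<otimes> J k p \<otimes> \<ominus> J r j)"
        unfolding t_def by (rule finsum_ldistr) (use c' J p j in auto)
      also have "(\<Oplus>k\<in>{..<r}. c k \<otimes> J k p \<otimes> \<ominus> J r j) \<oplus> (\<Oplus>k\<in>{..<r}. c k \<otimes> d \<otimes> J k j)
          = (\<Oplus>k\<in>{..<r}. c k \<otimes> J k p \<otimes> \<ominus> J r j \<oplus> c k \<otimes> d \<otimes> J k j)"
        by (rule finsum_addf[symmetric]) (use c' J p j d in auto)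
      also have "\<dots> = (\<Oplus>k\<in>{..<r}. c k \<otimes> J' k j)"
        by (rule finsum_cong') (use c' J p j d in \<open>auto simp: J'_def r_distr a_comm m_assoc\<close>)
      finally show "(\<Oplus>k\<in>{..<Suc r}. c2 k \<otimes> J k j) \<in> m" using cm[OF j] by simp
    qed
    then have "c k \<otimes> d \<in> m" if "k < r" for k
      using that by (auto simp: c2_def dest!: spec[of _ k])
    then show "\<forall>k<r. c k \<in> m" using m.I_prime c' d by blast
  qed
  then obtain s y where s: "s \<in> carrier R" "s \<notin> m" and y: "y \<in> {..<n} \<rightarrow> N"
    and sol: "\<And>k. k < r \<Longrightarrow> (\<Oplus>j\<in>{..<n}. J' k j \<otimes> y j) = s \<otimes> e'' k" by blast
  have yN: "y j \<in> N" if "j < n" for j using y that by auto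
  have yc: "y j \<in> carrier R" if "j < n" for j using yN[OF that] N.a_subset by blast
  define Y where "Y k = (\<Oplus>j\<in>{..<n}. J k j \<otimes> y j)" for k
  have Y: "Y k \<in> carrier R" if "k < Suc r" for k
    unfolding Y_def by (rule finsum_closed) (use that J yc in auto)
  have YN: "Y k \<in> N" if "k < Suc r" for k
    unfolding Y_def by (rule N.finsum_in_ideal) (use that J yN in \<open>auto simp: N.I_l_closed\<close>)
  \<comment> \<open>Back substitution. Scaling \<open>y\<close> by \<open>d\<close> leaves the pivot
    row short of \<open>d \<otimes> s \<otimes> e r\<close> by exactly \<open>d \<otimes> t\<close>;
    since the pivot is \<open>d\<close>, adding \<open>t\<close> to coordinate \<open>p\<close>
    makes up for it.\<close>
  define t where "t = s \<otimes> e r \<oplus> \<ominus> Y r"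
  have t: "t \<in> carrier R" "t \<in> N" using s e' Y e YN by (simp_all add: t_def N.I_l_closed)
  define z where "z j = d \<otimes> y j \<oplus> (if p = j then t else \<zero>)" for j
  have z: "z \<in> {..<n} \<rightarrow> N" using d yN t by (auto simp: z_def N.I_l_closed)
  have Jz: "(\<Oplus>j\<in>{..<n}. J k j \<otimes> z j) = d \<otimes> Y k \<oplus> J k p \<otimes> t" if k: "k < Suc r" for k
  proof -
    have "(\<Oplus>j\<in>{..<n}. J k j \<otimes> z j)
        = (\<Oplus>j\<in>{..<n}. d \<otimes> (J k j \<otimes> y j) \<oplus> (if p = j then J k j \<otimes> t else \<zero>))"
      by (rule finsum_cong') (use J yc k d t in \<open>auto simp: z_def r_distr m_lcomm\<close>)
    also have "\<dots> = (\<Oplus>j\<in>{..<n}. d \<otimes> (J k j \<otimes> y j)) \<oplus> (\<Oplus>j\<in>{..<n}. if p = j then J k j \<otimes> t else \<zero>)"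
      by (rule finsum_addf) (use J yc k d t in auto)
    also have "(\<Oplus>j\<in>{..<n}. d \<otimes> (J k j \<otimes> y j)) = d \<otimes> Y k"
      unfolding Y_def by (rule finsum_rdistr[symmetric]) (use J yc k d in auto)
    also have "(\<Oplus>j\<in>{..<n}. if p = j then J k j \<otimes> t else \<zero>) = J k p \<otimes> t"
      by (rule add.finprod_singleton) (use J p k t in auto)
    finally show ?thesis .
  qed
  have "(\<Oplus>j\<in>{..<n}. J k j \<otimes> z j) = (d \<otimes> s) \<otimes> e k" if k: "k < Suc r" for k
  proof (cases "k = r")
    case True
    have "d \<otimes> Y r \<oplus> d \<otimes> (s \<otimes> e r \<oplus> \<ominus> Y r) = d \<otimes> s \<otimes> e r"
      using d s e' Y[of r]
      by (simp add: r_distr r_minus a_lcomm[of "d \<otimes> Y r" _ "\<ominus> (d \<otimes> Y r)"] r_neg m_assoc)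
    then show ?thesis using Jz[OF k] True by (simp add: t_def d_def)
  next
    case False
    then have k': "k < r" using k by simp
    have "(\<Oplus>j\<in>{..<n}. J' k j \<otimes> y j)
        = (\<Oplus>j\<in>{..<n}. d \<otimes> (J k j \<otimes> y j) \<oplus> (\<ominus> J k p) \<otimes> (J r j \<otimes> y j))"
      by (rule finsum_cong')
        (use J yc k d p in \<open>auto simp: J'_def l_distr m_assoc l_minus r_minus\<close>)
    also have "\<dots> = (\<Oplus>j\<in>{..<n}. d \<otimes> (J k j \<otimes> y j)) \<oplus> (\<Oplus>j\<in>{..<n}. (\<ominus> J k p) \<otimes> (J r j \<otimes> y j))"
      by (rule finsum_addf) (use J yc k d p in auto)
    also have "(\<Oplus>j\<in>{..<n}. d \<otimes> (J k j \<otimes> y j)) = d \<otimes> Y k"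
      unfolding Y_def by (rule finsum_rdistr[symmetric]) (use J yc k d in auto)
    also have "(\<Oplus>j\<in>{..<n}. (\<ominus> J k p) \<otimes> (J r j \<otimes> y j)) = (\<ominus> J k p) \<otimes> Y r"
      unfolding Y_def by (rule finsum_rdistr[symmetric]) (use J yc k p in auto)
    finally have eq: "d \<otimes> Y k \<oplus> (\<ominus> J k p) \<otimes> Y r = s \<otimes> e'' k"
      using sol[OF k'] by simp
    have c: "J k p \<in> carrier R" "Y k \<in> carrier R" "Y r \<in> carrier R" "e k \<in> carrier R" "e r \<in> carrier R"
      using J p k Y e' by auto
    \<comment> \<open>The part of \<open>t\<close> coming from \<open>Y r\<close> rebuilds the
      reduced row, and the part coming from \<open>e r\<close> undoes the subtraction in
      \<open>e''\<close>.\<close>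
    have "d \<otimes> Y k \<oplus> J k p \<otimes> t = (d \<otimes> Y k \<oplus> (\<ominus> J k p) \<otimes> Y r) \<oplus> J k p \<otimes> (s \<otimes> e r)"
      using c d s by (simp add: t_def r_distr l_minus r_minus a_ac)
    also have "\<dots> = s \<otimes> e'' k \<oplus> J k p \<otimes> (s \<otimes> e r)" by (simp only: eq)
    also have "\<dots> = d \<otimes> s \<otimes> e k"
      using c d s by (simp add: e''_def r_distr r_minus m_ac a_assoc l_neg)
    finally show ?thesis using Jz[OF k] by simp
  qed
  moreover have "d \<otimes> s \<in> carrier R - m" using d s m.I_prime by auto
  ultimately show ?case using z by blast
qed

section \<open>Lifts near a closed point\<close>

lemma (in poly_eval) dir_deriv_smult_vec:
  assumes "v \<in> {..<n} \<rightarrow> carrier A" "c \<in> carrier A" "p \<in> carrier P"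
  shows "dir_deriv (\<lambda>j. c \<otimes>\<^bsub>A\<^esub> v j) p = c \<otimes>\<^bsub>A\<^esub> dir_deriv v p"
proof -
  note v = v_in[OF assms(1)]
  have "dir_deriv (\<lambda>j. c \<otimes>\<^bsub>A\<^esub> v j) p = (\<Oplus>\<^bsub>A\<^esub>j\<in>{..<n}. c \<otimes>\<^bsub>A\<^esub> (ev (mpoly_pderiv K j p) \<otimes>\<^bsub>A\<^esub> v j))"
    unfolding dir_deriv_def by (rule A.finsum_cong') (use assms v in \<open>auto simp: A.m_lcomm\<close>)
  also have "\<dots> = c \<otimes>\<^bsub>A\<^esub> dir_deriv v p"
    unfolding dir_deriv_def by (rule A.finsum_rdistr[symmetric]) (use assms v in auto)
  finally show ?thesis .
qed

lemma (in poly_eval) dir_deriv_add_vec: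
  assumes "v \<in> {..<n} \<rightarrow> carrier A" "w \<in> {..<n} \<rightarrow> carrier A" "p \<in> carrier P"
  shows "dir_deriv (\<lambda>j. v j \<oplus>\<^bsub>A\<^esub> w j) p = dir_deriv v p \<oplus>\<^bsub>A\<^esub> dir_deriv w p"
proof -
  note v = v_in[OF assms(1)] v_in[OF assms(2)]
  have "dir_deriv (\<lambda>j. v j \<oplus>\<^bsub>A\<^esub> w j) p
      = (\<Oplus>\<^bsub>A\<^esub>j\<in>{..<n}. ev (mpoly_pderiv K j p) \<otimes>\<^bsub>A\<^esub> v j \<oplus>\<^bsub>A\<^esub> ev (mpoly_pderiv K j p) \<otimes>\<^bsub>A\<^esub> w j)"
    unfolding dir_deriv_def by (rule A.finsum_cong') (use assms v in \<open>auto simp: A.r_distr\<close>)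
  also have "\<dots> = dir_deriv v p \<oplus>\<^bsub>A\<^esub> dir_deriv w p"
    unfolding dir_deriv_def by (rule A.finsum_addf) (use assms v in auto)
  finally show ?thesis .
qed

lemma (in poly_eval) smooth_atE:
  assumes "smooth_at K A n a m"
  obtains r :: nat and g h where "g \<in> {..<r} \<rightarrow> a_kernel P A ev" "h \<in> carrier P" "ev h \<notin> m"
    "\<forall>f\<in>a_kernel P A ev. h \<otimes>\<^bsub>P\<^esub> f \<in> Idl\<^bsub>P\<^esub> (g ` {..<r})"
    "\<forall>c\<in>{..<r} \<rightarrow> carrier A.
       (\<forall>j<n. (\<Oplus>\<^bsub>A\<^esub>k\<in>{..<r}. c k \<otimes>\<^bsub>A\<^esub> ev (mpoly_pderiv K j (g k))) \<in> m) \<longrightarrow> (\<forall>k<r. c k \<in> m)"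
  using assms unfolding smooth_at_def Let_def by (elim exE conjE) (rule that)

text \<open>The final factor is \<open>ev h \<otimes> s\<close>: \<open>s\<close> makes the lifted
  tuple annihilate the differentials of the \<open>g k\<close>, and \<open>ev h\<close> extends this
  from the \<open>g k\<close> to all relations between the generators. Both lie outside
  \<open>m\<close>, hence so does the product.\<close>

lemma (in poly_eval) derivation_lifts_locally:
  assumes surj: "ev ` carrier P = carrier A"
    and B: "algebra K B" and i: "i \<in> closed_embeddings K A B"
    and \<delta>: "derivation_along K A B i \<delta>"
    and m: "maximalideal m A" and smooth: "smooth_at K A n a m"
  shows "\<exists>s\<in>carrier A - m. \<exists>\<xi>\<in>vector_fields K A. \<forall>g\<in>carrier A. i (\<xi> g) = i s \<otimes>\<^bsub>B\<^esub> \<delta> g"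
proof -
  interpret B: algebra K B by (rule B)
  have ia: "i \<in> alg_hom K A B" and isurj: "i ` carrier A = carrier B"
    using i by (auto simp: closed_embeddings_def)
  then have "i \<in> ring_hom A B" by (simp add: alg_hom_def)
  then interpret i: ring_hom_ring A B i
    by (intro ring_hom_ringI2 cring.axioms(1) A.M_cring B.M_cring)
  interpret P: cring P by (rule P_cring)
  have prime: "primeideal m A" by (rule A.maximalideal_prime[OF m])
  interpret m: primeideal m A by (rule prime)
  define I where "I = a_kernel P A ev"
  have I: "I = {p \<in> carrier P. ev p = \<zero>\<^bsub>A\<^esub>}" by (simp add: I_def a_kernel_def')
  define N where "N = a_kernel A B i"
  have N: "N = {x \<in> carrier A. i x = \<zero>\<^bsub>B\<^esub>}" by (simp only: N_def a_kernel_def')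
  have N_ideal: "ideal N A" unfolding N_def by (rule i.kernel_is_ideal)
  obtain r :: nat and g h where g: "g \<in> {..<r} \<rightarrow> I" and h: "h \<in> carrier P" "ev h \<notin> m"
    and gen: "\<forall>f\<in>I. h \<otimes>\<^bsub>P\<^esub> f \<in> Idl\<^bsub>P\<^esub> (g ` {..<r})"
    and indep: "\<forall>c\<in>{..<r} \<rightarrow> carrier A.
       (\<forall>j<n. (\<Oplus>\<^bsub>A\<^esub>k\<in>{..<r}. c k \<otimes>\<^bsub>A\<^esub> ev (mpoly_pderiv K j (g k))) \<in> m) \<longrightarrow> (\<forall>k<r. c k \<in> m)"
    by (rule smooth_atE[OF smooth, folded I_def]) (rule that)
  have gI: "g k \<in> carrier P" "ev (g k) = \<zero>\<^bsub>A\<^esub>" if "k < r" for k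
    using g that by (auto simp: I)
  have \<delta>_closed: "\<delta> x \<in> carrier B" if "x \<in> carrier A" for x
    using \<delta> that by (simp add: derivation_along_def)
  have "\<delta> \<zero>\<^bsub>A\<^esub> = \<delta> \<zero>\<^bsub>A\<^esub> \<oplus>\<^bsub>B\<^esub> \<delta> \<zero>\<^bsub>A\<^esub>"
    using \<delta> by (metis A.zero_closed A.M.l_zero derivation_along_def)
  then have \<delta>_zero: "\<delta> \<zero>\<^bsub>A\<^esub> = \<zero>\<^bsub>B\<^esub>"
    using \<delta>_closed[of "\<zero>\<^bsub>A\<^esub>"] by (metis A.zero_closed B.add.l_cancel_one')
  have "\<exists>x\<in>carrier A. i x = \<delta> (a j)" if "j < n" for j
    using isurj \<delta>_closed[OF a_in[OF that]] by (metis imageE)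
  then obtain u where u': "\<And>j. j < n \<Longrightarrow> u j \<in> carrier A \<and> i (u j) = \<delta> (a j)" by metis
  then have u: "u \<in> {..<n} \<rightarrow> carrier A" by auto
  have chain: "\<delta> (ev p) = i (dir_deriv u p)" if "p \<in> carrier P" for p
    by (rule chain_rule[OF B ia \<delta> u _ that]) (use u' in auto)
  \<comment> \<open>By the chain rule the defect of \<open>u\<close> on \<open>g k\<close> restricts
    to \<delta> of \<open>ev (g k)\<close>, which is \<delta> of zero.\<close>
  have eN: "dir_deriv u (g k) \<in> N" if "k < r" for k
    using chain[OF gI(1)[OF that]] gI[OF that] \<delta>_zero by (simp add: N dir_deriv_closed[OF u])
  have "\<exists>s\<in>carrier A - m. \<exists>y\<in>{..<n} \<rightarrow> N. \<forall>k<r.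
      (\<Oplus>\<^bsub>A\<^esub>j\<in>{..<n}. ev (mpoly_pderiv K j (g k)) \<otimes>\<^bsub>A\<^esub> y j) = s \<otimes>\<^bsub>A\<^esub> dir_deriv u (g k)"
    by (rule A.linear_system_solvable_locally[OF prime N_ideal])
      (use gI eN indep in auto)
  then obtain s y where s: "s \<in> carrier A" "s \<notin> m" and yN: "y \<in> {..<n} \<rightarrow> N"
    and sol: "\<And>k. k < r \<Longrightarrow> dir_deriv y (g k) = s \<otimes>\<^bsub>A\<^esub> dir_deriv u (g k)"
    unfolding dir_deriv_def by blast
  have y: "y \<in> {..<n} \<rightarrow> carrier A" using yN N by blast
  \<comment> \<open>The tuple \<open>s u - y\<close>. It annihilates the \<open>g k\<close> because
    \<open>y\<close> solves the system, and \<open>i\<close> does not see \<open>y\<close>, whose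
    entries are in \<open>N\<close>.\<close>
  define w where "w = (\<lambda>j. s \<otimes>\<^bsub>A\<^esub> u j \<oplus>\<^bsub>A\<^esub> (\<ominus>\<^bsub>A\<^esub> \<one>\<^bsub>A\<^esub>) \<otimes>\<^bsub>A\<^esub> y j)"
  have su: "(\<lambda>j. s \<otimes>\<^bsub>A\<^esub> u j) \<in> {..<n} \<rightarrow> carrier A"
    and my: "(\<lambda>j. (\<ominus>\<^bsub>A\<^esub> \<one>\<^bsub>A\<^esub>) \<otimes>\<^bsub>A\<^esub> y j) \<in> {..<n} \<rightarrow> carrier A"
    using s u y by auto
  have w: "w \<in> {..<n} \<rightarrow> carrier A" using v_in[OF su] v_in[OF my] by (auto simp: w_def)
  have dw: "dir_deriv w p = s \<otimes>\<^bsub>A\<^esub> dir_deriv u p \<oplus>\<^bsub>A\<^esub> \<ominus>\<^bsub>A\<^esub> dir_deriv y p" if "p \<in> carrier P" for p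
    using that s dir_deriv_add_vec[OF su my that] dir_deriv_smult_vec[OF u s(1) that]
      dir_deriv_smult_vec[OF y, of "\<ominus>\<^bsub>A\<^esub> \<one>\<^bsub>A\<^esub>"] dir_deriv_closed[OF y that]
    by (simp add: w_def A.l_minus)
  \<comment> \<open>Vanishing of \<open>dir_deriv w\<close> alone does not define an ideal: in the
    product rule the other summand disappears only because \<open>ev p\<close> is zero as
    well.\<close>
  define Z where "Z = {p \<in> carrier P. ev p = \<zero>\<^bsub>A\<^esub> \<and> dir_deriv w p = \<zero>\<^bsub>A\<^esub>}"
  have "ideal Z P"
  proof (rule idealI)
    have "\<zero>\<^bsub>P\<^esub> \<in> Z"
      using dir_deriv_const[OF w zero_closed] by (simp add: Z_def ev_zero P_zero[symmetric])
    then show "subgroup Z (add_monoid P)"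
      by (intro P.add.subgroupI)
        (auto simp: Z_def minus_eq_scale ev_scale dir_deriv_scale[OF w] ev_add dir_deriv_add[OF w])
    fix p q assume p: "p \<in> Z" and q: "q \<in> carrier P"
    then show "q \<otimes>\<^bsub>P\<^esub> p \<in> Z" "p \<otimes>\<^bsub>P\<^esub> q \<in> Z"
      by (simp_all add: Z_def mult_closed ev_mult dir_deriv_mult[OF w] dir_deriv_closed[OF w])
  qed (rule P.ring_axioms)
  moreover have "g ` {..<r} \<subseteq> Z"
  proof
    fix f assume "f \<in> g ` {..<r}"
    then obtain k where k: "k < r" "f = g k" by auto
    then have "dir_deriv w f = \<zero>\<^bsub>A\<^esub>"
      using dw[OF gI(1)[OF k(1)]] sol[OF k(1)] s gI[OF k(1)] dir_deriv_closed[OF u]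
      by (simp add: A.r_neg)
    then show "f \<in> Z" using k gI by (simp add: Z_def)
  qed
  ultimately have Idl: "Idl\<^bsub>P\<^esub> (g ` {..<r}) \<subseteq> Z" by (rule P.genideal_minimal)
  have kill: "ev h \<otimes>\<^bsub>A\<^esub> dir_deriv w f = \<zero>\<^bsub>A\<^esub>" if f: "f \<in> carrier P" "ev f = \<zero>\<^bsub>A\<^esub>" for f
  proof -
    \<comment> \<open>\<open>h\<close> times \<open>f\<close> lies in the ideal of the
      \<open>g k\<close>, hence in \<open>Z\<close>. As \<open>ev f\<close> is zero, the product
      rule leaves \<open>ev h\<close> times \<open>dir_deriv w f\<close>.\<close>
    have "dir_deriv w (h \<otimes>\<^bsub>P\<^esub> f) = \<zero>\<^bsub>A\<^esub>" using gen Idl f by (auto simp: I Z_def)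
    then show ?thesis using f h by (simp add: dir_deriv_mult[OF w] dir_deriv_closed[OF w])
  qed
  define v where "v j = ev h \<otimes>\<^bsub>A\<^esub> w j" for j
  have v: "v \<in> {..<n} \<rightarrow> carrier A" using v_in[OF w] h by (auto simp: v_def)
  have dv: "dir_deriv v p = ev h \<otimes>\<^bsub>A\<^esub> dir_deriv w p" if "p \<in> carrier P" for p
    unfolding v_def by (rule dir_deriv_smult_vec[OF w]) (use h that in auto)
  obtain \<xi> where \<xi>: "\<xi> \<in> vector_fields K A" "\<And>p. p \<in> carrier P \<Longrightarrow> \<xi> (ev p) = dir_deriv v p"
    by (rule derivation_exists[OF surj v]) (use kill dv in auto)
  have "i (\<xi> x) = i (ev h \<otimes>\<^bsub>A\<^esub> s) \<otimes>\<^bsub>B\<^esub> \<delta> x" if x: "x \<in> carrier A" for x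
  proof -
    obtain p where p: "p \<in> carrier P" "x = ev p" using x surj by blast
    have "dir_deriv y p \<in> N"
      unfolding dir_deriv_def
      by (rule ideal.finsum_in_ideal[OF N_ideal]) (use yN p in \<open>auto intro!: ideal.I_l_closed[OF N_ideal]\<close>)
    then have "i (dir_deriv y p) = \<zero>\<^bsub>B\<^esub>" by (simp add: N)
    then show ?thesis
      using p h s \<xi>(2)[OF p(1)] dir_deriv_closed[OF u p(1)] dir_deriv_closed[OF y p(1)]
      by (simp add: dv dw chain B.m_assoc)
  qed
  moreover have "ev h \<otimes>\<^bsub>A\<^esub> s \<in> carrier A - m" using h s m.I_prime[of "ev h" s] by auto
  ultimately show ?thesis using \<xi>(1) by blast
qed

section \<open>From local lifts to a global lift\<close>

lemma vector_fields_lincomb: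
  assumes A: "algebra K A" and "\<xi> \<in> vector_fields K A" "\<eta> \<in> vector_fields K A"
    and c: "c \<in> carrier A"
  shows "(\<lambda>x\<in>carrier A. c \<otimes>\<^bsub>A\<^esub> \<xi> x \<oplus>\<^bsub>A\<^esub> \<eta> x) \<in> vector_fields K A"
proof -
  interpret A: algebra K A by (rule A)
  have \<xi>: "\<And>x. x \<in> carrier A \<Longrightarrow> \<xi> x \<in> carrier A"
    "\<And>x y. x \<in> carrier A \<Longrightarrow> y \<in> carrier A \<Longrightarrow> \<xi> (x \<oplus>\<^bsub>A\<^esub> y) = \<xi> x \<oplus>\<^bsub>A\<^esub> \<xi> y"
    "\<And>x y. x \<in> carrier A \<Longrightarrow> y \<in> carrier A \<Longrightarrow> \<xi> (x \<otimes>\<^bsub>A\<^esub> y) = \<xi> x \<otimes>\<^bsub>A\<^esub> y \<oplus>\<^bsub>A\<^esub> x \<otimes>\<^bsub>A\<^esub> \<xi> y"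
    "\<And>k x. k \<in> carrier K \<Longrightarrow> x \<in> carrier A \<Longrightarrow> \<xi> (k \<odot>\<^bsub>A\<^esub> x) = k \<odot>\<^bsub>A\<^esub> \<xi> x"
    using assms(2) by (auto simp: vector_fields_def linear_endos_def)
  have \<eta>: "\<And>x. x \<in> carrier A \<Longrightarrow> \<eta> x \<in> carrier A"
    "\<And>x y. x \<in> carrier A \<Longrightarrow> y \<in> carrier A \<Longrightarrow> \<eta> (x \<oplus>\<^bsub>A\<^esub> y) = \<eta> x \<oplus>\<^bsub>A\<^esub> \<eta> y"
    "\<And>x y. x \<in> carrier A \<Longrightarrow> y \<in> carrier A \<Longrightarrow> \<eta> (x \<otimes>\<^bsub>A\<^esub> y) = \<eta> x \<otimes>\<^bsub>A\<^esub> y \<oplus>\<^bsub>A\<^esub> x \<otimes>\<^bsub>A\<^esub> \<eta> y"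
    "\<And>k x. k \<in> carrier K \<Longrightarrow> x \<in> carrier A \<Longrightarrow> \<eta> (k \<odot>\<^bsub>A\<^esub> x) = k \<odot>\<^bsub>A\<^esub> \<eta> x"
    using assms(3) by (auto simp: vector_fields_def linear_endos_def)
  have sm: "c \<otimes>\<^bsub>A\<^esub> (k \<odot>\<^bsub>A\<^esub> x) = k \<odot>\<^bsub>A\<^esub> (c \<otimes>\<^bsub>A\<^esub> x)" if "k \<in> carrier K" "x \<in> carrier A" for k x
    using that c by (simp add: A.m_comm[of c] A.smult_assoc2)
  show ?thesis
    unfolding vector_fields_def linear_endos_def
    using c by (auto simp: \<xi> \<eta> sm A.r_distr A.l_distr A.smult_r_distr A.a_ac A.m_ac)
qed

lemma derivation_lifts:
  assumes V: "smooth_affine_variety K A" and B: "algebra K B"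
    and i: "i \<in> closed_embeddings K A B" and \<delta>: "derivation_along K A B i \<delta>"
  shows "\<exists>\<xi>\<in>vector_fields K A. \<forall>g\<in>carrier A. i (\<xi> g) = \<delta> g"
proof -
  have A: "algebra K A" using V by (simp add: smooth_affine_variety_def affine_variety_def)
  interpret A: algebra K A by (rule A)
  interpret B: algebra K B by (rule B)
  have "i \<in> ring_hom A B" using i by (simp add: closed_embeddings_def alg_hom_def)
  then interpret i: ring_hom_ring A B i
    by (intro ring_hom_ringI2 cring.axioms(1) A.M_cring B.M_cring)
  obtain n a where gen: "generates_algebra K A n a"
    and smooth: "\<And>m. maximalideal m A \<Longrightarrow> smooth_at K A n a m"
    using V by (auto simp: smooth_affine_variety_def)
  interpret poly_eval K n A a
    by unfold_locales (use gen in \<open>auto simp: generates_algebra_def\<close>)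
  have surj: "ev ` carrier P = carrier A" using gen by (simp add: generates_algebra_def)
  have \<delta>_closed: "\<delta> x \<in> carrier B" if "x \<in> carrier A" for x
    using \<delta> that by (simp add: derivation_along_def)
  \<comment> \<open>At \<open>s = \<one>\<close> the condition is the claim itself. The factor
    enters through \<open>i s\<close> because \<delta> takes its values in \<open>B\<close>.\<close>
  define L where "L = {s \<in> carrier A. \<exists>\<xi>\<in>vector_fields K A. \<forall>g\<in>carrier A. i (\<xi> g) = i s \<otimes>\<^bsub>B\<^esub> \<delta> g}"
  have zero: "(\<lambda>x\<in>carrier A. \<zero>\<^bsub>A\<^esub>) \<in> vector_fields K A"
    by (auto simp: vector_fields_def linear_endos_def)
  have vf: "\<xi> x \<in> carrier A" if "\<xi> \<in> vector_fields K A" "x \<in> carrier A" for \<xi> x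
    using that by (auto simp: vector_fields_def linear_endos_def)
  have zeroL: "\<zero>\<^bsub>A\<^esub> \<in> L"
    unfolding L_def using zero \<delta>_closed by (auto intro!: bexI[of _ "\<lambda>x\<in>carrier A. \<zero>\<^bsub>A\<^esub>"])
  \<comment> \<open>One closure property covers all that an ideal requires:
    \<open>c = \<one>\<close> gives sums and \<open>t = \<zero>\<close> gives multiples, among them
    negatives.\<close>
  have comb: "c \<otimes>\<^bsub>A\<^esub> s \<oplus>\<^bsub>A\<^esub> t \<in> L" if "c \<in> carrier A" "s \<in> L" "t \<in> L" for c s t
  proof -
    obtain \<xi> where \<xi>: "\<xi> \<in> vector_fields K A" "\<forall>g\<in>carrier A. i (\<xi> g) = i s \<otimes>\<^bsub>B\<^esub> \<delta> g"
      using \<open>s \<in> L\<close> by (auto simp: L_def)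
    obtain \<eta> where \<eta>: "\<eta> \<in> vector_fields K A" "\<forall>g\<in>carrier A. i (\<eta> g) = i t \<otimes>\<^bsub>B\<^esub> \<delta> g"
      using \<open>t \<in> L\<close> by (auto simp: L_def)
    have st: "s \<in> carrier A" "t \<in> carrier A" using that by (auto simp: L_def)
    show ?thesis
      unfolding L_def using that st \<xi> \<eta> vf \<delta>_closed vector_fields_lincomb[OF A \<xi>(1) \<eta>(1) that(1)]
      by (auto intro!: bexI[of _ "\<lambda>x\<in>carrier A. c \<otimes>\<^bsub>A\<^esub> \<xi> x \<oplus>\<^bsub>A\<^esub> \<eta> x"] simp: B.l_distr B.m_assoc)
  qed
  have LA: "L \<subseteq> carrier A" by (auto simp: L_def)
  have scal: "c \<otimes>\<^bsub>A\<^esub> s \<in> L" if "c \<in> carrier A" "s \<in> L" for c s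
    using comb[OF that zeroL] that LA by auto
  have "ideal L A"
  proof (rule idealI)
    show "subgroup L (add_monoid A)"
    proof (rule A.add.subgroupI)
      fix s assume s: "s \<in> L"
      show "\<ominus>\<^bsub>A\<^esub> s \<in> L" using scal[of "\<ominus>\<^bsub>A\<^esub> \<one>\<^bsub>A\<^esub>" s] s LA by (auto simp: A.l_minus)
    next
      fix s t assume "s \<in> L" "t \<in> L"
      then show "s \<oplus>\<^bsub>A\<^esub> t \<in> L" using comb[of "\<one>\<^bsub>A\<^esub>" s t] LA by auto
    qed (use zeroL LA in auto)
    fix s c assume "s \<in> L" "c \<in> carrier A"
    then show "c \<otimes>\<^bsub>A\<^esub> s \<in> L" "s \<otimes>\<^bsub>A\<^esub> c \<in> L" using scal LA A.m_comm[of s c] by auto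
  qed (rule cring.axioms(1)[OF A.M_cring])
  have "L = carrier A"
  proof (rule ccontr)
    assume "L \<noteq> carrier A"
    then obtain m where m: "maximalideal m A" "L \<subseteq> m"
      using A.exists_maximalideal[OF \<open>ideal L A\<close>] by blast
    obtain s where "s \<in> carrier A - m" "s \<in> L"
      using derivation_lifts_locally[OF surj B i \<delta> m(1) smooth[OF m(1)]] by (auto simp: L_def)
    then show False using m(2) by blast
  qed
  then have "\<one>\<^bsub>A\<^esub> \<in> L" by simp
  then show ?thesis using \<delta>_closed by (auto simp: L_def)
qed

section \<open>Tensor products with a cyclic module\<close>

lemma (in abelian_subgroup) coset_absorb:
  assumes "h \<in> H" "x \<in> carrier G" shows "H +> (h \<oplus> x) = H +> x"
proof -
  have "h \<oplus> x \<in> H +> x" unfolding a_r_coset_def' using assms by blast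
  then show ?thesis by (rule a_repr_independence'[symmetric, OF _ assms(2)])
qed

text \<open>Operations on quotients are encoded as unions over all representatives of a coset. If
  the value does not depend on the representative, the union is that value; it is not empty because
  \<open>H\<close> contains zero.\<close>

lemma (in abelian_subgroup) UN_coset:
  assumes "\<And>h. h \<in> H \<Longrightarrow> g (h \<oplus> x) = g x"
  shows "(\<Union>y\<in>H +> x. g y) = g x"
proof -
  have "(\<Union>y\<in>H +> x. g y) = (\<Union>h\<in>H. g (h \<oplus> x))" unfolding a_r_coset_def' by simp
  also have "\<dots> = (\<Union>h\<in>H. g x)" by (intro SUP_cong assms refl)
  also have "\<dots> = g x" using subgroup.one_closed[OF a_subgroup] by blast
  finally show ?thesis .
qed

lemma (in abelian_subgroup) coset_eq_self_iff:
  assumes "x \<in> carrier G" shows "H +> x = H \<longleftrightarrow> x \<in> H"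
  using a_rcos_self[OF assms] a_rcos_const by blast

lemma abelian_subgroup_submodule:
  assumes "submodule H R M" "abelian_group M" shows "abelian_subgroup H M"
  using assms by (intro abelian_subgroupI3 additive_subgroupI) (auto simp: submodule_def)

text \<open>An abstract form of D/J tensor N = N/JN, with N/JN presented as W/S.
  \<open>J_smult\<close> and \<open>S_minimal\<close> together say that the preimage of
  \<open>S\<close> under \<open>i\<close> is the smallest additive subgroup of \<open>N\<close> that
  is stable under \<open>act\<close> and contains all values of \<open>J\<close> on
  \<open>N\<close>. As \<open>D\<close> is not assumed commutative, the axioms of a left module are
  listed one by one.\<close>

locale quotient_tensor = D: ring D + N: abelian_group N + W: module K W
  for D :: "'d ring" and N :: "('d, 'n) module" and K :: "'k ring" and W :: "('k, 'w) module" +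
  fixes J :: "'d set" and act :: "'k \<Rightarrow> 'n \<Rightarrow> 'n" and S :: "'w set" and i :: "'n \<Rightarrow> 'w"
  assumes smult_closed: "r \<in> carrier D \<Longrightarrow> y \<in> carrier N \<Longrightarrow> r \<odot>\<^bsub>N\<^esub> y \<in> carrier N"
    and smult_l_distr: "r \<in> carrier D \<Longrightarrow> s \<in> carrier D \<Longrightarrow> y \<in> carrier N \<Longrightarrow>
      (r \<oplus>\<^bsub>D\<^esub> s) \<odot>\<^bsub>N\<^esub> y = r \<odot>\<^bsub>N\<^esub> y \<oplus>\<^bsub>N\<^esub> s \<odot>\<^bsub>N\<^esub> y"
    and smult_r_distr: "r \<in> carrier D \<Longrightarrow> y \<in> carrier N \<Longrightarrow> z \<in> carrier N \<Longrightarrow>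
      r \<odot>\<^bsub>N\<^esub> (y \<oplus>\<^bsub>N\<^esub> z) = r \<odot>\<^bsub>N\<^esub> y \<oplus>\<^bsub>N\<^esub> r \<odot>\<^bsub>N\<^esub> z"
    and smult_assoc: "r \<in> carrier D \<Longrightarrow> s \<in> carrier D \<Longrightarrow> y \<in> carrier N \<Longrightarrow>
      (r \<otimes>\<^bsub>D\<^esub> s) \<odot>\<^bsub>N\<^esub> y = r \<odot>\<^bsub>N\<^esub> (s \<odot>\<^bsub>N\<^esub> y)"
    and smult_one: "y \<in> carrier N \<Longrightarrow> \<one>\<^bsub>D\<^esub> \<odot>\<^bsub>N\<^esub> y = y"
    and act_closed: "c \<in> carrier K \<Longrightarrow> y \<in> carrier N \<Longrightarrow> act c y \<in> carrier N"
    and act_add: "c \<in> carrier K \<Longrightarrow> y \<in> carrier N \<Longrightarrow> z \<in> carrier N \<Longrightarrow>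
      act c (y \<oplus>\<^bsub>N\<^esub> z) = act c y \<oplus>\<^bsub>N\<^esub> act c z"
    and act_smult: "c \<in> carrier K \<Longrightarrow> r \<in> carrier D \<Longrightarrow> y \<in> carrier N \<Longrightarrow>
      act c (r \<odot>\<^bsub>N\<^esub> y) = r \<odot>\<^bsub>N\<^esub> act c y"
    and J: "submodule J D (right_regular D)"
    and S: "submodule S K W"
    and i_add: "y \<in> carrier N \<Longrightarrow> z \<in> carrier N \<Longrightarrow> i (y \<oplus>\<^bsub>N\<^esub> z) = i y \<oplus>\<^bsub>W\<^esub> i z"
    and i_act: "c \<in> carrier K \<Longrightarrow> y \<in> carrier N \<Longrightarrow> i (act c y) = c \<odot>\<^bsub>W\<^esub> i y"
    and i_surj: "i ` carrier N = carrier W"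
    and J_smult: "r \<in> J \<Longrightarrow> y \<in> carrier N \<Longrightarrow> i (r \<odot>\<^bsub>N\<^esub> y) \<in> S"
    and S_minimal: "subgroup Z (add_monoid N) \<Longrightarrow>
      (\<And>c y. c \<in> carrier K \<Longrightarrow> y \<in> Z \<Longrightarrow> act c y \<in> Z) \<Longrightarrow>
      (\<And>r y. r \<in> J \<Longrightarrow> y \<in> carrier N \<Longrightarrow> r \<odot>\<^bsub>N\<^esub> y \<in> Z) \<Longrightarrow>
      y \<in> carrier N \<Longrightarrow> i y \<in> S \<Longrightarrow> y \<in> Z"
begin

section \<open>The relations in the tensor product of D/J with N\<close>

definition M where "M = quotient_module (right_regular D) J"
abbreviation F where "F \<equiv> free_Abelian_group (carrier M \<times> carrier N)"
definition T where "T = tensor_kernel D M N"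
abbreviation scalar where "scalar c \<equiv> frag_extend (\<lambda>(x, y). frag_of (x, act c y))"

lemma i_closed: "y \<in> carrier N \<Longrightarrow> i y \<in> carrier W"
  using i_surj by blast

lemma J_abelian_subgroup: "abelian_subgroup J D"
proof -
  have "additive_subgroup J D"
    using J by (simp add: submodule_def additive_subgroup_def right_regular_def subgroup_def m_inv_def)
  then show ?thesis by (rule abelian_subgroupI3[OF _ D.is_abelian_group])
qed

sublocale J: abelian_subgroup J D
  by (rule J_abelian_subgroup)

sublocale S: abelian_subgroup S W
  by (rule abelian_subgroup_submodule[OF S module.axioms(2)[OF W.module_axioms]])

lemma J_mult: "x \<in> J \<Longrightarrow> r \<in> carrier D \<Longrightarrow> x \<otimes>\<^bsub>D\<^esub> r \<in> J"
  using submodule.smult_closed[OF J, of r x] by (simp add: right_regular_def)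

lemma coset_right_regular: "J +>\<^bsub>right_regular D\<^esub> x = J +>\<^bsub>D\<^esub> x"
  by (simp add: a_r_coset_def r_coset_def right_regular_def)

lemma M_carrier: "carrier M = (\<lambda>x. J +>\<^bsub>D\<^esub> x) ` carrier D"
  by (auto simp: M_def quotient_module_def A_RCOSETS_def RCOSETS_def a_r_coset_def r_coset_def right_regular_def)

lemma M_closed: "x \<in> carrier D \<Longrightarrow> J +>\<^bsub>D\<^esub> x \<in> carrier M"
  by (simp add: M_carrier)

lemma M_add: "x \<in> carrier D \<Longrightarrow> y \<in> carrier D \<Longrightarrow>
    (J +>\<^bsub>D\<^esub> x) \<oplus>\<^bsub>M\<^esub> (J +>\<^bsub>D\<^esub> y) = J +>\<^bsub>D\<^esub> (x \<oplus>\<^bsub>D\<^esub> y)"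
  by (simp add: J.a_rcos_sum[symmetric] M_def quotient_module_def set_add_def set_mult_def right_regular_def)

text \<open>The union in \<open>quotient_module\<close> collapses because \<open>J\<close> absorbs
  multiplication on the right, the side on which \<open>D\<close> acts.\<close>

lemma M_smult: "(r \<odot>\<^bsub>M\<^esub> (J +>\<^bsub>D\<^esub> x)) = J +>\<^bsub>D\<^esub> (x \<otimes>\<^bsub>D\<^esub> r)"
  if "x \<in> carrier D" "r \<in> carrier D"
proof -
  have "r \<odot>\<^bsub>M\<^esub> (J +>\<^bsub>D\<^esub> x) = (\<Union>y\<in>J +>\<^bsub>D\<^esub> x. J +>\<^bsub>D\<^esub> (y \<otimes>\<^bsub>D\<^esub> r))"
    by (simp add: M_def quotient_module_def coset_right_regular) (simp add: right_regular_def)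
  also have "\<dots> = J +>\<^bsub>D\<^esub> (x \<otimes>\<^bsub>D\<^esub> r)"
    by (rule J.UN_coset) (use that J_mult in \<open>simp_all add: D.l_distr J.coset_absorb\<close>)
  finally show ?thesis .
qed

lemma relations_closed: "tensor_relations D M N \<subseteq> carrier F"
proof -
  have add: "x \<oplus>\<^bsub>M\<^esub> x' \<in> carrier M" if "x \<in> carrier M" "x' \<in> carrier M" for x x'
    using that M_add by (auto simp: M_carrier)
  have sm: "r \<odot>\<^bsub>M\<^esub> x \<in> carrier M" if "r \<in> carrier D" "x \<in> carrier M" for r x
    using that M_smult by (auto simp: M_carrier)
  have diff: "u - v \<in> carrier F" if "u \<in> carrier F" "v \<in> carrier F" for u v
    using that keys_diff[of u v] by auto
  show ?thesis
    unfolding tensor_relations_def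
    by (auto simp del: carrier_free_Abelian_group_iff intro!: diff intro: add sm smult_closed)
qed

sublocale F: comm_group F
  by (rule abelian_free_Abelian_group)

lemma T_subgroup: "subgroup T F"
  unfolding T_def tensor_kernel_def by (rule F.generate_is_subgroup[OF relations_closed])

lemma T_subset: "T \<subseteq> carrier F"
  using T_subgroup by (rule subgroup.subset)

lemma T_zero: "0 \<in> T"
  using subgroup.one_closed[OF T_subgroup] by simp

lemma T_add: "u \<in> T \<Longrightarrow> v \<in> T \<Longrightarrow> u + v \<in> T"
  using subgroup.m_closed[OF T_subgroup] by simp

lemma T_minus: "u \<in> T \<Longrightarrow> - u \<in> T"
  using subgroup.m_inv_closed[OF T_subgroup, of u] T_subset by auto

lemma T_diff: "u \<in> T \<Longrightarrow> v \<in> T \<Longrightarrow> u - v \<in> T"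
  using T_add[of u "- v"] T_minus[of v] by simp

lemma relation_in_T: "u \<in> tensor_relations D M N \<Longrightarrow> u \<in> T"
  by (simp add: T_def tensor_kernel_def generate.incl)

lemma T_add_l: "x \<in> carrier M \<Longrightarrow> x' \<in> carrier M \<Longrightarrow> y \<in> carrier N \<Longrightarrow>
    frag_of (x \<oplus>\<^bsub>M\<^esub> x', y) - frag_of (x, y) - frag_of (x', y) \<in> T"
  by (rule relation_in_T) (auto simp: tensor_relations_def)

lemma T_add_r: "x \<in> carrier M \<Longrightarrow> y \<in> carrier N \<Longrightarrow> y' \<in> carrier N \<Longrightarrow>
    frag_of (x, y \<oplus>\<^bsub>N\<^esub> y') - frag_of (x, y) - frag_of (x, y') \<in> T"
  by (rule relation_in_T) (auto simp: tensor_relations_def)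

lemma T_smult: "r \<in> carrier D \<Longrightarrow> x \<in> carrier M \<Longrightarrow> y \<in> carrier N \<Longrightarrow>
    frag_of (r \<odot>\<^bsub>M\<^esub> x, y) - frag_of (x, r \<odot>\<^bsub>N\<^esub> y) \<in> T"
  by (rule relation_in_T) (auto simp: tensor_relations_def)

lemma T_minimal:
  assumes "subgroup H F" "tensor_relations D M N \<subseteq> H" shows "T \<subseteq> H"
  unfolding T_def tensor_kernel_def by (rule F.generate_subgroup_incl[OF assms(2,1)])

lemma scalar_closed: "scalar c u \<in> carrier F" if "c \<in> carrier K" "u \<in> carrier F"
proof -
  have "Poly_Mapping.keys (case z of (x, y) \<Rightarrow> frag_of (x, act c y)) \<subseteq> carrier M \<times> carrier N"
    if "z \<in> carrier M \<times> carrier N" for z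
    using that act_closed[OF \<open>c \<in> carrier K\<close>] by (cases z) simp
  moreover have "Poly_Mapping.keys u \<subseteq> carrier M \<times> carrier N" using that by simp
  ultimately have "Poly_Mapping.keys (scalar c u) \<subseteq> carrier M \<times> carrier N"
    by (intro order_trans[OF keys_frag_extend] UN_least) blast
  then show ?thesis by simp
qed

text \<open>Applying \<open>act c\<close> to second components turns every relation into a relation
  of the same kind; for the balancing relation this is the commutation of \<open>act\<close> with
  \<open>D\<close>. Hence scalar multiplication descends to the tensor product.\<close>

lemma scalar_T:
  assumes c: "c \<in> carrier K" and "u \<in> T" shows "scalar c u \<in> T"
proof -
  let ?H = "{u \<in> carrier F. scalar c u \<in> T}"
  have "T \<subseteq> ?H"
  proof (rule T_minimal)
    show "subgroup ?H F"
    proof (rule F.subgroupI)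
      fix u assume "u \<in> ?H"
      then show "inv\<^bsub>F\<^esub> u \<in> ?H" by (simp add: frag_extend_minus T_minus)
    next
      fix u v assume "u \<in> ?H" "v \<in> ?H"
      then show "u \<otimes>\<^bsub>F\<^esub> v \<in> ?H"
        using F.m_closed[of u v] by (simp add: frag_extend_add T_add)
    qed (use T_zero in \<open>auto intro!: exI[of _ 0]\<close>)
    have "scalar c u \<in> T" if "u \<in> tensor_relations D M N" for u
      using that unfolding tensor_relations_def
    proof (elim UnE CollectE exE conjE)
      fix x x' y assume u: "u = frag_of (x \<oplus>\<^bsub>M\<^esub> x', y) - frag_of (x, y) - frag_of (x', y)"
        and "x \<in> carrier M" "x' \<in> carrier M" "y \<in> carrier N"
      then show ?thesis
        using T_add_l[of x x' "act c y"] act_closed[OF c] by (simp add: u frag_extend_diff)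
    next
      fix x y y' assume u: "u = frag_of (x, y \<oplus>\<^bsub>N\<^esub> y') - frag_of (x, y) - frag_of (x, y')"
        and "x \<in> carrier M" "y \<in> carrier N" "y' \<in> carrier N"
      then show ?thesis
        using T_add_r[of x "act c y" "act c y'"] act_closed[OF c] act_add[OF c]
        by (simp add: u frag_extend_diff)
    next
      fix r x y assume u: "u = frag_of (r \<odot>\<^bsub>M\<^esub> x, y) - frag_of (x, r \<odot>\<^bsub>N\<^esub> y)"
        and "r \<in> carrier D" "x \<in> carrier M" "y \<in> carrier N"
      then show ?thesis
        using T_smult[of r x "act c y"] act_closed[OF c] act_smult[OF c]
        by (simp add: u frag_extend_diff)
    qed
    then show "tensor_relations D M N \<subseteq> ?H" using relations_closed by blast
  qed
  then show ?thesis using assms by blast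
qed

lemma one_coset: "J +>\<^bsub>D\<^esub> \<one>\<^bsub>D\<^esub> \<in> carrier M"
  by (simp add: M_closed)

text \<open>The coset of \<open>r\<close> is the coset of \<open>\<one>\<close> acted on by
  \<open>r\<close>, so the balancing relation moves \<open>r\<close> to the second factor.\<close>

lemma T_one_smult: "r \<in> carrier D \<Longrightarrow> y \<in> carrier N \<Longrightarrow>
    frag_of (J +>\<^bsub>D\<^esub> r, y) - frag_of (J +>\<^bsub>D\<^esub> \<one>\<^bsub>D\<^esub>, r \<odot>\<^bsub>N\<^esub> y) \<in> T"
  using T_smult[OF _ one_coset] by (simp add: M_smult)

lemma T_zero_r: "x \<in> carrier M \<Longrightarrow> frag_of (x, \<zero>\<^bsub>N\<^esub>) \<in> T"
  using T_minus[OF T_add_r[of x "\<zero>\<^bsub>N\<^esub>" "\<zero>\<^bsub>N\<^esub>"]] by simp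

lemma T_zero_l: "y \<in> carrier N \<Longrightarrow> frag_of (J, y) \<in> T"
proof -
  assume y: "y \<in> carrier N"
  have 0: "J +>\<^bsub>D\<^esub> \<zero>\<^bsub>D\<^esub> = J" by (rule J.a_rcos_const) simp
  show ?thesis
    using T_minus[OF T_add_l[OF M_closed M_closed y, of "\<zero>\<^bsub>D\<^esub>" "\<zero>\<^bsub>D\<^esub>"]]
    by (simp add: M_add) (simp add: 0)
qed

text \<open>\<open>M\<close> is generated by the coset of \<open>\<one>\<close>: each elementary
  tensor can be given this first component, and then sums and differences are formed in the
  second.\<close>

lemma tensor_normal_form:
  assumes "u \<in> carrier F"
  obtains y where "y \<in> carrier N" "u - frag_of (J +>\<^bsub>D\<^esub> \<one>\<^bsub>D\<^esub>, y) \<in> T"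
proof -
  let ?e = "J +>\<^bsub>D\<^esub> \<one>\<^bsub>D\<^esub>"
  have keys: "Poly_Mapping.keys u \<subseteq> carrier M \<times> carrier N" using assms by simp
  have "\<exists>y\<in>carrier N. u - frag_of (?e, y) \<in> T"
  proof (rule free_Abelian_group_induct[OF keys, where P = "\<lambda>u. \<exists>y\<in>carrier N. u - frag_of (?e, y) \<in> T"])
    show "\<exists>y\<in>carrier N. 0 - frag_of (?e, y) \<in> T"
      using T_minus[OF T_zero_r[OF one_coset]] by (intro bexI[of _ "\<zero>\<^bsub>N\<^esub>"]) auto
  next
    fix u v
    assume "\<exists>y\<in>carrier N. u - frag_of (?e, y) \<in> T" "\<exists>y\<in>carrier N. v - frag_of (?e, y) \<in> T"
    then obtain y z where yz: "y \<in> carrier N" "z \<in> carrier N"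
      and T: "u - frag_of (?e, y) \<in> T" "v - frag_of (?e, z) \<in> T" by blast
    have "frag_of (?e, (y \<ominus>\<^bsub>N\<^esub> z) \<oplus>\<^bsub>N\<^esub> z) - frag_of (?e, y \<ominus>\<^bsub>N\<^esub> z) - frag_of (?e, z) \<in> T"
      by (rule T_add_r[OF one_coset]) (use yz in auto)
    moreover have "(y \<ominus>\<^bsub>N\<^esub> z) \<oplus>\<^bsub>N\<^esub> z = y" using yz by (simp add: N.minus_eq N.a_assoc N.l_neg)
    ultimately have "frag_of (?e, y) - frag_of (?e, y \<ominus>\<^bsub>N\<^esub> z) - frag_of (?e, z) \<in> T" by simp
    from T_add[OF T_diff[OF T] this] have "u - v - frag_of (?e, y \<ominus>\<^bsub>N\<^esub> z) \<in> T"
      by (simp add: algebra_simps)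
    then show "\<exists>y\<in>carrier N. u - v - frag_of (?e, y) \<in> T" using yz by blast
  next
    fix a assume "a \<in> carrier M \<times> carrier N"
    then obtain x y where "x \<in> carrier D" "y \<in> carrier N" "a = (J +>\<^bsub>D\<^esub> x, y)"
      by (auto simp: M_carrier)
    then show "\<exists>y\<in>carrier N. frag_of a - frag_of (?e, y) \<in> T"
      using T_one_smult smult_closed by blast
  qed
  then show ?thesis using that by blast
qed

text \<open>The elements \<open>y\<close> for which 1 tensor \<open>y\<close> vanishes form a set to
  which \<open>S_minimal\<close> applies: for \<open>r \<in> J\<close>, the tensor of 1 with
  \<open>r y\<close> equals that of the coset of \<open>r\<close> with \<open>y\<close>, and this
  coset is zero. It yields injectivity of the isomorphism below.\<close>

lemma one_tensor_in_T:
  assumes "y \<in> carrier N" "i y \<in> S"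
  shows "frag_of (J +>\<^bsub>D\<^esub> \<one>\<^bsub>D\<^esub>, y) \<in> T"
proof -
  let ?e = "J +>\<^bsub>D\<^esub> \<one>\<^bsub>D\<^esub>"
  let ?Z = "{y \<in> carrier N. frag_of (?e, y) \<in> T}"
  have "y \<in> ?Z"
  proof (rule S_minimal)
    show "subgroup ?Z (add_monoid N)"
    proof (rule N.add.subgroupI)
      fix y assume y: "y \<in> ?Z"
      have "frag_of (?e, y \<oplus>\<^bsub>N\<^esub> \<ominus>\<^bsub>N\<^esub> y) - frag_of (?e, y) - frag_of (?e, \<ominus>\<^bsub>N\<^esub> y) \<in> T"
        by (rule T_add_r[OF one_coset]) (use y in auto)
      then have r: "frag_of (?e, \<zero>\<^bsub>N\<^esub>) - frag_of (?e, y) - frag_of (?e, \<ominus>\<^bsub>N\<^esub> y) \<in> T"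
        using y by (simp add: N.r_neg)
      show "\<ominus>\<^bsub>N\<^esub> y \<in> ?Z"
        using T_diff[OF T_diff[OF T_zero_r[OF one_coset], of "frag_of (?e, y)"] r] y
        by (simp add: algebra_simps)
    next
      fix y z assume yz: "y \<in> ?Z" "z \<in> ?Z"
      then have "frag_of (?e, y \<oplus>\<^bsub>N\<^esub> z) - frag_of (?e, y) - frag_of (?e, z) \<in> T"
        by (intro T_add_r[OF one_coset]) auto
      from T_add[OF T_add[OF this] , of "frag_of (?e, z)" "frag_of (?e, y)"] yz
      show "y \<oplus>\<^bsub>N\<^esub> z \<in> ?Z" by simp
    qed (use T_zero_r[OF one_coset] in auto)
    show "act c y \<in> ?Z" if "c \<in> carrier K" "y \<in> ?Z" for c y
      using scalar_T[OF that(1), of "frag_of (?e, y)"] that act_closed by simp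
    show "r \<odot>\<^bsub>N\<^esub> y \<in> ?Z" if r: "r \<in> J" and y: "y \<in> carrier N" for r y
    proof -
      have rD: "r \<in> carrier D" using r by simp
      have "frag_of (J, y) - frag_of (?e, r \<odot>\<^bsub>N\<^esub> y) \<in> T"
        using T_one_smult[OF rD y] J.a_rcos_const[OF r] by simp
      from T_diff[OF T_zero_l[OF y] this] show ?thesis using smult_closed[OF rD y] by simp
    qed
  qed (use assms in auto)
  then show ?thesis by simp
qed

section \<open>The isomorphism with the quotient of W by S\<close>

abbreviation Q where "Q \<equiv> quotient_module W S"

lemma Q_carrier: "carrier Q = (\<lambda>w. S +>\<^bsub>W\<^esub> w) ` carrier W"
  by (auto simp: quotient_module_def A_RCOSETS_def RCOSETS_def a_r_coset_def)

lemma Q_smult: "c \<odot>\<^bsub>Q\<^esub> (S +>\<^bsub>W\<^esub> w) = S +>\<^bsub>W\<^esub> (c \<odot>\<^bsub>W\<^esub> w)" if "c \<in> carrier K" "w \<in> carrier W"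
proof -
  have "c \<odot>\<^bsub>Q\<^esub> (S +>\<^bsub>W\<^esub> w) = (\<Union>x\<in>S +>\<^bsub>W\<^esub> w. S +>\<^bsub>W\<^esub> (c \<odot>\<^bsub>W\<^esub> x))"
    by (simp add: quotient_module_def)
  also have "\<dots> = S +>\<^bsub>W\<^esub> (c \<odot>\<^bsub>W\<^esub> w)"
    by (rule S.UN_coset)
      (use that submodule.smult_closed[OF S] in \<open>simp_all add: W.smult_r_distr S.coset_absorb\<close>)
  finally show ?thesis .
qed

text \<open>The universal property of the free abelian group gives a homomorphism \<open>h\<close>,
  and the first isomorphism theorem applies once its kernel is \<open>T\<close>. That
  \<open>T\<close> is contained in the kernel is bilinearity and balancedness; the converse is where
  minimality of \<open>S\<close> enters.\<close>

theorem tensor_iso: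
  "\<exists>\<Theta>. linear_iso K (tensor_product D M N act) Q \<Theta> \<and>
      (\<forall>x\<in>carrier D. \<forall>y\<in>carrier N. \<Theta> (tensor D M N (J +>\<^bsub>D\<^esub> x) y) = S +>\<^bsub>W\<^esub> i (x \<odot>\<^bsub>N\<^esub> y))"
proof -
  let ?e = "J +>\<^bsub>D\<^esub> \<one>\<^bsub>D\<^esub>"
  \<comment> \<open>The carrier and addition of \<open>Q\<close> in the guise of a multiplicative
    group, the form required for free groups and factor groups.\<close>
  interpret G: comm_group "W A_Mod S" by (rule S.a_factorgroup_is_comm_group)
  have G_mult: "(S +>\<^bsub>W\<^esub> v) \<otimes>\<^bsub>W A_Mod S\<^esub> (S +>\<^bsub>W\<^esub> w) = S +>\<^bsub>W\<^esub> (v \<oplus>\<^bsub>W\<^esub> w)"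
    if "v \<in> carrier W" "w \<in> carrier W" for v w
    using that by (simp add: S.a_rcos_sum)
  have G_carrier: "carrier (W A_Mod S) = (\<lambda>w. S +>\<^bsub>W\<^esub> w) ` carrier W"
    by (auto simp: A_FactGroup_def FactGroup_def RCOSETS_def a_r_coset_def)
  have G_one: "\<one>\<^bsub>W A_Mod S\<^esub> = S"
    by (simp add: A_FactGroup_def FactGroup_def)
  \<comment> \<open>Two representatives of \<open>t\<close> differ by an element of
    \<open>J\<close>, which changes the value of \<open>i\<close> by an element of \<open>S\<close>
    according to \<open>J_smult\<close>.\<close>
  define f where "f = (\<lambda>(t, y). \<Union>x\<in>t. S +>\<^bsub>W\<^esub> i (x \<odot>\<^bsub>N\<^esub> y))"
  have f: "f (J +>\<^bsub>D\<^esub> x, y) = S +>\<^bsub>W\<^esub> i (x \<odot>\<^bsub>N\<^esub> y)" if "x \<in> carrier D" "y \<in> carrier N" for x y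
    unfolding f_def prod.case
    by (rule J.UN_coset) (use that smult_closed i_closed J_smult in
      \<open>simp_all add: smult_l_distr i_add S.coset_absorb\<close>)
  have f_closed: "f ` (carrier M \<times> carrier N) \<subseteq> carrier (W A_Mod S)"
  proof clarify
    fix t y assume "t \<in> carrier M" "y \<in> carrier N"
    then show "f (t, y) \<in> carrier (W A_Mod S)"
      unfolding M_carrier G_carrier using f smult_closed i_closed by blast
  qed
  obtain h where h: "h \<in> hom F (W A_Mod S)"
    and hf: "\<forall>z\<in>carrier M \<times> carrier N. h (frag_of z) = f z"
    by (rule G.free_Abelian_group_universal[OF f_closed]) (rule that, assumption, blast)
  interpret h: group_hom F "W A_Mod S" h
    by (simp add: group_hom_def group_hom_axioms_def h F.group_axioms G.group_axioms)
  have h_frag: "h (frag_of (J +>\<^bsub>D\<^esub> x, y)) = S +>\<^bsub>W\<^esub> i (x \<odot>\<^bsub>N\<^esub> y)"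
    if "x \<in> carrier D" "y \<in> carrier N" for x y
    using bspec[OF hf SigmaI[OF M_closed[OF that(1)] that(2)]] f[OF that] by (rule trans)
  have h_e: "h (frag_of (?e, y)) = S +>\<^bsub>W\<^esub> i y" if "y \<in> carrier N" for y
    using h_frag[OF D.one_closed that] smult_one[OF that] by simp
  let ?ker = "kernel F (W A_Mod S) h"
  have h_add: "h (u + v) = h u \<otimes>\<^bsub>W A_Mod S\<^esub> h v" if "u \<in> carrier F" "v \<in> carrier F" for u v
    using h.hom_mult[OF that] by simp
  have ker_eq: "u - v \<in> ?ker \<longleftrightarrow> h u = h v" if "u \<in> carrier F" "v \<in> carrier F" for u v
  proof -
    have "u - v = u \<otimes>\<^bsub>F\<^esub> inv\<^bsub>F\<^esub> v" using that by simp
    then have d: "u - v \<in> carrier F"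
      using F.m_closed[OF that(1) F.inv_closed[OF that(2)]] by (simp only:)
    have "h u = h (u - v) \<otimes>\<^bsub>W A_Mod S\<^esub> h v"
      using h_add[OF d that(2)] by simp
    then show ?thesis
      using d G.r_cancel_one[OF h.hom_closed[OF that(2)] h.hom_closed[OF d]]
      by (simp only: kernel_def mem_Collect_eq) blast
  qed
  have frag_in: "frag_of (J +>\<^bsub>D\<^esub> x, y) \<in> carrier F" if "x \<in> carrier D" "y \<in> carrier N" for x y
    using that M_closed by simp
  have T_ker: "T \<subseteq> ?ker"
  proof (rule T_minimal)
    show "subgroup ?ker F" by (rule h.subgroup_kernel)
    show "tensor_relations D M N \<subseteq> ?ker"
    proof
      fix u assume "u \<in> tensor_relations D M N"
      then consider
          (1) x x' y where "u = frag_of ((J +>\<^bsub>D\<^esub> x) \<oplus>\<^bsub>M\<^esub> (J +>\<^bsub>D\<^esub> x'), y) - frag_of (J +>\<^bsub>D\<^esub> x, y) - frag_of (J +>\<^bsub>D\<^esub> x', y)"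
            "x \<in> carrier D" "x' \<in> carrier D" "y \<in> carrier N"
        | (2) x y y' where "u = frag_of (J +>\<^bsub>D\<^esub> x, y \<oplus>\<^bsub>N\<^esub> y') - frag_of (J +>\<^bsub>D\<^esub> x, y) - frag_of (J +>\<^bsub>D\<^esub> x, y')"
            "x \<in> carrier D" "y \<in> carrier N" "y' \<in> carrier N"
        | (3) r x y where "u = frag_of (r \<odot>\<^bsub>M\<^esub> (J +>\<^bsub>D\<^esub> x), y) - frag_of (J +>\<^bsub>D\<^esub> x, r \<odot>\<^bsub>N\<^esub> y)"
            "r \<in> carrier D" "x \<in> carrier D" "y \<in> carrier N"
        unfolding tensor_relations_def M_carrier by blast
      then show "u \<in> ?ker"
      proof cases
        case 1
        have "h (frag_of (J +>\<^bsub>D\<^esub> (x \<oplus>\<^bsub>D\<^esub> x'), y)) = h (frag_of (J +>\<^bsub>D\<^esub> x, y) + frag_of (J +>\<^bsub>D\<^esub> x', y))"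
          using 1 smult_closed i_closed
          by (subst h_add) (simp_all only: frag_in h_frag D.add.m_closed smult_l_distr i_add G_mult)
        then have "frag_of (J +>\<^bsub>D\<^esub> (x \<oplus>\<^bsub>D\<^esub> x'), y) - (frag_of (J +>\<^bsub>D\<^esub> x, y) + frag_of (J +>\<^bsub>D\<^esub> x', y)) \<in> ?ker"
          by (subst ker_eq) (use 1 F.m_closed[OF frag_in frag_in] in \<open>simp_all add: M_closed\<close>)
        then show ?thesis using 1 by (simp add: M_add diff_diff_eq)
      next
        case 2
        have "h (frag_of (J +>\<^bsub>D\<^esub> x, y \<oplus>\<^bsub>N\<^esub> y')) = h (frag_of (J +>\<^bsub>D\<^esub> x, y) + frag_of (J +>\<^bsub>D\<^esub> x, y'))"
          using 2 smult_closed i_closed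
          by (subst h_add) (simp_all only: frag_in h_frag N.add.m_closed smult_r_distr i_add G_mult)
        then have "frag_of (J +>\<^bsub>D\<^esub> x, y \<oplus>\<^bsub>N\<^esub> y') - (frag_of (J +>\<^bsub>D\<^esub> x, y) + frag_of (J +>\<^bsub>D\<^esub> x, y')) \<in> ?ker"
          by (subst ker_eq) (use 2 F.m_closed[OF frag_in frag_in] in \<open>simp_all add: M_closed\<close>)
        then show ?thesis using 2 by (simp add: diff_diff_eq)
      next
        case 3
        have "h (frag_of (J +>\<^bsub>D\<^esub> (x \<otimes>\<^bsub>D\<^esub> r), y)) = h (frag_of (J +>\<^bsub>D\<^esub> x, r \<odot>\<^bsub>N\<^esub> y))"
          using 3 by (simp add: h_frag smult_assoc smult_closed)
        then show ?thesis
          using 3 by (simp add: M_smult ker_eq M_closed smult_closed)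
      qed
    qed
  qed
  \<comment> \<open>Modulo \<open>T\<close> an element of the kernel is 1 tensor \<open>y\<close>;
    its image is the coset of \<open>i y\<close>, so \<open>i y\<close> lies in
    \<open>S\<close>.\<close>
  have "?ker \<subseteq> T"
  proof
    fix u assume u: "u \<in> ?ker"
    then have uF: "u \<in> carrier F" by (simp add: kernel_def)
    then obtain y where y: "y \<in> carrier N" "u - frag_of (?e, y) \<in> T"
      by (rule tensor_normal_form)
    then have "h u = h (frag_of (?e, y))"
      using T_ker ker_eq[OF uF frag_in[OF D.one_closed y(1)]] by blast
    then have "S +>\<^bsub>W\<^esub> i y = S" using u y(1) h_e by (simp add: kernel_def G_one)
    then have "i y \<in> S" using S.coset_eq_self_iff i_closed y(1) by blast
    then have "frag_of (?e, y) \<in> T" using one_tensor_in_T y by blast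
    from T_add[OF y(2) this] show "u \<in> T" by simp
  qed
  then have ker: "?ker = T" using T_ker by blast
  define \<Theta> where "\<Theta> = (\<lambda>t. the_elem (h ` t))"
  have "h ` carrier F = carrier (W A_Mod S)"
  proof
    show "carrier (W A_Mod S) \<subseteq> h ` carrier F"
    proof
      fix q assume "q \<in> carrier (W A_Mod S)"
      then obtain y where "y \<in> carrier N" "q = S +>\<^bsub>W\<^esub> i y"
        unfolding G_carrier i_surj[symmetric] by blast
      then show "q \<in> h ` carrier F"
        using h_e frag_in[OF D.one_closed] by (metis image_eqI)
    qed
  qed (use h.hom_closed in blast)
  then have iso: "\<Theta> \<in> iso (F Mod T) (W A_Mod S)"
    using h.FactGroup_iso_set by (simp add: ker \<Theta>_def)
  have \<Theta>: "\<Theta> (T #>\<^bsub>F\<^esub> u) = h u" if u: "u \<in> carrier F" for u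
  proof -
    have "h ` (T #>\<^bsub>F\<^esub> u) = {h u}"
    proof -
      have "h (t + u) = h u" if "t \<in> T" for t
      proof -
        have "t \<in> ?ker" using that T_ker by blast
        then have t: "t \<in> carrier F" "h t = \<one>\<^bsub>W A_Mod S\<^esub>" by (auto simp: kernel_def)
        show ?thesis using h_add[OF t(1) u] unfolding t(2) G.l_one[OF h.hom_closed[OF u]] .
      qed
      then show ?thesis using T_zero by (auto simp: r_coset_def)
    qed
    then show ?thesis by (simp add: \<Theta>_def)
  qed
  \<comment> \<open>By the normal form it suffices to compare both sides on a single tensor 1 tensor
    \<open>y\<close>, where the claim is \<open>i_act\<close>.\<close>
  have h_scalar: "h (scalar c u) = c \<odot>\<^bsub>Q\<^esub> h u" if c: "c \<in> carrier K" and u: "u \<in> carrier F" for c u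
  proof -
    obtain y where y: "y \<in> carrier N" "u - frag_of (?e, y) \<in> T"
      using u by (rule tensor_normal_form)
    have "scalar c u - frag_of (?e, act c y) \<in> T"
      using scalar_T[OF c y(2)] by (simp add: frag_extend_diff)
    then have "h (scalar c u) = S +>\<^bsub>W\<^esub> i (act c y)"
      using T_ker ker_eq[OF scalar_closed[OF c u] frag_in[OF D.one_closed act_closed[OF c y(1)]]]
        h_e[OF act_closed[OF c y(1)]] by auto
    moreover have "h u = S +>\<^bsub>W\<^esub> i y"
      using T_ker y(2) ker_eq[OF u frag_in[OF D.one_closed y(1)]] h_e[OF y(1)] by auto
    ultimately show ?thesis using Q_smult[OF c i_closed[OF y(1)]] i_act[OF c y(1)] by simp
  qed
  have "linear_iso K (tensor_product D M N act) Q \<Theta>"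
    unfolding linear_iso_def
  proof (intro conjI ballI)
    show "bij_betw \<Theta> (carrier (tensor_product D M N act)) (carrier Q)"
      using iso by (simp add: iso_def tensor_product_def Let_def T_def[symmetric] Q_carrier G_carrier)
  next
    fix s t assume "s \<in> carrier (tensor_product D M N act)" "t \<in> carrier (tensor_product D M N act)"
    then show "\<Theta> (s \<oplus>\<^bsub>tensor_product D M N act\<^esub> t) = \<Theta> s \<oplus>\<^bsub>Q\<^esub> \<Theta> t"
      using iso
      by (simp add: iso_def hom_def tensor_product_def Let_def T_def[symmetric] quotient_module_def)
  next
    fix c t assume c: "c \<in> carrier K" and "t \<in> carrier (tensor_product D M N act)"
    then obtain u where u: "u \<in> carrier F" "t = T #>\<^bsub>F\<^esub> u"
      by (auto simp: tensor_product_def Let_def T_def[symmetric] FactGroup_def RCOSETS_def)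
    \<comment> \<open>Scalar multiplication on the tensor product is a union over all
      representatives of the coset; this shows that they all contribute the same set.\<close>
    have "T #>\<^bsub>F\<^esub> scalar c (v + u) = T #>\<^bsub>F\<^esub> scalar c u" if "v \<in> T" for v
      using F.coset_mult_assoc[OF T_subset, of "scalar c v" "scalar c u"] scalar_T[OF c that]
        F.coset_join2[OF _ T_subgroup] T_subset scalar_closed[OF c u(1)]
      by (simp add: frag_extend_add subset_iff)
    then have "(\<Union>u\<in>t. T #>\<^bsub>F\<^esub> scalar c u) = T #>\<^bsub>F\<^esub> scalar c u"
      using T_zero by (force simp: u(2) r_coset_def)
    then have "c \<odot>\<^bsub>tensor_product D M N act\<^esub> t = T #>\<^bsub>F\<^esub> scalar c u"
      by (simp add: tensor_product_def Let_def T_def[symmetric])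
    then show "\<Theta> (c \<odot>\<^bsub>tensor_product D M N act\<^esub> t) = c \<odot>\<^bsub>Q\<^esub> \<Theta> t"
      using u \<Theta> scalar_closed[OF c u(1)] h_scalar[OF c u(1)] by simp
  qed
  moreover have "\<Theta> (tensor D M N (J +>\<^bsub>D\<^esub> x) y) = S +>\<^bsub>W\<^esub> i (x \<odot>\<^bsub>N\<^esub> y)"
    if "x \<in> carrier D" "y \<in> carrier N" for x y
    unfolding tensor_def T_def[symmetric] using \<Theta>[OF frag_in[OF that]] h_frag[OF that] by simp
  ultimately show ?thesis by blast
qed

end

section \<open>The ring of differential operators\<close>

locale diff_ops = algebra K A for K :: "'k ring" and A :: "('k, 'a) module"
begin

abbreviation D where "D \<equiv> diff_op_ring K A"
abbreviation E where "E \<equiv> linear_endos K A"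
abbreviation comm where "comm \<equiv> func_commutator A"

definition zero_op where "zero_op = (\<lambda>x\<in>carrier A. \<zero>\<^bsub>A\<^esub>)"
definition add_op where "add_op P Q = (\<lambda>x\<in>carrier A. P x \<oplus>\<^bsub>A\<^esub> Q x)"

lemma op_apply:
  assumes "x \<in> carrier A"
  shows "zero_op x = \<zero>\<^bsub>A\<^esub>" "add_op P Q x = P x \<oplus>\<^bsub>A\<^esub> Q x" "compose (carrier A) P Q x = P (Q x)"
    "comm P f x = P (f \<otimes>\<^bsub>A\<^esub> x) \<ominus>\<^bsub>A\<^esub> f \<otimes>\<^bsub>A\<^esub> P x" "mult_op A f x = f \<otimes>\<^bsub>A\<^esub> x"
  using assms by (simp_all add: zero_op_def add_op_def func_commutator_def mult_op_def compose_eq)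

lemma op_extensional:
  "zero_op \<in> extensional (carrier A)" "add_op P Q \<in> extensional (carrier A)"
  "compose (carrier A) P Q \<in> extensional (carrier A)" "comm P f \<in> extensional (carrier A)"
  "mult_op A f \<in> extensional (carrier A)"
  by (simp_all add: zero_op_def add_op_def func_commutator_def mult_op_def compose_def)

lemma upto_0: "diff_ops_upto K A 0 = {P \<in> E. \<forall>f\<in>carrier A. comm P f = zero_op}"
  by (simp add: zero_op_def)

declare diff_ops_upto.simps(1) [simp del]

lemma endo_ext:
  assumes "P \<in> E" "Q \<in> E" "\<And>x. x \<in> carrier A \<Longrightarrow> P x = Q x" shows "P = Q"
  using assms by (intro extensionalityI[of P "carrier A"]) (auto simp: linear_endos_def PiE_def)

lemma endo:
  assumes "P \<in> E"
  shows "x \<in> carrier A \<Longrightarrow> P x \<in> carrier A"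
    and "x \<in> carrier A \<Longrightarrow> y \<in> carrier A \<Longrightarrow> P (x \<oplus>\<^bsub>A\<^esub> y) = P x \<oplus>\<^bsub>A\<^esub> P y"
    and "c \<in> carrier K \<Longrightarrow> x \<in> carrier A \<Longrightarrow> P (c \<odot>\<^bsub>A\<^esub> x) = c \<odot>\<^bsub>A\<^esub> P x"
  using assms by (auto simp: linear_endos_def)

lemma endo_zero: "P \<in> E \<Longrightarrow> P \<zero>\<^bsub>A\<^esub> = \<zero>\<^bsub>A\<^esub>"
  using endo(2)[of P "\<zero>\<^bsub>A\<^esub>" "\<zero>\<^bsub>A\<^esub>"] endo(1)[of P "\<zero>\<^bsub>A\<^esub>"]
  by (metis M.add.l_cancel_one' M.l_zero M.zero_closed)

lemma endo_minus: "P \<in> E \<Longrightarrow> x \<in> carrier A \<Longrightarrow> P (\<ominus>\<^bsub>A\<^esub> x) = \<ominus>\<^bsub>A\<^esub> P x"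
  using endo(2)[of P "\<ominus>\<^bsub>A\<^esub> x" x] endo(1)[of P] endo_zero[of P]
  by (simp add: M.l_neg M.minus_equality[symmetric])

lemma endoI:
  assumes "P \<in> extensional (carrier A)" "\<And>x. x \<in> carrier A \<Longrightarrow> P x \<in> carrier A"
    and "\<And>x y. x \<in> carrier A \<Longrightarrow> y \<in> carrier A \<Longrightarrow> P (x \<oplus>\<^bsub>A\<^esub> y) = P x \<oplus>\<^bsub>A\<^esub> P y"
    and "\<And>c x. c \<in> carrier K \<Longrightarrow> x \<in> carrier A \<Longrightarrow> P (c \<odot>\<^bsub>A\<^esub> x) = c \<odot>\<^bsub>A\<^esub> P x"
  shows "P \<in> E"
  using assms by (auto simp: linear_endos_def PiE_def)

lemma zero_op_endo: "zero_op \<in> E"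
  by (rule endoI) (simp_all add: op_apply op_extensional)

lemma add_op_endo: "P \<in> E \<Longrightarrow> Q \<in> E \<Longrightarrow> add_op P Q \<in> E"
  by (rule endoI) (simp_all add: op_apply op_extensional endo smult_r_distr M.a_ac)

lemma compose_endo: "P \<in> E \<Longrightarrow> Q \<in> E \<Longrightarrow> compose (carrier A) P Q \<in> E"
  by (rule endoI) (simp_all add: op_apply op_extensional endo)

lemma comm_endo: "P \<in> E \<Longrightarrow> f \<in> carrier A \<Longrightarrow> comm P f \<in> E"
  by (rule endoI)
    (simp_all add: op_apply op_extensional endo r_distr smult_r_distr smult_assoc2 m_comm[of f]
      minus_eq smult_r_minus M.minus_add l_distr M.a_ac)

lemma mult_op_endo: "f \<in> carrier A \<Longrightarrow> mult_op A f \<in> E"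
  by (rule endoI) (simp_all add: op_apply op_extensional r_distr m_comm[of f] smult_assoc2 l_distr)

section \<open>The filtration by order\<close>

lemma upto_endo: "P \<in> diff_ops_upto K A n \<Longrightarrow> P \<in> E"
  by (cases n) (simp_all add: upto_0)

lemma comm_zero: "f \<in> carrier A \<Longrightarrow> comm zero_op f = zero_op"
  by (rule endo_ext) (simp_all add: op_apply minus_eq comm_endo zero_op_endo)

lemma zero_upto: "zero_op \<in> diff_ops_upto K A n"
  by (induction n) (simp_all add: upto_0 zero_op_endo comm_zero)

lemma add_zero_op: "P \<in> E \<Longrightarrow> add_op zero_op P = P"
  by (rule endo_ext) (simp_all add: op_apply endo add_op_endo zero_op_endo)

lemma comm_add:
  assumes "P \<in> E" "Q \<in> E" "f \<in> carrier A"
  shows "comm (add_op P Q) f = add_op (comm P f) (comm Q f)"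
  by (rule endo_ext)
    (use assms in \<open>simp_all add: comm_endo add_op_endo op_apply endo r_distr minus_eq M.minus_add M.a_ac\<close>)

lemma add_upto: "P \<in> diff_ops_upto K A n \<Longrightarrow> Q \<in> diff_ops_upto K A n \<Longrightarrow> add_op P Q \<in> diff_ops_upto K A n"
proof (induction n arbitrary: P Q)
  case 0
  then have "comm (add_op P Q) f = zero_op" if "f \<in> carrier A" for f
    using that by (simp add: upto_0 comm_add add_zero_op zero_op_endo)
  then show ?case using 0 by (simp add: upto_0 add_op_endo)
next
  case (Suc n)
  then show ?case by (simp add: add_op_endo comm_add)
qed

lemma upto_Suc: "P \<in> diff_ops_upto K A n \<Longrightarrow> P \<in> diff_ops_upto K A (Suc n)"
proof (induction n arbitrary: P)
  case 0
  then show ?case using zero_upto[of 0] by (simp add: upto_0)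
next
  case (Suc n)
  then show ?case by simp
qed

lemma upto_mono: "m \<le> n \<Longrightarrow> P \<in> diff_ops_upto K A m \<Longrightarrow> P \<in> diff_ops_upto K A n"
  by (induction n rule: dec_induct) (auto intro: upto_Suc simp del: diff_ops_upto.simps)

text \<open>The commutator with \<open>f\<close> is a derivation of the algebra of endomorphisms:
  insert \<open>P (f \<otimes> Q x)\<close> with both signs.\<close>

lemma comm_compose:
  assumes "P \<in> E" "Q \<in> E" "f \<in> carrier A"
  shows "comm (compose (carrier A) P Q) f =
    add_op (compose (carrier A) P (comm Q f)) (compose (carrier A) (comm P f) Q)"
proof (rule endo_ext)
  fix x assume x: "x \<in> carrier A"
  have "P (Q (f \<otimes>\<^bsub>A\<^esub> x)) \<ominus>\<^bsub>A\<^esub> f \<otimes>\<^bsub>A\<^esub> P (Q x) =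
      P (Q (f \<otimes>\<^bsub>A\<^esub> x) \<ominus>\<^bsub>A\<^esub> f \<otimes>\<^bsub>A\<^esub> Q x) \<oplus>\<^bsub>A\<^esub> (P (f \<otimes>\<^bsub>A\<^esub> Q x) \<ominus>\<^bsub>A\<^esub> f \<otimes>\<^bsub>A\<^esub> P (Q x))"
    using assms x by (simp add: minus_eq endo endo_minus M.a_assoc M.r_neg1)
  then show "comm (compose (carrier A) P Q) f x =
    add_op (compose (carrier A) P (comm Q f)) (compose (carrier A) (comm P f) Q) x"
    using assms x by (simp add: op_apply endo)
qed (use assms in \<open>auto intro!: comm_endo compose_endo add_op_endo\<close>)

lemma compose_zero: "P \<in> E \<Longrightarrow> compose (carrier A) P zero_op = zero_op"
  "P \<in> E \<Longrightarrow> compose (carrier A) zero_op P = zero_op"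
  by (rule endo_ext; simp add: op_apply endo_zero endo compose_endo zero_op_endo)+

text \<open>The induction runs on \<open>m + n\<close> because each summand of the commutator lowers
  the order of only one factor. A factor of order zero has no lower order to pass to, but its
  commutator is zero; hence the case distinctions.\<close>

lemma compose_upto:
  "P \<in> diff_ops_upto K A m \<Longrightarrow> Q \<in> diff_ops_upto K A n \<Longrightarrow>
     compose (carrier A) P Q \<in> diff_ops_upto K A (m + n)"
proof (induction "m + n" arbitrary: m n P Q)
  case 0
  then have PQ: "P \<in> E" "Q \<in> E" using upto_endo by blast+
  moreover have "comm (compose (carrier A) P Q) f = zero_op" if "f \<in> carrier A" for f
    using 0 that PQ by (simp add: upto_0 comm_compose compose_zero add_zero_op zero_op_endo)
  ultimately show ?case using 0 by (simp add: upto_0 compose_endo)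
next
  case (Suc k)
  have PQ: "P \<in> E" "Q \<in> E" using Suc.prems upto_endo by blast+
  have "comm (compose (carrier A) P Q) f \<in> diff_ops_upto K A k" if f: "f \<in> carrier A" for f
  proof -
    have "compose (carrier A) P (comm Q f) \<in> diff_ops_upto K A k"
    proof (cases n)
      case 0
      then show ?thesis using Suc.prems f PQ zero_upto by (simp add: upto_0 compose_zero)
    next
      case (Suc n')
      then have "k = m + n'" using \<open>Suc k = m + n\<close> by simp
      then show ?thesis using Suc.hyps(1)[of m n' P "comm Q f"] Suc.prems f \<open>n = Suc n'\<close> by simp
    qed
    moreover have "compose (carrier A) (comm P f) Q \<in> diff_ops_upto K A k"
    proof (cases m)
      case 0
      then show ?thesis using Suc.prems f PQ zero_upto by (simp add: upto_0 compose_zero)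
    next
      case (Suc m')
      then have "k = m' + n" using \<open>Suc k = m + n\<close> by simp
      then show ?thesis using Suc.hyps(1)[of m' n "comm P f" Q] Suc.prems f \<open>m = Suc m'\<close> by simp
    qed
    ultimately show ?thesis using add_upto comm_compose[OF PQ f] by simp
  qed
  then show ?case using PQ unfolding Suc.hyps(2)[symmetric] by (simp add: compose_endo)
qed

lemma mult_op_upto: "f \<in> carrier A \<Longrightarrow> mult_op A f \<in> diff_ops_upto K A 0"
  unfolding upto_0
  by (auto simp: op_apply mult_op_endo comm_endo zero_op_endo m_lcomm minus_eq M.r_neg intro!: endo_ext)

text \<open>By the Leibniz rule the commutator of \<xi> with \<open>f\<close> is multiplication by
  \<open>\<xi> f\<close>, an operator of order zero.\<close>

lemma vector_field_upto: "\<xi> \<in> vector_fields K A \<Longrightarrow> \<xi> \<in> diff_ops_upto K A (Suc 0)"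
proof -
  assume \<xi>: "\<xi> \<in> vector_fields K A"
  then have E: "\<xi> \<in> E" by (simp add: vector_fields_def)
  have "comm \<xi> f = mult_op A (\<xi> f)" if f: "f \<in> carrier A" for f
  proof (rule endo_ext)
    fix x assume x: "x \<in> carrier A"
    have "\<xi> (f \<otimes>\<^bsub>A\<^esub> x) = \<xi> f \<otimes>\<^bsub>A\<^esub> x \<oplus>\<^bsub>A\<^esub> f \<otimes>\<^bsub>A\<^esub> \<xi> x"
      using \<xi> f x by (simp add: vector_fields_def)
    then show "comm \<xi> f x = mult_op A (\<xi> f) x"
      using f x E by (simp add: op_apply minus_eq M.a_assoc M.r_neg endo)
  qed (use f E in \<open>auto intro: comm_endo mult_op_endo endo\<close>)
  then show ?thesis using E mult_op_upto endo(1) by simp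
qed

section \<open>The ring axioms for differential operators\<close>

lemma D_carrier: "carrier D = (\<Union>n. diff_ops_upto K A n)"
  and D_mult: "P \<otimes>\<^bsub>D\<^esub> Q = compose (carrier A) P Q"
  and D_one: "\<one>\<^bsub>D\<^esub> = (\<lambda>x\<in>carrier A. x)"
  and D_zero: "\<zero>\<^bsub>D\<^esub> = zero_op"
  and D_add: "P \<oplus>\<^bsub>D\<^esub> Q = add_op P Q"
  by (simp_all add: diff_op_ring_def zero_op_def add_op_def)

lemma D_endo: "P \<in> carrier D \<Longrightarrow> P \<in> E"
  using upto_endo by (auto simp: D_carrier)

lemma D_I: "P \<in> diff_ops_upto K A n \<Longrightarrow> P \<in> carrier D"
  by (auto simp: D_carrier)

lemma mult_op_D: "f \<in> carrier A \<Longrightarrow> mult_op A f \<in> carrier D"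
  by (rule D_I[OF mult_op_upto])

lemma vector_field_D: "\<xi> \<in> vector_fields K A \<Longrightarrow> \<xi> \<in> carrier D"
  by (rule D_I[OF vector_field_upto])

lemma D_mult_closed: "P \<in> carrier D \<Longrightarrow> Q \<in> carrier D \<Longrightarrow> P \<otimes>\<^bsub>D\<^esub> Q \<in> carrier D"
  using compose_upto D_I unfolding D_mult by (metis D_carrier UN_E)

lemma D_add_closed: "P \<in> carrier D \<Longrightarrow> Q \<in> carrier D \<Longrightarrow> P \<oplus>\<^bsub>D\<^esub> Q \<in> carrier D"
proof -
  assume "P \<in> carrier D" "Q \<in> carrier D"
  then obtain m n where "P \<in> diff_ops_upto K A m" "Q \<in> diff_ops_upto K A n" by (auto simp: D_carrier)
  then have "P \<in> diff_ops_upto K A (max m n)" "Q \<in> diff_ops_upto K A (max m n)"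
    using upto_mono[of m "max m n"] upto_mono[of n "max m n"] by auto
  then show ?thesis unfolding D_add by (intro D_I add_upto)
qed

lemma D_one_eq: "\<one>\<^bsub>D\<^esub> = mult_op A \<one>\<^bsub>A\<^esub>"
  unfolding D_one mult_op_def by (rule restrict_ext) simp

lemma D_one_apply: "x \<in> carrier A \<Longrightarrow> \<one>\<^bsub>D\<^esub> x = x"
  by (simp add: D_one)

lemma D_ring: "ring D"
proof -
  have one: "\<one>\<^bsub>D\<^esub> \<in> carrier D" unfolding D_one_eq by (rule mult_op_D) simp
  have zero: "\<zero>\<^bsub>D\<^esub> \<in> carrier D" unfolding D_zero by (rule D_I[OF zero_upto])
  have ext: "P = Q" if "P \<in> carrier D" "Q \<in> carrier D" "\<And>x. x \<in> carrier A \<Longrightarrow> P x = Q x" for P Q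
    using endo_ext[OF D_endo D_endo] that by blast
  note cl = D_add_closed D_mult_closed one zero
  note app = D_add D_mult D_zero op_apply D_one_apply
  note endo = endo[OF D_endo]
  show ?thesis
  proof (rule ringI)
    show "abelian_group D"
    proof (rule abelian_groupI)
      fix P assume P: "P \<in> carrier D"
      let ?N = "mult_op A (\<ominus>\<^bsub>A\<^esub> \<one>\<^bsub>A\<^esub>) \<otimes>\<^bsub>D\<^esub> P"
      have N: "?N \<in> carrier D" by (intro D_mult_closed mult_op_D P) simp
      have "?N \<oplus>\<^bsub>D\<^esub> P = \<zero>\<^bsub>D\<^esub>"
        by (rule ext) (use P N endo in \<open>simp_all add: cl, simp add: app l_minus M.l_neg\<close>)
      then show "\<exists>Q\<in>carrier D. Q \<oplus>\<^bsub>D\<^esub> P = \<zero>\<^bsub>D\<^esub>" using N by blast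
    next
      fix P assume P: "P \<in> carrier D"
      show "\<zero>\<^bsub>D\<^esub> \<oplus>\<^bsub>D\<^esub> P = P"
        by (rule ext) (use P endo in \<open>simp_all add: cl, simp add: app\<close>)
    next
      fix P Q R assume "P \<in> carrier D" "Q \<in> carrier D" "R \<in> carrier D"
      then show "P \<oplus>\<^bsub>D\<^esub> Q \<oplus>\<^bsub>D\<^esub> R = P \<oplus>\<^bsub>D\<^esub> (Q \<oplus>\<^bsub>D\<^esub> R)"
        by (intro ext) (use endo in \<open>simp_all add: cl, simp add: app M.a_assoc\<close>)
    next
      fix P Q assume "P \<in> carrier D" "Q \<in> carrier D"
      then show "P \<oplus>\<^bsub>D\<^esub> Q = Q \<oplus>\<^bsub>D\<^esub> P"
        by (intro ext) (use endo in \<open>simp_all add: cl, simp add: app M.a_comm\<close>)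
    qed (use cl in auto)
    show "monoid D"
    proof (rule monoidI)
      fix P Q R assume "P \<in> carrier D" "Q \<in> carrier D" "R \<in> carrier D"
      then show "P \<otimes>\<^bsub>D\<^esub> Q \<otimes>\<^bsub>D\<^esub> R = P \<otimes>\<^bsub>D\<^esub> (Q \<otimes>\<^bsub>D\<^esub> R)"
        by (intro ext) (use endo in \<open>simp_all add: cl, simp add: app\<close>)
    next
      fix P assume P: "P \<in> carrier D"
      show "\<one>\<^bsub>D\<^esub> \<otimes>\<^bsub>D\<^esub> P = P"
        by (rule ext) (use P endo in \<open>simp_all add: cl, simp add: app\<close>)
      show "P \<otimes>\<^bsub>D\<^esub> \<one>\<^bsub>D\<^esub> = P"
        by (rule ext) (use P endo in \<open>simp_all add: cl, simp add: app\<close>)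
    qed (use cl in auto)
  next
    fix P Q R assume PQR: "P \<in> carrier D" "Q \<in> carrier D" "R \<in> carrier D"
    show "(P \<oplus>\<^bsub>D\<^esub> Q) \<otimes>\<^bsub>D\<^esub> R = P \<otimes>\<^bsub>D\<^esub> R \<oplus>\<^bsub>D\<^esub> Q \<otimes>\<^bsub>D\<^esub> R"
      by (rule ext) (use PQR endo in \<open>simp_all add: cl, simp add: app\<close>)
    show "R \<otimes>\<^bsub>D\<^esub> (P \<oplus>\<^bsub>D\<^esub> Q) = R \<otimes>\<^bsub>D\<^esub> P \<oplus>\<^bsub>D\<^esub> R \<otimes>\<^bsub>D\<^esub> Q"
      by (rule ext) (use PQR endo in \<open>simp_all add: cl, simp add: app\<close>)
  qed
qed

end

section \<open>The direct image\<close>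

text \<open>Serves for spans over \<open>K\<close> and for right ideals of D alike. Closure of the
  carrier under scalars makes the carrier a submodule containing \<open>S\<close>, so the
  intersection is not over an empty family.\<close>

lemma gen_submodule:
  assumes "abelian_group M" "S \<subseteq> carrier M"
    and "\<And>r x. r \<in> carrier R \<Longrightarrow> x \<in> carrier M \<Longrightarrow> r \<odot>\<^bsub>M\<^esub> x \<in> carrier M"
  shows "submodule (gen_submodule R M S) R M" and "S \<subseteq> gen_submodule R M S"
proof -
  interpret M: abelian_group M by fact
  have carrier: "submodule (carrier M) R M"
    using assms(3) M.add.subgroup_self by (simp add: submodule_def submodule_axioms_def)
  have "subgroup (gen_submodule R M S) (add_monoid M)"
    unfolding gen_submodule_def
    by (rule M.add.subgroups_Inter) (use carrier assms(2) in \<open>auto simp: submodule_def\<close>)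
  moreover have "r \<odot>\<^bsub>M\<^esub> x \<in> gen_submodule R M S" if "r \<in> carrier R" "x \<in> gen_submodule R M S" for r x
    using that by (auto simp: gen_submodule_def intro: submodule.smult_closed)
  ultimately show "submodule (gen_submodule R M S) R M"
    by (simp add: submodule_def submodule_axioms_def)
  show "S \<subseteq> gen_submodule R M S" by (auto simp: gen_submodule_def)
qed

lemma gen_submodule_minimal: "submodule N R M \<Longrightarrow> S \<subseteq> N \<Longrightarrow> gen_submodule R M S \<subseteq> N"
  by (auto simp: gen_submodule_def)

lemma abelian_group_right_regular: "ring D \<Longrightarrow> abelian_group (right_regular D)"
proof -
  assume "ring D"
  then interpret D: ring D .
  show ?thesis
    by (rule abelian_groupI) (auto simp: right_regular_def D.a_ac intro: D.l_neg D.a_inv_closed)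
qed

lemma abelian_group_functions: "abelian_group A \<Longrightarrow> abelian_group (functions_as_D_module A)"
proof -
  assume "abelian_group A"
  then interpret A: abelian_group A .
  show ?thesis
    by (rule abelian_groupI) (auto simp: functions_as_D_module_def A.a_ac intro: A.l_neg A.a_inv_closed)
qed

text \<open>An instance of \<open>tensor_iso\<close> with N = O_V and W = O_X. Two points remain:
  operators in \<open>J\<close> send O_V into the preimage of \<open>S\<close>, and this preimage is
  no larger than J O_V requires. The second needs every Hamiltonian field to have a lift in
  \<open>J\<close>.\<close>

theorem direct_image_M_phi:
  assumes X: "affine_poisson_variety K OX br" and V: "smooth_affine_variety K OV"
    and i: "i \<in> closed_embeddings K OV OX"
    and phi: "\<And>f. f \<in> carrier OY \<Longrightarrow> phi f \<in> carrier OX"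
  shows "\<exists>\<Theta>. linear_iso K (direct_image_pt K OV (M_phi K OX br OY phi OV i))
                (bracket_quotient K OX br OY phi) \<Theta> \<and>
            (\<forall>P\<in>carrier (diff_op_ring K OV). \<forall>g\<in>carrier OV.
               \<Theta> (tensor (diff_op_ring K OV) (M_phi K OX br OY phi OV i) (functions_as_D_module OV)
                    (M_phi_ideal K OX br OY phi OV i +>\<^bsub>right_regular (diff_op_ring K OV)\<^esub> P) g)
               = bracket_span K OX br OY phi +>\<^bsub>OX\<^esub> i (P g))"
proof -
  have "algebra K OV" using V by (simp add: smooth_affine_variety_def affine_variety_def)
  then interpret V: diff_ops K OV by (simp add: diff_ops_def)
  have OX: "algebra K OX"
    using X unfolding affine_poisson_variety_def affine_variety_def by blast
  then interpret X: algebra K OX .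
  have i_alg: "i \<in> alg_hom K OV OX" and i_surj: "i ` carrier OV = carrier OX"
    using i by (auto simp: closed_embeddings_def)
  then have "i \<in> ring_hom OV OX" by (simp add: alg_hom_def)
  then interpret i: ring_hom_ring OV OX i
    by (intro ring_hom_ringI2 cring.axioms(1) V.M_cring X.M_cring)
  have i_smult: "i (c \<odot>\<^bsub>OV\<^esub> x) = c \<odot>\<^bsub>OX\<^esub> i x" if "c \<in> carrier K" "x \<in> carrier OV" for c x
    using i_alg that by (simp add: alg_hom_def)
  have br: "\<And>f g. f \<in> carrier OX \<Longrightarrow> g \<in> carrier OX \<Longrightarrow> br f g \<in> carrier OX"
    "\<And>f g h. f \<in> carrier OX \<Longrightarrow> g \<in> carrier OX \<Longrightarrow> h \<in> carrier OX \<Longrightarrow>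
       br f (g \<oplus>\<^bsub>OX\<^esub> h) = br f g \<oplus>\<^bsub>OX\<^esub> br f h"
    "\<And>c f g. c \<in> carrier K \<Longrightarrow> f \<in> carrier OX \<Longrightarrow> g \<in> carrier OX \<Longrightarrow>
       br f (c \<odot>\<^bsub>OX\<^esub> g) = c \<odot>\<^bsub>OX\<^esub> br f g"
    "\<And>f g h. f \<in> carrier OX \<Longrightarrow> g \<in> carrier OX \<Longrightarrow> h \<in> carrier OX \<Longrightarrow>
       br f (g \<otimes>\<^bsub>OX\<^esub> h) = br f g \<otimes>\<^bsub>OX\<^esub> h \<oplus>\<^bsub>OX\<^esub> g \<otimes>\<^bsub>OX\<^esub> br f h"
    using X unfolding affine_poisson_variety_def by blast+
  have br_zero: "br f \<zero>\<^bsub>OX\<^esub> = \<zero>\<^bsub>OX\<^esub>" if "f \<in> carrier OX" for f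
    using br(2)[OF that, of "\<zero>\<^bsub>OX\<^esub>" "\<zero>\<^bsub>OX\<^esub>"] br(1)[OF that, of "\<zero>\<^bsub>OX\<^esub>"]
    by (metis X.M.add.l_cancel_one' X.M.l_zero X.M.zero_closed)
  define D where "D = diff_op_ring K OV"
  define N where "N = functions_as_D_module OV"
  define J where "J = M_phi_ideal K OX br OY phi OV i"
  define S where "S = bracket_span K OX br OY phi"
  define gens where "gens = mult_op OV ` a_kernel OV OX i \<union> hamiltonian_lifts K OX br OY phi OV i"
  have J_def': "J = gen_submodule D (right_regular D) gens"
    by (simp only: J_def M_phi_ideal_def D_def gens_def)
  have D_ring: "ring D" unfolding D_def by (rule V.D_ring)
  interpret D: ring D by (rule D_ring)
  have D_eq: "carrier D = carrier V.D" "\<And>P Q. P \<otimes>\<^bsub>D\<^esub> Q = compose (carrier OV) P Q"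
    by (simp_all only: D_def V.D_mult)
  have endo: "P \<in> linear_endos K OV" if "P \<in> carrier D" for P
    using that V.D_endo by (simp only: D_eq)
  have ker: "a_kernel OV OX i = {x \<in> carrier OV. i x = \<zero>\<^bsub>OX\<^esub>}" by (simp only: a_kernel_def')
  have rr: "carrier (right_regular D) = carrier D" "\<And>r x. r \<odot>\<^bsub>right_regular D\<^esub> x = x \<otimes>\<^bsub>D\<^esub> r"
    by (simp_all add: right_regular_def)
  have gens_D: "gens \<subseteq> carrier D"
    unfolding gens_def D_eq hamiltonian_lifts_def ker
    using V.mult_op_D V.vector_field_D by blast
  have J: "submodule J D (right_regular D)" "gens \<subseteq> J"
    unfolding J_def'
    by (rule gen_submodule; use abelian_group_right_regular[OF D_ring] gens_D D.m_closed in \<open>simp add: rr\<close>)+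
  define brs where "brs = {br (phi f) g | f g. f \<in> carrier OY \<and> g \<in> carrier OX}"
  have S_def': "S = gen_submodule K OX brs" by (simp only: S_def bracket_span_def brs_def)
  have "brs \<subseteq> carrier OX" unfolding brs_def using br(1) phi by blast
  then have S: "submodule S K OX" "brs \<subseteq> S"
    unfolding S_def'
    by (rule gen_submodule[OF X.M.abelian_group_axioms]; use X.smult_closed in simp)+
  have lift: "\<exists>\<xi>\<in>hamiltonian_lifts K OX br OY phi OV i. \<forall>g\<in>carrier OV. i (\<xi> g) = br (phi f) (i g)"
    if f: "f \<in> carrier OY" for f
  proof -
    have "derivation_along K OV OX i (\<lambda>g. br (phi f) (i g))"
      unfolding derivation_along_def using br phi[OF f] i_smult by simp
    then obtain \<xi> where "\<xi> \<in> vector_fields K OV" "\<forall>g\<in>carrier OV. i (\<xi> g) = br (phi f) (i g)"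
      using derivation_lifts[OF V OX i] by blast
    \<comment> \<open>A lift preserves the ideal of X automatically: if \<open>i x\<close> is zero
      then \<open>i (\<xi> x)\<close> is the bracket of \<open>phi f\<close> with zero.\<close>
    moreover from this have "\<xi> ` a_kernel OV OX i \<subseteq> a_kernel OV OX i"
      using br_zero[OF phi[OF f]] by (auto simp: ker vector_fields_def linear_endos_def)
    ultimately show ?thesis using f unfolding hamiltonian_lifts_def by blast
  qed
  have S_sub: "S \<subseteq> carrier OX" "\<zero>\<^bsub>OX\<^esub> \<in> S" "\<And>x. x \<in> S \<Longrightarrow> \<ominus>\<^bsub>OX\<^esub> x \<in> S"
    "\<And>x y. x \<in> S \<Longrightarrow> y \<in> S \<Longrightarrow> x \<oplus>\<^bsub>OX\<^esub> y \<in> S"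
    using X.submoduleE(1,3,5)[OF S(1)] subgroup.one_closed[OF submodule.axioms(1)[OF S(1)]]
    by (blast, simp only: monoid.simps, blast+)
  interpret RR: abelian_group "right_regular D"
    by (rule abelian_group_right_regular[OF D_ring])
  have RR_add: "(P \<oplus>\<^bsub>right_regular D\<^esub> Q) y = P y \<oplus>\<^bsub>OV\<^esub> Q y" and RR_zero: "\<zero>\<^bsub>right_regular D\<^esub> y = \<zero>\<^bsub>OV\<^esub>"
    if "y \<in> carrier OV" for P Q y
    using that by (simp_all add: right_regular_def D_def diff_op_ring_def)
  have J_S: "i (r y) \<in> S" if "r \<in> J" "y \<in> carrier OV" for r y
  proof -
    \<comment> \<open>These operators form a right ideal: composing on the right only changes the
      function to which the operator is applied. So it is enough to test the generators of
      \<open>J\<close>.\<close>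
    let ?R = "{r \<in> carrier D. \<forall>y\<in>carrier OV. i (r y) \<in> S}"
    have "J \<subseteq> ?R"
      unfolding J_def'
    proof (rule gen_submodule_minimal)
      have "subgroup ?R (add_monoid (right_regular D))"
      proof (rule RR.add.subgroupI)
        show "?R \<subseteq> carrier (right_regular D)" by (auto simp: rr)
        show "?R \<noteq> {}"
          using RR.zero_closed RR_zero S_sub(2) by (auto simp: rr intro!: exI[of _ "\<zero>\<^bsub>right_regular D\<^esub>"])
      next
        fix r assume r: "r \<in> ?R"
        let ?n = "\<ominus>\<^bsub>right_regular D\<^esub> r"
        have n: "?n \<in> carrier D" using r RR.a_inv_closed[of r] by (simp add: rr)
        have "i (?n y) \<in> S" if y: "y \<in> carrier OV" for y
        proof -
          \<comment> \<open>The negative is known only as an inverse in the additive group, so its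
            values are read off from the sum with \<open>r\<close>.\<close>
          have "r \<oplus>\<^bsub>right_regular D\<^esub> ?n = \<zero>\<^bsub>right_regular D\<^esub>"
            using r by (intro RR.r_neg) (simp add: rr)
          then have "r y \<oplus>\<^bsub>OV\<^esub> ?n y = \<zero>\<^bsub>OV\<^esub>" using RR_add[OF y, of r ?n] RR_zero[OF y] by simp
          moreover have c: "r y \<in> carrier OV" "?n y \<in> carrier OV"
            using r n y V.endo(1)[OF endo] by auto
          ultimately have "?n y = \<ominus>\<^bsub>OV\<^esub> r y" by (metis V.M.minus_equality V.M.a_comm)
          then show ?thesis using r y c S_sub(3) by simp
        qed
        then show "?n \<in> ?R" using n by simp
      next
        fix r s assume rs: "r \<in> ?R" "s \<in> ?R"
        have "i ((r \<oplus>\<^bsub>right_regular D\<^esub> s) y) \<in> S" if y: "y \<in> carrier OV" for y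
          using rs y V.endo(1)[OF endo] S_sub(4) by (simp add: RR_add)
        then show "r \<oplus>\<^bsub>right_regular D\<^esub> s \<in> ?R"
          using rs RR.a_closed[of r s] by (simp add: rr)
      qed
      moreover have "x \<otimes>\<^bsub>D\<^esub> r \<in> ?R" if "r \<in> carrier D" "x \<in> ?R" for r x
        using that D.m_closed V.endo(1)[OF endo] by (simp add: D_eq(2) compose_eq)
      ultimately show "submodule ?R D (right_regular D)"
        by (simp add: submodule_def submodule_axioms_def rr)
      show "gens \<subseteq> ?R"
      proof
        fix r assume r: "r \<in> gens"
        then have rD: "r \<in> carrier D" using gens_D by blast
        have "i (r y) \<in> S" if y: "y \<in> carrier OV" for y
          using r unfolding gens_def
        proof
          assume "r \<in> mult_op OV ` a_kernel OV OX i"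
          then obtain x where "x \<in> carrier OV" "i x = \<zero>\<^bsub>OX\<^esub>" "r = mult_op OV x" by (auto simp: ker)
          then show ?thesis using y S_sub(2) by (simp add: V.op_apply)
        next
          assume "r \<in> hamiltonian_lifts K OX br OY phi OV i"
          then obtain f where "f \<in> carrier OY" "\<forall>g\<in>carrier OV. i (r g) = br (phi f) (i g)"
            by (auto simp: hamiltonian_lifts_def)
          then have "i (r y) \<in> brs" using y i.hom_closed unfolding brs_def by blast
          then show ?thesis using S(2) by blast
        qed
        then show "r \<in> ?R" using rD by blast
      qed
    qed
    then show ?thesis using that by blast
  qed
  have N_eq: "carrier N = carrier OV" "\<And>P y. P \<odot>\<^bsub>N\<^esub> y = P y" "\<And>x y. x \<oplus>\<^bsub>N\<^esub> y = x \<oplus>\<^bsub>OV\<^esub> y" "\<zero>\<^bsub>N\<^esub> = \<zero>\<^bsub>OV\<^esub>"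
    by (simp_all add: N_def functions_as_D_module_def)
  have T: "quotient_tensor D N K OX J (smult OV) S i"
  proof (intro quotient_tensor.intro quotient_tensor_axioms.intro)
    show "ring D" by (rule D_ring)
    show "abelian_group N" unfolding N_def by (rule abelian_group_functions[OF V.M.abelian_group_axioms])
    show "module K OX" by (rule algebra.axioms(1)[OF OX])
    fix Z y
    assume Z: "subgroup Z (add_monoid N)" and ZK: "\<And>c y. c \<in> carrier K \<Longrightarrow> y \<in> Z \<Longrightarrow> c \<odot>\<^bsub>OV\<^esub> y \<in> Z"
      and ZJ: "\<And>r y. r \<in> J \<Longrightarrow> y \<in> carrier N \<Longrightarrow> r \<odot>\<^bsub>N\<^esub> y \<in> Z"
      and y: "y \<in> carrier N" "i y \<in> S"
    have Z_sub: "Z \<subseteq> carrier OV" "\<zero>\<^bsub>OV\<^esub> \<in> Z" "\<And>u v. u \<in> Z \<Longrightarrow> v \<in> Z \<Longrightarrow> u \<oplus>\<^bsub>OV\<^esub> v \<in> Z"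
      using subgroup.subset[OF Z] subgroup.one_closed[OF Z] subgroup.m_closed[OF Z] by (simp_all add: N_eq)
    have Z_minus: "\<ominus>\<^bsub>OV\<^esub> u \<in> Z" if "u \<in> Z" for u
      using ZK[of "\<ominus>\<^bsub>K\<^esub> \<one>\<^bsub>K\<^esub>" u] that Z_sub(1) by (auto simp: V.smult_l_minus)
    \<comment> \<open>Multiplication by \<open>x\<close> belongs to \<open>J\<close>, and its value
      at the constant function 1 is \<open>x\<close>.\<close>
    have ker_Z: "x \<in> Z" if "x \<in> carrier OV" "i x = \<zero>\<^bsub>OX\<^esub>" for x
    proof -
      have "mult_op OV x \<in> J" using J(2) that unfolding gens_def ker by blast
      from ZJ[OF this, of "\<one>\<^bsub>OV\<^esub>"] show ?thesis using that(1) by (simp add: N_eq V.op_apply)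
    qed
    \<comment> \<open>The image of \<open>Z\<close> is a subspace, so only brackets have to be
      checked: the bracket of \<open>phi f\<close> and \<open>i g'\<close> is the restriction of
      \<open>\<xi> g'\<close> for a lift \<xi> in \<open>J\<close>.\<close>
    have "S \<subseteq> i ` Z"
      unfolding S_def'
    proof (rule gen_submodule_minimal)
      show "submodule (i ` Z) K OX"
      proof (rule X.submoduleI)
        show "i ` Z \<subseteq> carrier OX" using Z_sub(1) by auto
        show "\<zero>\<^bsub>OX\<^esub> \<in> i ` Z" using Z_sub(2) by (metis i.hom_zero image_eqI)
      next
        fix w assume "w \<in> i ` Z"
        then obtain u where u: "u \<in> Z" "w = i u" by blast
        then have "\<ominus>\<^bsub>OX\<^esub> w = i (\<ominus>\<^bsub>OV\<^esub> u)" using Z_sub(1) by auto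
        then show "\<ominus>\<^bsub>OX\<^esub> w \<in> i ` Z" using Z_minus u(1) by blast
      next
        fix w w' assume "w \<in> i ` Z" "w' \<in> i ` Z"
        then obtain u u' where u: "u \<in> Z" "w = i u" "u' \<in> Z" "w' = i u'" by blast
        then have "w \<oplus>\<^bsub>OX\<^esub> w' = i (u \<oplus>\<^bsub>OV\<^esub> u')" using Z_sub(1) by (simp add: subset_iff)
        then show "w \<oplus>\<^bsub>OX\<^esub> w' \<in> i ` Z" using Z_sub(3) u by blast
      next
        fix c w assume c: "c \<in> carrier K" and "w \<in> i ` Z"
        then obtain u where u: "u \<in> Z" "w = i u" by blast
        then have "c \<odot>\<^bsub>OX\<^esub> w = i (c \<odot>\<^bsub>OV\<^esub> u)" using Z_sub(1) c i_smult by auto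
        then show "c \<odot>\<^bsub>OX\<^esub> w \<in> i ` Z" using ZK[OF c u(1)] by blast
      qed
      show "brs \<subseteq> i ` Z"
      proof
        fix b assume "b \<in> brs"
        then obtain f g where f: "f \<in> carrier OY" and g: "g \<in> carrier OX" "b = br (phi f) g"
          unfolding brs_def by blast
        then obtain g' where g': "g' \<in> carrier OV" "g = i g'" unfolding i_surj[symmetric] by blast
        obtain \<xi> where \<xi>: "\<xi> \<in> hamiltonian_lifts K OX br OY phi OV i"
          "\<forall>g\<in>carrier OV. i (\<xi> g) = br (phi f) (i g)"
          using lift[OF f] by blast
        then have "\<xi> \<in> J" using J(2) unfolding gens_def by blast
        then have "\<xi> g' \<in> Z" using ZJ[of \<xi> g'] g'(1) by (simp only: N_eq)
        moreover have "b = i (\<xi> g')" using bspec[OF \<xi>(2) g'(1)] g(2) g'(2) by (simp only:)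
        ultimately show "b \<in> i ` Z" by blast
      qed
    qed
    then obtain z where z: "z \<in> Z" "i y = i z" using y(2) by blast
    have yz: "y \<in> carrier OV" "z \<in> carrier OV" using y(1) z(1) Z_sub(1) by (auto simp: N_eq)
    \<comment> \<open>The elements \<open>y\<close> and \<open>z\<close> of O_V differ by a function
      vanishing on X, and such functions belong to \<open>Z\<close> by \<open>ker_Z\<close>.\<close>
    have "i (y \<oplus>\<^bsub>OV\<^esub> \<ominus>\<^bsub>OV\<^esub> z) = \<zero>\<^bsub>OX\<^esub>" using yz z(2) by (simp add: X.M.r_neg)
    then have "y \<oplus>\<^bsub>OV\<^esub> \<ominus>\<^bsub>OV\<^esub> z \<in> Z" using ker_Z yz by simp
    from Z_sub(3)[OF this z(1)] show "y \<in> Z" using yz by (simp add: V.M.a_assoc V.M.l_neg)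
  next
    fix r s y assume "r \<in> carrier D" "s \<in> carrier D" "y \<in> carrier N"
    then show "(r \<oplus>\<^bsub>D\<^esub> s) \<odot>\<^bsub>N\<^esub> y = r \<odot>\<^bsub>N\<^esub> y \<oplus>\<^bsub>N\<^esub> s \<odot>\<^bsub>N\<^esub> y"
      and "(r \<otimes>\<^bsub>D\<^esub> s) \<odot>\<^bsub>N\<^esub> y = r \<odot>\<^bsub>N\<^esub> (s \<odot>\<^bsub>N\<^esub> y)"
      by (simp_all add: N_eq D_def diff_op_ring_def compose_eq)
  next
    fix y assume "y \<in> carrier N"
    then show "\<one>\<^bsub>D\<^esub> \<odot>\<^bsub>N\<^esub> y = y" by (simp add: N_eq D_def V.D_one)
  next
    fix r y assume "r \<in> carrier D" "y \<in> carrier N"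
    then show "r \<odot>\<^bsub>N\<^esub> y \<in> carrier N" by (simp only: N_eq V.endo[OF endo])
  next
    fix r y z assume "r \<in> carrier D" "y \<in> carrier N" "z \<in> carrier N"
    then show "r \<odot>\<^bsub>N\<^esub> (y \<oplus>\<^bsub>N\<^esub> z) = r \<odot>\<^bsub>N\<^esub> y \<oplus>\<^bsub>N\<^esub> r \<odot>\<^bsub>N\<^esub> z"
      by (simp only: N_eq V.endo[OF endo])
  next
    fix c y assume "c \<in> carrier K" "y \<in> carrier N"
    then show "c \<odot>\<^bsub>OV\<^esub> y \<in> carrier N" and "i (c \<odot>\<^bsub>OV\<^esub> y) = c \<odot>\<^bsub>OX\<^esub> i y"
      by (simp_all only: N_eq V.smult_closed i_smult)
  next
    fix c y z assume "c \<in> carrier K" "y \<in> carrier N" "z \<in> carrier N"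
    then show "c \<odot>\<^bsub>OV\<^esub> (y \<oplus>\<^bsub>N\<^esub> z) = c \<odot>\<^bsub>OV\<^esub> y \<oplus>\<^bsub>N\<^esub> c \<odot>\<^bsub>OV\<^esub> z"
      by (simp only: N_eq V.smult_r_distr)
  next
    fix c r y assume "c \<in> carrier K" "r \<in> carrier D" "y \<in> carrier N"
    then show "c \<odot>\<^bsub>OV\<^esub> (r \<odot>\<^bsub>N\<^esub> y) = r \<odot>\<^bsub>N\<^esub> (c \<odot>\<^bsub>OV\<^esub> y)"
      by (simp only: N_eq V.endo(3)[OF endo])
  next
    fix y z assume "y \<in> carrier N" "z \<in> carrier N"
    then show "i (y \<oplus>\<^bsub>N\<^esub> z) = i y \<oplus>\<^bsub>OX\<^esub> i z" using i.hom_add[of y z] by (simp only: N_eq)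
  next
    fix r y assume "r \<in> J" "y \<in> carrier N"
    then show "i (r \<odot>\<^bsub>N\<^esub> y) \<in> S" by (simp only: N_eq J_S)
  qed (simp_all only: J(1) S(1) N_eq i_surj)
  have "M_phi K OX br OY phi OV i = quotient_tensor.M D J"
    by (simp only: M_phi_def quotient_tensor.M_def[OF T] D_def[symmetric] J_def[symmetric])
  moreover have "bracket_quotient K OX br OY phi = quotient_module OX S"
    by (simp only: bracket_quotient_def S_def)
  ultimately show ?thesis
    using quotient_tensor.tensor_iso[OF T]
    unfolding direct_image_pt_def D_def[symmetric] N_def[symmetric] J_def[symmetric] S_def[symmetric]
    by (simp only: quotient_tensor.coset_right_regular[OF T] N_eq)
qed

theorem proposition2p13:
  fixes K :: "'k ring"
    and OX :: "('k, 'x) module" and OY :: "('k, 'y) module" and OV :: "('k, 'v) module"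
    and br :: "'x \<Rightarrow> 'x \<Rightarrow> 'x" and phi :: "'y \<Rightarrow> 'x" and i :: "'v \<Rightarrow> 'x"
  assumes "algebraically_closed K" and "char_zero K"
    and "affine_poisson_variety K OX br"
    and "affine_variety K OY"
    and "phi \<in> alg_hom K OY OX"
    and "smooth_affine_variety K OV"
    and "i \<in> closed_embeddings K OV OX"
  shows "(\<exists>\<Theta>. linear_iso K (direct_image_pt K OV (M_phi K OX br OY phi OV i))
                (bracket_quotient K OX br OY phi) \<Theta> \<and>
            (\<forall>P\<in>carrier (diff_op_ring K OV). \<forall>g\<in>carrier OV.
               \<Theta> (tensor (diff_op_ring K OV) (M_phi K OX br OY phi OV i) (functions_as_D_module OV)
                    (M_phi_ideal K OX br OY phi OV i +>\<^bsub>right_regular (diff_op_ring K OV)\<^esub> P) g)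
               = bracket_span K OX br OY phi +>\<^bsub>OX\<^esub> i (P g)))
       \<and> (\<exists>\<Theta>. linear_iso K (direct_image_pt K OV (M_poisson K OX br OV i)) (HP0 K OX br) \<Theta> \<and>
            (\<forall>P\<in>carrier (diff_op_ring K OV). \<forall>g\<in>carrier OV.
               \<Theta> (tensor (diff_op_ring K OV) (M_poisson K OX br OV i) (functions_as_D_module OV)
                    (M_phi_ideal K OX br OX (\<lambda>f. f) OV i +>\<^bsub>right_regular (diff_op_ring K OV)\<^esub> P) g)
               = bracket_span K OX br OX (\<lambda>f. f) +>\<^bsub>OX\<^esub> i (P g)))"
proof (rule conjI)
  have phi: "phi f \<in> carrier OX" if "f \<in> carrier OY" for f
    using assms(5) that ring_hom_closed by (fastforce simp: alg_hom_def)
  show "\<exists>\<Theta>. linear_iso K (direct_image_pt K OV (M_phi K OX br OY phi OV i))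
                (bracket_quotient K OX br OY phi) \<Theta> \<and>
            (\<forall>P\<in>carrier (diff_op_ring K OV). \<forall>g\<in>carrier OV.
               \<Theta> (tensor (diff_op_ring K OV) (M_phi K OX br OY phi OV i) (functions_as_D_module OV)
                    (M_phi_ideal K OX br OY phi OV i +>\<^bsub>right_regular (diff_op_ring K OV)\<^esub> P) g)
               = bracket_span K OX br OY phi +>\<^bsub>OX\<^esub> i (P g))"
    by (rule direct_image_M_phi[OF assms(3,6,7) phi])
  have "HP0 K OX br = bracket_quotient K OX br OX (\<lambda>f. f)"
    by (simp only: HP0_def bracket_quotient_def bracket_span_def)
  then show "\<exists>\<Theta>. linear_iso K (direct_image_pt K OV (M_poisson K OX br OV i)) (HP0 K OX br) \<Theta> \<and>
            (\<forall>P\<in>carrier (diff_op_ring K OV). \<forall>g\<in>carrier OV.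
               \<Theta> (tensor (diff_op_ring K OV) (M_poisson K OX br OV i) (functions_as_D_module OV)
                    (M_phi_ideal K OX br OX (\<lambda>f. f) OV i +>\<^bsub>right_regular (diff_op_ring K OV)\<^esub> P) g)
               = bracket_span K OX br OX (\<lambda>f. f) +>\<^bsub>OX\<^esub> i (P g))"
    using direct_image_M_phi[OF assms(3,6,7), of OX "\<lambda>f. f"] by (simp only: M_poisson_def)
qed

end
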